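(* For any graph story $\langle T,\tau,W\rangle$ in which $T$ is a tree with $n$ vertices, one can construct in $O(n)$ time a drawing story of $\langle T,\tau,W\rangle$ that is planar, straight-line, and lies on an $(8W+1)\times(8W+1)$ grid.
   Context: A graph story $\langle G,\tau,W\rangle$ consists of a graph $G$ with $n$ vertices, a bijection $\tau:V(G)\to\{1,\dots,n\}$, and a positive integer $W$ (the window size); for $t=1,\dots,n+W-1$, $G_t$ is the subgraph of $G$ induced by $\{v: t-W<\tau(v)\leq t\}$. A drawing story is a sequence $\Gamma_1,\dots,\Gamma_{n+W-1}$ where $\Gamma_t$ is a drawing of $G_t$, every vertex is drawn at the same point in all $\Gamma_t$ containing it, and every edge is drawn by the same curve in all $\Gamma_t$ containing it. It is planar (resp. straight-line) if every $\Gamma_t$ is planar (resp. draws edges as straight-line segments). It lies on a $w\times h$ grid if all vertices are placed at integer-coordinate points of a grid $[a,b]\times[c,d]$ (integers) with $b-a+1=w$ and $d-c+1=h$, and all drawings lie within its bounding box. *)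

theory Defs
  imports "HOL-Analysis.Analysis" "Graph_Theory.Digraph_Component"
begin

section \<open>Graph stories\<close>

text \<open>
  Finite simple undirected graphs are the library's \<^locale>\<open>pair_graph\<close>s: finite, loop-free,
  symmetric digraphs without parallel arcs. An undirected edge is the two-element set of the ends
  of an arc (and of the reverse arc).
\<close>

definition edge_set :: "('a, 'b) pre_digraph \<Rightarrow> 'a set set" where
  "edge_set H = (\<lambda>e. {tail H e, head H e}) ` arcs H"

text \<open>
  The library constant \<^const>\<open>tree\<close> is unusable here: in a symmetric digraph the closed walk
  a, b, a is a \<^const>\<open>pre_digraph.cycle\<close>. The cycles of the undirected graph are exactly the
  cycles with at least three arcs. Connected graphs are nonempty by definition.
\<close>

definition undirected_tree :: "'a pair_pre_digraph \<Rightarrow> bool" where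
  "undirected_tree T \<longleftrightarrow>
     pair_graph T \<and> Digraph_Component.connected (with_proj T) \<and>
     \<not> (\<exists>p. pre_digraph.cycle (with_proj T) p \<and> 3 \<le> length p)"

definition graph_story :: "'a pair_pre_digraph \<Rightarrow> ('a \<Rightarrow> nat) \<Rightarrow> nat \<Rightarrow> bool" where
  "graph_story G \<tau> W \<longleftrightarrow>
     pair_graph G \<and> bij_betw \<tau> (pverts G) {1..card (pverts G)} \<and> 0 < W"

definition window_graph ::
    "'a pair_pre_digraph \<Rightarrow> ('a \<Rightarrow> nat) \<Rightarrow> nat \<Rightarrow> nat \<Rightarrow> ('a, 'a \<times> 'a) pre_digraph" where
  "window_graph G \<tau> W t =
     with_proj G \<restriction> {v \<in> pverts G. int t - int W < int (\<tau> v) \<and> \<tau> v \<le> t}"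

definition story_times :: "'a pair_pre_digraph \<Rightarrow> nat \<Rightarrow> nat set" where
  "story_times G W = {1..card (pverts G) + W - 1}"


section \<open>Drawings\<close>

text \<open>Curves are point sets, so that "the same curve" does not depend on a parametrization.\<close>

record 'a drawing =
  vpos :: "'a \<Rightarrow> real \<times> real"
  ecurve :: "'a set \<Rightarrow> (real \<times> real) set"

definition is_drawing :: "('a, 'b) pre_digraph \<Rightarrow> 'a drawing \<Rightarrow> bool" where
  "is_drawing H \<Gamma> \<longleftrightarrow>
     inj_on (vpos \<Gamma>) (verts H) \<and>
     (\<forall>e\<in>edge_set H. \<exists>g. arc g \<and> path_image g = ecurve \<Gamma> e \<and>
        {pathstart g, pathfinish g} = vpos \<Gamma> ` e)"

definition planar_drawing :: "('a, 'b) pre_digraph \<Rightarrow> 'a drawing \<Rightarrow> bool" where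
  "planar_drawing H \<Gamma> \<longleftrightarrow>
     is_drawing H \<Gamma> \<and>
     (\<forall>e\<in>edge_set H. \<forall>f\<in>edge_set H. e \<noteq> f \<longrightarrow>
        ecurve \<Gamma> e \<inter> ecurve \<Gamma> f \<subseteq> vpos \<Gamma> ` (e \<inter> f)) \<and>
     (\<forall>v\<in>verts H. \<forall>e\<in>edge_set H. vpos \<Gamma> v \<in> ecurve \<Gamma> e \<longrightarrow> v \<in> e)"

definition straight_line_drawing :: "('a, 'b) pre_digraph \<Rightarrow> 'a drawing \<Rightarrow> bool" where
  "straight_line_drawing H \<Gamma> \<longleftrightarrow>
     is_drawing H \<Gamma> \<and>
     (\<forall>a\<in>arcs H. ecurve \<Gamma> {tail H a, head H a} =
        closed_segment (vpos \<Gamma> (tail H a)) (vpos \<Gamma> (head H a)))"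


section \<open>Drawing stories\<close>

text \<open>A drawing story is indexed by all of \<^typ>\<open>nat\<close>; only the values at the times of the graph
  story matter.\<close>

definition drawing_story ::
    "'a pair_pre_digraph \<Rightarrow> ('a \<Rightarrow> nat) \<Rightarrow> nat \<Rightarrow> (nat \<Rightarrow> 'a drawing) \<Rightarrow> bool" where
  "drawing_story G \<tau> W \<Gamma> \<longleftrightarrow>
     (\<forall>t\<in>story_times G W. is_drawing (window_graph G \<tau> W t) (\<Gamma> t)) \<and>
     (\<forall>s\<in>story_times G W. \<forall>t\<in>story_times G W.
        (\<forall>v \<in> verts (window_graph G \<tau> W s) \<inter> verts (window_graph G \<tau> W t).
           vpos (\<Gamma> s) v = vpos (\<Gamma> t) v) \<and>
        (\<forall>e \<in> edge_set (window_graph G \<tau> W s) \<inter> edge_set (window_graph G \<tau> W t).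
           ecurve (\<Gamma> s) e = ecurve (\<Gamma> t) e))"

definition planar_story ::
    "'a pair_pre_digraph \<Rightarrow> ('a \<Rightarrow> nat) \<Rightarrow> nat \<Rightarrow> (nat \<Rightarrow> 'a drawing) \<Rightarrow> bool" where
  "planar_story G \<tau> W \<Gamma> \<longleftrightarrow>
     (\<forall>t\<in>story_times G W. planar_drawing (window_graph G \<tau> W t) (\<Gamma> t))"

definition straight_line_story ::
    "'a pair_pre_digraph \<Rightarrow> ('a \<Rightarrow> nat) \<Rightarrow> nat \<Rightarrow> (nat \<Rightarrow> 'a drawing) \<Rightarrow> bool" where
  "straight_line_story G \<tau> W \<Gamma> \<longleftrightarrow>
     (\<forall>t\<in>story_times G W. straight_line_drawing (window_graph G \<tau> W t) (\<Gamma> t))"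

definition lies_on_grid ::
    "'a pair_pre_digraph \<Rightarrow> ('a \<Rightarrow> nat) \<Rightarrow> nat \<Rightarrow> nat \<Rightarrow> nat \<Rightarrow> (nat \<Rightarrow> 'a drawing) \<Rightarrow> bool" where
  "lies_on_grid G \<tau> W w h \<Gamma> \<longleftrightarrow>
     (\<exists>a b c d :: int. b - a + 1 = int w \<and> d - c + 1 = int h \<and>
        (\<forall>t\<in>story_times G W.
           (\<forall>v\<in>verts (window_graph G \<tau> W t). \<exists>x\<in>{a..b}. \<exists>y\<in>{c..d}.
              vpos (\<Gamma> t) v = (real_of_int x, real_of_int y)) \<and>
           (\<forall>e\<in>edge_set (window_graph G \<tau> W t).
              ecurve (\<Gamma> t) e \<subseteq> {real_of_int a..real_of_int b} \<times> {real_of_int c..real_of_int d})))"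


section \<open>A random-access machine\<close>

text \<open>
  Running time refers to a word RAM that is programmed in a structured language. A program uses
  finitely many registers and finitely many integer arrays, numbered by constants of the program;
  an array cell is addressed by a computed integer.
\<close>

datatype aexp =
    Const int | Reg nat | Mem nat aexp
  | Plus aexp aexp | Minus aexp aexp | Times aexp aexp | Quot aexp aexp | Rem aexp aexp

datatype bexp = Less aexp aexp | Equal aexp aexp | Neg bexp | Conj bexp bexp

datatype com =
    Skip | Assign nat aexp | Store nat aexp aexp
  | Seq com com | Cond bexp com com | While bexp com

record mstate =
  reg :: "nat \<Rightarrow> int"
  mem :: "nat \<Rightarrow> int \<Rightarrow> int"

primrec aval :: "aexp \<Rightarrow> mstate \<Rightarrow> int" where
  "aval (Const k) s = k"
| "aval (Reg r) s = reg s r"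
| "aval (Mem m i) s = mem s m (aval i s)"
| "aval (Plus a b) s = aval a s + aval b s"
| "aval (Minus a b) s = aval a s - aval b s"
| "aval (Times a b) s = aval a s * aval b s"
| "aval (Quot a b) s = aval a s div aval b s"
| "aval (Rem a b) s = aval a s mod aval b s"

primrec bval :: "bexp \<Rightarrow> mstate \<Rightarrow> bool" where
  "bval (Less a b) s = (aval a s < aval b s)"
| "bval (Equal a b) s = (aval a s = aval b s)"
| "bval (Neg b) s = (\<not> bval b s)"
| "bval (Conj b c) s = (bval b s \<and> bval c s)"

text \<open>
  \<open>exec B c s t s'\<close>: started in \<open>s\<close>, the program \<open>c\<close> terminates in \<open>s'\<close> after \<open>t\<close> steps, and
  all values it stores have absolute value at most \<open>B\<close> (otherwise the run is stuck).
  Assignments and tests take one step each: the expressions are part of the program, so their sizes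
  do not depend on the input and counting single operations changes \<open>t\<close> by a constant factor
  only. For the same reason intermediate values and addresses are bounded by a polynomial in \<open>B\<close>
  (if the input values are bounded by \<open>B\<close>), that is, they occupy \<open>O(log B)\<close> bits.
\<close>

inductive exec :: "int \<Rightarrow> com \<Rightarrow> mstate \<Rightarrow> nat \<Rightarrow> mstate \<Rightarrow> bool" for B :: int where
  Skip: "exec B Skip s 1 s"
| Assign: "\<bar>aval a s\<bar> \<le> B \<Longrightarrow>
    exec B (Assign r a) s 1 (s\<lparr>reg := (reg s)(r := aval a s)\<rparr>)"
| Store: "\<bar>aval a s\<bar> \<le> B \<Longrightarrow>
    exec B (Store m i a) s 1 (s\<lparr>mem := (mem s)(m := (mem s m)(aval i s := aval a s))\<rparr>)"
| Seq: "exec B c1 s1 t1 s2 \<Longrightarrow> exec B c2 s2 t2 s3 \<Longrightarrow> exec B (Seq c1 c2) s1 (t1 + t2) s3"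
| CondTrue: "bval b s \<Longrightarrow> exec B c1 s t s' \<Longrightarrow> exec B (Cond b c1 c2) s (t + 1) s'"
| CondFalse: "\<not> bval b s \<Longrightarrow> exec B c2 s t s' \<Longrightarrow> exec B (Cond b c1 c2) s (t + 1) s'"
| WhileFalse: "\<not> bval b s \<Longrightarrow> exec B (While b c) s 1 s"
| WhileTrue: "bval b s1 \<Longrightarrow> exec B c s1 t1 s2 \<Longrightarrow> exec B (While b c) s2 t2 s3 \<Longrightarrow>
    exec B (While b c) s1 (t1 + t2 + 1) s3"


section \<open>Input and output of the machine\<close>

text \<open>
  \<open>vs\<close> numbers the vertices by \<open>0, \<dots>, n - 1\<close>, and \<open>adj ! i\<close> lists, in any order, the numbers of
  the neighbours of the vertex with number \<open>i\<close>.
\<close>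

definition adjacency_lists :: "'a pair_pre_digraph \<Rightarrow> 'a list \<Rightarrow> nat list list \<Rightarrow> bool" where
  "adjacency_lists G vs adj \<longleftrightarrow>
     distinct vs \<and> set vs = pverts G \<and> length adj = length vs \<and>
     (\<forall>i<length vs. distinct (adj ! i) \<and>
        set (adj ! i) = {j. j < length vs \<and> (vs ! i, vs ! j) \<in> parcs G})"

definition array_of :: "nat list \<Rightarrow> int \<Rightarrow> int" where
  "array_of xs i = (if 0 \<le> i \<and> i < int (length xs) then int (xs ! nat i) else 0)"

text \<open>
  Registers 0 and 1 contain \<open>n\<close> and \<open>W\<close>. Array 0 contains the values of \<open>\<tau>\<close>. The adjacency lists
  are stored consecutively in array 2; the list of vertex \<open>i\<close> begins at the position in cell \<open>i\<close>
  of array 1 and ends before the position in cell \<open>i + 1\<close>. Everything else is 0.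
\<close>

definition input_state :: "('a \<Rightarrow> nat) \<Rightarrow> nat \<Rightarrow> 'a list \<Rightarrow> nat list list \<Rightarrow> mstate" where
  "input_state \<tau> W vs adj =
     \<lparr>reg = (\<lambda>_. 0)(0 := int (length vs), 1 := int W),
      mem = (\<lambda>_ _. 0)(
        0 := array_of (map \<tau> vs),
        1 := array_of (map (\<lambda>i. \<Sum>k<i. length (adj ! k)) [0..<Suc (length vs)]),
        2 := array_of (concat adj))\<rparr>"

text \<open>
  A straight-line drawing story is determined by the positions of the vertices, and these are the
  output; the drawings at the \<open>n + W - 1\<close> times are not listed one by one, which would in general
  take more than linear space. Arrays 3 and 4 contain the two coordinates.
\<close>

definition output_positions ::
    "'a pair_pre_digraph \<Rightarrow> ('a \<Rightarrow> nat) \<Rightarrow> nat \<Rightarrow> 'a list \<Rightarrow> mstate \<Rightarrow> (nat \<Rightarrow> 'a drawing) \<Rightarrow> bool" where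
  "output_positions G \<tau> W vs s \<Gamma> \<longleftrightarrow>
     (\<forall>t\<in>story_times G W. \<forall>i<length vs. vs ! i \<in> verts (window_graph G \<tau> W t) \<longrightarrow>
        vpos (\<Gamma> t) (vs ! i) =
          (real_of_int (mem s 3 (int i)), real_of_int (mem s 4 (int i))))"

end

theory Submission
  imports Defs
begin

text \<open>
  Cut time into buckets of \<open>W\<close> consecutive vertices. A window meets at most two consecutive buckets,
  so it suffices to place every bucket such that any two consecutive ones are drawn without crossings.
  Even buckets live near the horizontal, odd ones near the vertical axis, which gives four rays.
  Root \<open>T\<close> and visit the components of the buckets breadth first; a child in another bucket opens a new
  component, one ray further counterclockwise if the parity of the bucket changes. The edges between two rays
  then run between vertices whose orders on the two rays agree, hence are nested, and the spiral
  uses each quadrant in one direction only.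

  Within a component the vertices are visited in preorder, and depth grows by at most one per step.
  The vertex of rank \<open>j\<close> on its ray, with depth \<open>d\<close> in a component whose first rank is \<open>K\<close>, is placed
  at \<open>(2 W + K + j - d, j)\<close> before rotation. In this shear of the layered drawing of a tree every vertex sees
  the whole quadrant towards the next ray, while the roots lie on a line of slope 1/2 that
  all edges from the previous ray approach from below with a larger slope.

  Both orders are produced by one worklist: children in the same bucket are pushed at the front,
  the others at the back.
\<close>

section \<open>Trees\<close>

text \<open>A vertex needs one point for all times, so its coordinates may depend on its whole
  bucket but never on a window. Parity is enough to choose a ray because buckets in one window
  differ by at most one: there, a ray belongs to a single bucket. An edge between buckets further
  apart is never drawn and only guides the traversal. Acyclicity acts through one fact: the arcs
  that connect all vertices to a root are, up to reversal, all arcs. This makes every drawn edge a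
  link between a vertex and its parent in the traversal, and it bounds the number of arcs that the
  program reads. The crossing proof consists of linear inequalities. A pair of links is turned until
  one of them touches ray 0, and then a line separates the two: a vertical or horizontal one, the
  line through a link, the line of the roots, or the antidiagonal. On ray 0 ordinates are below
  \<open>W\<close>, while abscissae start at \<open>2 * W\<close> and, as base ranks and ranks are
  below \<open>W\<close>, stay below \<open>4 * W\<close>. The first distance keeps the rays apart,
  the second one gives the grid of side \<open>8 * W + 1\<close>.\<close>

lemma tree_arc_is_bridge:
  assumes T: "undirected_tree T" and uv: "(u, v) \<in> parcs T"
    and R: "R \<subseteq> parcs T" "(u, v) \<notin> R"
  shows "(u, v) \<notin> R\<^sup>*"
proof
  assume uvR: "(u, v) \<in> R\<^sup>*"
  interpret pair_graph T using T by (simp add: undirected_tree_def)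
  have "\<exists>p. awalk u p v \<and> set p \<subseteq> R"
    using uvR
  proof (induction rule: rtrancl_induct)
    case base
    have "awalk u [] u" using in_arcsD1[OF uv] by (simp add: awalk_Nil_iff)
    then show ?case by fastforce
  next
    case (step y z)
    then obtain p where p: "awalk u p y" "set p \<subseteq> R" by blast
    have "awalk y [(y, z)] z"
      using step.hyps(2) R(1) in_arcsD1 in_arcsD2 by (auto simp: awalk_simps)
    with p step.hyps(2) have "awalk u (p @ [(y, z)]) z" "set (p @ [(y, z)]) \<subseteq> R"
      by auto
    then show ?case by blast
  qed
  then obtain p where p: "awalk u p v" "set p \<subseteq> R" by blast
  define q where "q = awalk_to_apath p"
  have q: "apath u q v" unfolding q_def by (rule apath_awalk_to_apath[OF p(1)])
  have qR: "set q \<subseteq> R" using awalk_to_apath_subset[OF p(1)] p(2) by (auto simp: q_def)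
  \<comment> \<open>A path with a single arc would be \<open>(u, v)\<close> itself, which
    \<open>R\<close> avoids. The closing arc \<open>(v, u)\<close> therefore completes a cycle of at
    least three arcs, the kind that \<open>undirected_tree\<close> excludes.\<close>
  have len: "2 \<le> length q"
  proof (cases q)
    case Nil
    with q have "u = v" by (simp add: apath_def awalk_simps)
    then show ?thesis using pair_no_loops[OF uv] by simp
  next
    case (Cons e es)
    show ?thesis
    proof (cases es)
      case Nil
      with Cons q have "e = (u, v)" by (cases e) (simp add: apath_def awalk_simps)
      with Cons qR R(2) show ?thesis by simp
    qed (simp add: Cons)
  qed
  have vu: "(v, u) \<in> parcs T" using arcs_symmetric[OF uv] by simp
  have "awalk v ((v, u) # q) v"
    using q vu in_arcsD1[OF vu] by (auto simp: apath_def awalk_simps)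
  moreover have "distinct (tl (pawalk_verts v ((v, u) # q)))"
    using q by (simp add: apath_def)
  ultimately have "cycle ((v, u) # q)" unfolding cycle_def by blast
  moreover have "3 \<le> length ((v, u) # q)" using len by simp
  ultimately show False using T unfolding undirected_tree_def by blast
qed

text \<open>An arc missing from \<open>P\<close> would be bypassed by \<open>P\<close>, hence would not be a bridge.\<close>

lemma tree_arcs_subset_connecting:
  assumes T: "undirected_tree T" and P: "P \<subseteq> parcs T"
    and conn: "\<And>v. v \<in> pverts T \<Longrightarrow> (v, r) \<in> P\<^sup>*"
  shows "parcs T \<subseteq> P \<union> P\<inverse>"
proof (rule ccontr)
  assume "\<not> parcs T \<subseteq> P \<union> P\<inverse>"
  then obtain u v where uv: "(u, v) \<in> parcs T" "(u, v) \<notin> P \<union> P\<inverse>" by auto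
  interpret pair_graph T using T by (simp add: undirected_tree_def)
  have "P \<union> P\<inverse> \<subseteq> parcs T" using P arcs_symmetric by auto
  from tree_arc_is_bridge[OF T uv(1) this uv(2)] have "(u, v) \<notin> (P \<union> P\<inverse>)\<^sup>*" .
  moreover have "(u, r) \<in> (P \<union> P\<inverse>)\<^sup>*"
    using conn[OF in_arcsD1[OF uv(1)]] by (rule rtrancl_mono[THEN subsetD, rotated]) simp
  moreover have "(r, v) \<in> (P \<union> P\<inverse>)\<^sup>*"
  proof -
    have "(v, r) \<in> (P \<union> P\<inverse>)\<^sup>*"
      using conn[OF in_arcsD2[OF uv(1)]] by (rule rtrancl_mono[THEN subsetD, rotated]) simp
    then have "(r, v) \<in> ((P \<union> P\<inverse>)\<inverse>)\<^sup>*" by (rule rtrancl_converseI)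
    then show ?thesis by (simp add: converse_Un Un_commute)
  qed
  ultimately show False by (meson rtrancl_trans)
qed

lemma tree_connected:
  assumes T: "undirected_tree T" and "u \<in> pverts T" "v \<in> pverts T"
  shows "(u, v) \<in> (parcs T)\<^sup>*"
proof -
  interpret pair_graph T using T by (simp add: undirected_tree_def)
  have "strongly_connected T"
    using T pair_sym_arcs by (intro symmetric_connected_imp_strongly_connected) (auto simp: undirected_tree_def)
  then have "u \<rightarrow>\<^sup>*\<^bsub>T\<^esub> v" using assms by (auto simp: strongly_connected_def)
  then show ?thesis unfolding reachable_def by (simp add: rtrancl_on_rtranclI)
qed

text \<open>The linear running time rests on this bound, since every adjacency list is scanned.
  Stepping from each vertex other than \<open>r\<close> to a neighbour closer to \<open>r\<close>
  uses at most one arc per vertex and still connects everything to \<open>r\<close>, so up to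
  reversal there are no other arcs.\<close>

lemma card_tree_arcs:
  assumes T: "undirected_tree T"
  shows "card (parcs T) \<le> 2 * card (pverts T)"
proof -
  interpret pair_graph T using T by (simp add: undirected_tree_def)
  obtain r where r: "r \<in> pverts T"
    using T by (auto simp: undirected_tree_def connected_conv)
  define h where "h v = (LEAST k. (v, r) \<in> parcs T ^^ k)" for v
  have h: "(v, r) \<in> parcs T ^^ h v" if "v \<in> pverts T" for v
    using tree_connected[OF T that r] unfolding h_def rtrancl_power by (metis LeastI)
  have closer: "\<exists>w. (v, w) \<in> parcs T \<and> h w < h v" if "v \<in> pverts T" "v \<noteq> r" for v
  proof -
    from h[OF that(1)] that(2) obtain k where k: "h v = Suc k" by (cases "h v") auto
    with h[OF that(1)] obtain w where w: "(v, w) \<in> parcs T" "(w, r) \<in> parcs T ^^ k"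
      by (metis relpow_Suc_D2)
    then have "h w \<le> k" unfolding h_def by (simp add: Least_le)
    with w k show ?thesis by auto
  qed
  then obtain p where p: "\<And>v. v \<in> pverts T \<Longrightarrow> v \<noteq> r \<Longrightarrow> (v, p v) \<in> parcs T \<and> h (p v) < h v"
    by metis
  define P where "P = (\<lambda>v. (v, p v)) ` (pverts T - {r})"
  have "P \<subseteq> parcs T" using p by (auto simp: P_def)
  moreover have "(v, r) \<in> P\<^sup>*" if "v \<in> pverts T" for v
    using that
  proof (induction "h v" arbitrary: v rule: less_induct)
    case less
    show ?case
    proof (cases "v = r")
      case False
      with less p[of v] have "(p v, r) \<in> P\<^sup>*" using in_arcsD2 by blast
      moreover have "(v, p v) \<in> P" using False less.prems by (simp add: P_def)
      ultimately show ?thesis by (meson converse_rtrancl_into_rtrancl)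
    qed simp
  qed
  ultimately have "parcs T \<subseteq> P \<union> P\<inverse>" by (rule tree_arcs_subset_connecting[OF T])
  moreover have "finite P" "card P \<le> card (pverts T)"
    using pair_finite_verts unfolding P_def
    by (auto intro!: order_trans[OF card_image_le] card_mono)
  ultimately have "card (parcs T) \<le> card (P \<union> P\<inverse>)"
    by (intro card_mono) (auto simp: finite_converse)
  also have "\<dots> \<le> card P + card (P\<inverse>)" by (rule card_Un_le)
  also have "\<dots> \<le> 2 * card (pverts T)" using \<open>card P \<le> _\<close> by simp
  finally show ?thesis .
qed

section \<open>Separating links in the plane\<close>

definition rot :: "real \<times> real \<Rightarrow> real \<times> real" where
  "rot p = (- snd p, fst p)"

definition lf :: "real \<Rightarrow> real \<Rightarrow> real \<times> real \<Rightarrow> real" where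
  "lf \<alpha> \<beta> p = \<alpha> * fst p + \<beta> * snd p"

definition meet_at_ends :: "real \<times> real \<Rightarrow> real \<times> real \<Rightarrow> real \<times> real \<Rightarrow> real \<times> real \<Rightarrow> bool" where
  "meet_at_ends a b c d \<longleftrightarrow> closed_segment a b \<inter> closed_segment c d \<subseteq> {a, b} \<inter> {c, d}"

lemma meet_at_ends_commute: "meet_at_ends a b c d \<longleftrightarrow> meet_at_ends c d a b"
  and meet_at_ends_flip1: "meet_at_ends a b c d \<longleftrightarrow> meet_at_ends b a c d"
  and meet_at_ends_flip2: "meet_at_ends a b c d \<longleftrightarrow> meet_at_ends a b d c"
  unfolding meet_at_ends_def by (auto simp: closed_segment_commute)

lemma linear_rot: "linear rot"
  by (rule linearI) (auto simp: rot_def)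

lemma inj_rot: "inj rot"
  by (auto simp: rot_def inj_on_def prod_eq_iff)

lemma rot_4: "rot (rot (rot (rot p))) = p"
  by (simp add: rot_def)

lemma rot_funpow_mod: "(rot ^^ (r mod 4)) p = (rot ^^ r) p"
proof -
  have "rot ^^ 4 = id" by (rule ext) (simp add: eval_nat_numeral rot_4)
  then have "(rot ^^ (r mod 4 + 4 * (r div 4))) p = (rot ^^ (r mod 4)) p"
    unfolding funpow_add funpow_mult[symmetric] by simp
  then show ?thesis by simp
qed

lemma mod4_diff: "a < 4 \<Longrightarrow> b < 4 \<Longrightarrow> b = (a + (b + 4 - a) mod 4) mod (4 :: nat)"
  by (simp add: mod_simps)

lemma meet_at_ends_rot: "meet_at_ends (rot a) (rot b) (rot c) (rot d) \<longleftrightarrow> meet_at_ends a b c d"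
proof -
  have "closed_segment (rot p) (rot q) = rot ` closed_segment p q" for p q
    by (rule closed_segment_linear_image[OF linear_rot])
  moreover have "{rot p, rot q} = rot ` {p, q}" for p q by simp
  ultimately show ?thesis
    unfolding meet_at_ends_def by (simp only: image_Int[OF inj_rot, symmetric] inj_image_subset_iff[OF inj_rot])
qed

lemma meet_at_ends_funpow_rot:
  "meet_at_ends ((rot ^^ r) a) ((rot ^^ r) b) ((rot ^^ r) c) ((rot ^^ r) d) \<longleftrightarrow> meet_at_ends a b c d"
  by (induction r) (simp_all add: meet_at_ends_rot)

lemma lf_segment: "lf \<alpha> \<beta> ((1 - u) *\<^sub>R a + u *\<^sub>R b) = (1 - u) * lf \<alpha> \<beta> a + u * lf \<alpha> \<beta> b"
  by (simp add: lf_def algebra_simps)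

lemma lf_segment_ge:
  assumes "z \<in> closed_segment c d" "k \<le> lf \<alpha> \<beta> c" "k \<le> lf \<alpha> \<beta> d"
  shows "k \<le> lf \<alpha> \<beta> z"
proof -
  from assms(1) obtain u where u: "0 \<le> u" "u \<le> 1" "z = (1 - u) *\<^sub>R c + u *\<^sub>R d"
    by (auto simp: in_segment)
  have "(1 - u) * k + u * k \<le> (1 - u) * lf \<alpha> \<beta> c + u * lf \<alpha> \<beta> d"
    using u assms by (intro add_mono mult_left_mono) auto
  then show ?thesis unfolding u(3) lf_segment by (simp add: algebra_simps)
qed

lemma lf_segment_end:
  assumes "z \<in> closed_segment a b" "lf \<alpha> \<beta> a \<le> k" "lf \<alpha> \<beta> b < k" "k \<le> lf \<alpha> \<beta> z"
  shows "z = a"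
proof -
  from assms(1) obtain u where u: "0 \<le> u" "u \<le> 1" "z = (1 - u) *\<^sub>R a + u *\<^sub>R b"
    by (auto simp: in_segment)
  have "u = 0"
  proof (rule ccontr)
    assume "u \<noteq> 0"
    with u have "u * lf \<alpha> \<beta> b < u * k" using assms(3) by auto
    moreover have "(1 - u) * lf \<alpha> \<beta> a \<le> (1 - u) * k"
      using u assms(2) by (intro mult_left_mono) auto
    ultimately have "lf \<alpha> \<beta> z < k" unfolding u(3) lf_segment by (simp add: algebra_simps)
    with assms(4) show False by simp
  qed
  with u show ?thesis by simp
qed

lemma meet_at_ends_separated:
  assumes "lf \<alpha> \<beta> a < k" "lf \<alpha> \<beta> b < k" "k \<le> lf \<alpha> \<beta> c" "k \<le> lf \<alpha> \<beta> d"
  shows "meet_at_ends a b c d"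
proof -
  have False if z: "z \<in> closed_segment a b" "z \<in> closed_segment c d" for z
  proof -
    have "k \<le> lf \<alpha> \<beta> z" by (rule lf_segment_ge[OF z(2) assms(3,4)])
    moreover from this have "z = a" using assms z(1) by (intro lf_segment_end[of z a b]) auto
    ultimately show False using assms(1) by simp
  qed
  then show ?thesis by (auto simp: meet_at_ends_def)
qed

text \<open>The first functional leaves \<open>a\<close> as the only possible common point. If
  \<open>a\<close> is not an end of the other segment, the second functional keeps that segment
  strictly on one side of \<open>a\<close>.\<close>

lemma meet_at_ends_touching:
  assumes "lf \<alpha> \<beta> a \<le> k" "lf \<alpha> \<beta> b < k" "k \<le> lf \<alpha> \<beta> c" "k \<le> lf \<alpha> \<beta> d"
    and "a \<in> {c, d} \<or> lf \<alpha>' \<beta>' a < lf \<alpha>' \<beta>' c \<and> lf \<alpha>' \<beta>' a < lf \<alpha>' \<beta>' d"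
  shows "meet_at_ends a b c d"
proof -
  have "a \<in> {c, d}" "z = a" if z: "z \<in> closed_segment a b" "z \<in> closed_segment c d" for z
  proof -
    have "k \<le> lf \<alpha> \<beta> z" by (rule lf_segment_ge[OF z(2) assms(3,4)])
    then show "z = a" using assms(1,2) z(1) by (intro lf_segment_end[of z a b]) auto
    have "min (lf \<alpha>' \<beta>' c) (lf \<alpha>' \<beta>' d) \<le> lf \<alpha>' \<beta>' z"
      by (rule lf_segment_ge[OF z(2)]) auto
    with assms(5) show "a \<in> {c, d}" unfolding \<open>z = a\<close> by fastforce
  qed
  then show ?thesis by (auto simp: meet_at_ends_def)
qed

lemma meet_at_ends_point: "a \<in> {c, d} \<Longrightarrow> meet_at_ends a a c d"
  by (auto simp: meet_at_ends_def)

text \<open>This isolates the geometry from the traversal: \<open>S\<close> stands for the visit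
  positions of the vertices in one window, and only inequalities between numbers remain. In
  \<open>same_ray\<close>, either the component of \<open>v\<close> starts after \<open>u\<close>,
  or both belong to one component, whose positions and ranks are consecutive.\<close>

locale spiral_layout =
  fixes S :: "nat set" and W :: nat and K j d ry par :: "nat \<Rightarrow> nat"
  assumes depth: "\<And>v. v \<in> S \<Longrightarrow> K v + d v \<le> j v"
    and bound: "\<And>v. v \<in> S \<Longrightarrow> j v < W"
    and same_ray: "\<And>u v. u \<in> S \<Longrightarrow> v \<in> S \<Longrightarrow> ry u = ry v \<Longrightarrow> u < v \<Longrightarrow>
      j u < K v \<or> K u = K v \<and> j v = j u + (v - u) \<and> d v \<le> d u + (v - u)"
begin

definition pt :: "nat \<Rightarrow> real \<times> real" where
  "pt v = (real (2 * W + K v + j v) - real (d v), real (j v))"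

definition pos :: "nat \<Rightarrow> real \<times> real" where
  "pos v = (rot ^^ ry v) (pt v)"

text \<open>Degenerate links from a vertex to itself are admitted, so that the disjointness of links
  also covers vertices lying on edges.\<close>

definition intra :: "nat \<Rightarrow> nat \<Rightarrow> bool" where
  "intra u v \<longleftrightarrow> u \<in> S \<and> v \<in> S \<and> ry u = ry v \<and> K u = K v \<and>
     (u = v \<or> u < v \<and> d v = Suc (d u) \<and> (\<forall>w. u < w \<and> w < v \<longrightarrow> d v \<le> d w))"

text \<open>The start of the traversal has no parent and an arbitrary value of \<open>par\<close>;
  \<open>0 < v\<close> excludes it. The last two conditions say that \<open>v\<close> is the root of
  its component.\<close>

definition inter :: "nat \<Rightarrow> nat \<Rightarrow> bool" where
  "inter u v \<longleftrightarrow> u \<in> S \<and> v \<in> S \<and> 0 < v \<and> par v = u \<and> ry v = Suc (ry u) mod 4 \<and> d v = 0 \<and> K v = j v"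

section \<open>Bounds in the frame of one ray, and pairs of links inside components\<close>

lemmas coords = lf_def rot_def pt_def

lemma same_rayD:
  assumes "u \<in> S" "v \<in> S" "ry u = ry v"
  shows "u = v \<or> j u < K v \<or> j v < K u \<or>
    K u = K v \<and> (u < v \<and> j v = j u + (v - u) \<and> d v \<le> d u + (v - u) \<or>
                 v < u \<and> j u = j v + (u - v) \<and> d u \<le> d v + (u - v))"
  using same_ray[of u v] same_ray[of v u] assms by (cases u v rule: linorder_cases) auto

lemma intra_j: "intra u v \<Longrightarrow> j v = j u + (v - u) \<and> u \<le> v"
  unfolding intra_def using same_rayD[of u v] depth[of u] depth[of v] by auto

lemma X_bounds:
  assumes "v \<in> S"
  shows "2 * real W + 2 * K v \<le> fst (pt v)" "fst (pt v) \<le> 2 * real W + K v + j v"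
    "snd (pt v) = j v" "real (K v) + d v \<le> j v" "real (j v) + 1 \<le> W" "0 \<le> real (j v)" "0 \<le> real (K v)" "0 \<le> real (d v)"
    "fst (pt v) = 2 * real W + K v + j v - d v"
  using depth[OF assms] bound[OF assms] by (auto simp: pt_def)

text \<open>From \<open>u\<close> to a child \<open>v\<close> the displacement is
  \<open>(n - 1, n)\<close> with \<open>n = v - u\<close>, as the rank grows by \<open>n\<close> and
  the depth by one. So the functional with coefficients \<open>n\<close> and \<open>1 - n\<close> is
  constant along the link. A vertex of the component visited strictly between them has depth at
  least \<open>d v\<close> and hence a smaller value: the link passes to its right.\<close>

lemma intra_intra_aux:
  assumes a: "intra u v" and b: "intra u' v'" and r: "ry u = ry u'" and K: "K u = K u'"
    and lt: "u < u' \<or> u = u' \<and> v < v'"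
  shows "meet_at_ends (pt u) (pt v) (pt u') (pt v')"
proof -
  have S: "u \<in> S" "v \<in> S" "u' \<in> S" "v' \<in> S" using a b by (auto simp: intra_def)
  have jv: "j v = j u + (v - u)" "u \<le> v" and jv': "j v' = j u' + (v' - u')" "u' \<le> v'"
    using intra_j[OF a] intra_j[OF b] by auto
  have ju': "j u' = j u + (u' - u)"
    using same_ray[OF S(1,3) r] depth[OF S(1)] depth[OF S(3)] K lt by auto
  have Ks: "K v = K u" "K v' = K u" using a b K by (auto simp: intra_def)
  consider "u = u'" "v < v'" | "u < u'" "v \<le> u'" | "u < u'" "u' < v" using lt by linarith
  then show ?thesis
  proof cases
    case 1
    show ?thesis
    proof (cases "u = v")
      case True
      then show ?thesis using 1 by (auto intro: meet_at_ends_point)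
    next
      case False
      with a 1 b jv have d: "d v = Suc (d u)" "d v' = Suc (d u)" by (auto simp: intra_def)
      have ne: "real v < real v'" "real u < real v" using 1 False jv by auto
      \<comment> \<open>For two children of the same vertex, the line is taken through the link to
        the later one.\<close>
      let ?n = "real v' - real u"
      have "lf ?n (1 - ?n) (pt v) < lf ?n (1 - ?n) (pt u)"
      proof -
        have "lf ?n (1 - ?n) (pt v) - lf ?n (1 - ?n) (pt u) =
            ?n * (real v - real u - 1) + (1 - ?n) * (real v - real u)"
          using jv d 1 by (simp add: coords Ks algebra_simps of_nat_diff)
        also have "\<dots> = real v - real v'" by (simp add: algebra_simps)
        finally show ?thesis using ne by simp
      qed
      moreover have "lf ?n (1 - ?n) (pt v') = lf ?n (1 - ?n) (pt u)"
        using jv' d 1 by (simp add: coords Ks algebra_simps of_nat_diff)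
      ultimately show ?thesis
        by (intro meet_at_ends_touching[of ?n "1 - ?n" _ "lf ?n (1 - ?n) (pt u)"]) (auto simp: 1)
    qed
  next
    case 2
    show ?thesis
    proof (cases "v = u'")
      case False
      with 2 jv jv' ju' have "j u < j u'" "j v < j u'" "j u' \<le> j v'" by auto
      then show ?thesis
        by (intro meet_at_ends_separated[of 0 1 _ "real (j u')"]) (auto simp: coords)
    next
      case True
      with 2 have "j u < j u'" "j u' \<le> j v'" using jv' ju' by auto
      then show ?thesis using True
        by (subst meet_at_ends_flip1, intro meet_at_ends_touching[of 0 1 _ "real (j u')"]) (auto simp: coords)
    qed
  next
    case 3
    have d: "d v = Suc (d u)" "d v \<le> d u'" using a 3 by (auto simp: intra_def)
    \<comment> \<open>The links are nested. \<open>u'\<close> is visited between \<open>u\<close>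
      and \<open>v\<close>, so it is at least as deep as \<open>v\<close> and its child is deeper
      than \<open>v\<close>. If that child came after \<open>v\<close>, then \<open>v\<close> would
      be a vertex between \<open>u'\<close> and \<open>v'\<close> that is too shallow.\<close>
    have "v' < v"
    proof (rule ccontr)
      assume "\<not> v' < v"
      then have "u' < v'" "v \<le> v'" using 3 by auto
      then have "d v' = Suc (d u')" "v < v' \<Longrightarrow> d v' \<le> d v" using b 3 by (auto simp: intra_def)
      then show False using d \<open>v \<le> v'\<close> by (cases "v = v'") auto
    qed
    then have d': "d v \<le> d v'" using a 3 jv' by (auto simp: intra_def)
    let ?n = "real v - real u"
    let ?f = "lf ?n (1 - ?n)"
    have below: "?f (pt w) < ?f (pt u)" if w: "K w = K u" "j w = j u + (w - u)" "u < w" "w < v" "d v \<le> d w" for w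
    proof -
      have "?f (pt w) - ?f (pt u) = ?n * (real w - real u + real (d u) - real (d w)) + (1 - ?n) * (real w - real u)"
        using w by (simp add: coords algebra_simps of_nat_diff)
      also have "\<dots> = real w - real u - ?n * (real (d w) - real (d u))" by (simp add: algebra_simps)
      also have "\<dots> \<le> real w - real u - ?n * 1"
        using w d 3 by (intro diff_left_mono mult_left_mono) auto
      also have "\<dots> < 0" using w by simp
      finally show ?thesis by simp
    qed
    have "?f (pt v) = ?f (pt u)"
      using jv d by (simp add: coords Ks algebra_simps of_nat_diff)
    moreover have "?f (pt u') < ?f (pt u)" using ju' K 3 d by (intro below) auto
    moreover have "?f (pt v') < ?f (pt u)" using ju' jv' Ks 3 d' \<open>v' < v\<close> by (intro below) auto
    ultimately show ?thesis
      by (subst meet_at_ends_commute, intro meet_at_ends_separated[of ?n "1 - ?n" _ "?f (pt u)"]) auto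
  qed
qed

lemma intra_intra_same_ray:
  assumes a: "intra u v" and b: "intra u' v'" and r: "ry u = ry u'" and ne: "(u, v) \<noteq> (u', v')"
  shows "meet_at_ends (pt u) (pt v) (pt u') (pt v')"
proof (cases "K u = K u'")
  case True
  consider "u < u' \<or> u = u' \<and> v < v'" | "u' < u \<or> u' = u \<and> v' < v" using ne by force
  then show ?thesis
    using intra_intra_aux[OF a b r True] intra_intra_aux[OF b a r[symmetric] True[symmetric]]
    by cases (auto simp: meet_at_ends_commute)
next
  case False
  have S: "u \<in> S" "v \<in> S" "u' \<in> S" "v' \<in> S" and eq: "ry v = ry u" "ry u' = ry u" "ry v' = ry u"
    "K v = K u" "K v' = K u'" using a b r by (auto simp: intra_def)
  have le: "j u \<le> j v" "j u' \<le> j v'" using intra_j[OF a] intra_j[OF b] by auto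
  \<comment> \<open>Different components of a ray occupy disjoint intervals of ranks, and ranks are
    ordinates.\<close>
  have "j v < j u' \<or> j v' < j u"
    using same_rayD[of v u'] same_rayD[of v' u] same_rayD[of v v'] same_rayD[of u u'] S eq False
      depth[OF S(1)] depth[OF S(2)] depth[OF S(3)] depth[OF S(4)] by auto
  then show ?thesis
  proof
    assume "j v < j u'"
    with le show ?thesis by (intro meet_at_ends_separated[of 0 1 _ "real (j u')"]) (auto simp: coords)
  next
    assume "j v' < j u"
    with le show ?thesis
      by (subst meet_at_ends_commute, intro meet_at_ends_separated[of 0 1 _ "real (j u)"]) (auto simp: coords)
  qed
qed

text \<open>The vertical line at abscissa \<open>W\<close> separates the links: ray 0 lies to the
  right of it, and the other three rays have abscissae below \<open>W\<close>, being within
  \<open>W\<close> of the vertical axis or on the negative side.\<close>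

lemma intra_intra_other_ray:
  assumes a: "intra u v" and b: "intra u' v'" and s: "s \<in> {1, 2, 3::nat}"
  shows "meet_at_ends (pt u) (pt v) ((rot ^^ s) (pt u')) ((rot ^^ s) (pt v'))"
proof -
  have S: "u \<in> S" "v \<in> S" "u' \<in> S" "v' \<in> S" using a b by (auto simp: intra_def)
  note B = S[THEN X_bounds(1)] S[THEN X_bounds(2)] S[THEN X_bounds(3)]
    S[THEN X_bounds(4)] S[THEN X_bounds(5)] S[THEN X_bounds(6)] S[THEN X_bounds(7)]
  show ?thesis
    apply (rule meet_at_ends_separated[of "-1" 0 _ "- real W"])
    using s B by (auto simp: lf_def rot_def eval_nat_numeral)
qed

section \<open>Links inside components against links between rays\<close>

lemma intra_inter_0:
  assumes a: "intra u v" and b: "inter p c" and r: "ry u = ry p"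
  shows "meet_at_ends (pt u) (pt v) (pt p) (rot (pt c))"
proof -
  have S: "u \<in> S" "v \<in> S" "p \<in> S" "c \<in> S" using a b by (auto simp: intra_def inter_def)
  have eq: "ry v = ry p" "K v = K u" using a r by (auto simp: intra_def)
  have jv: "j v = j u + (v - u)" "u \<le> v" using intra_j[OF a] by auto
  note B = S[THEN X_bounds(1)] S[THEN X_bounds(2)] S[THEN X_bounds(3)]
    S[THEN X_bounds(4)] S[THEN X_bounds(5)] S[THEN X_bounds(6)] S[THEN X_bounds(7)] S[THEN X_bounds(8)]
  have W0: "0 < real W" using B by linarith
  have Xv: "fst (pt u) \<le> fst (pt v)"
    using a jv by (auto simp: intra_def pt_def of_nat_diff)
  \<comment> \<open>The end \<open>rot (pt c)\<close> is to the left of and above every point of the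
    ray. Along the visiting order abscissae do not decrease and ordinates increase, so a vertical or
    horizontal line works in all cases except the last one, where \<open>p\<close> is visited
    strictly between the ends of the other link.\<close>
  consider "p = u" | "p = v" | "j p < K u" | "j v < j p" "p \<noteq> v"
    | "K p = K u" "p < u" "j u = j p + (u - p)" "d u \<le> d p + (u - p)"
    | "K p = K u" "u < p" "j p = j u + (p - u)" "p < v"
  proof (cases p u rule: linorder_cases)
    case less
    then show thesis using same_ray[OF S(3,1) r[symmetric]] that(3,5) by auto
  next
    case equal
    then show thesis using that(1) by simp
  next
    case greater
    show thesis
    proof (cases p v rule: linorder_cases)
      case less
      have "j u < K p \<or> K u = K p \<and> j p = j u + (p - u)" "j p < K v \<or> K p = K v"
        using same_ray[OF S(1,3) r greater] same_ray[OF S(3,2) eq(1)[symmetric] less] by auto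
      then show thesis
        using that(6) depth[OF S(1)] depth[OF S(3)] eq greater less by auto
    next
      case equal
      then show thesis using that(2) by simp
    next
      case greater
      then show thesis using same_ray[OF S(2,3) eq(1) greater] that(4) depth[OF S(3)] by auto
    qed
  qed
  then show ?thesis
  proof cases
    case 1
    then show ?thesis using B W0 Xv
      by (subst meet_at_ends_commute, intro meet_at_ends_touching[of 1 0 _ "fst (pt p)"]) (auto simp: lf_def rot_def)
  next
    case 2
    then show ?thesis using X_bounds(1,7)[OF S(4)] X_bounds(3)[OF S(1)] X_bounds(3,5)[OF S(3)] jv
      by (subst meet_at_ends_commute, intro meet_at_ends_touching[of 0 "-1" _ "- snd (pt p)"]) (auto simp: lf_def rot_def)
  next
    case 3
    then show ?thesis using X_bounds(2,4,8)[OF S(3)] X_bounds(1)[OF S(1)] X_bounds(1)[OF S(2)] X_bounds(3,6)[OF S(4)] W0 eq(2)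
      by (subst meet_at_ends_commute, intro meet_at_ends_separated[of 1 0 _ "2 * real W + 2 * K u"]) (auto simp: lf_def rot_def)
  next
    case 4
    then show ?thesis
      using X_bounds(3)[OF S(1)] X_bounds(3)[OF S(2)] X_bounds(3,5)[OF S(3)] X_bounds(1,7)[OF S(4)] jv
      by (intro meet_at_ends_separated[of 0 1 _ "real (j p)"]) (auto simp: lf_def rot_def)
  next
    case 5
    have "fst (pt p) \<le> fst (pt u)" "snd (pt p) < snd (pt u)" "snd (pt p) < snd (pt v)"
      using 5 jv by (auto simp: pt_def)
    then show ?thesis using X_bounds(1,7)[OF S(3)] X_bounds(3,6)[OF S(4)] W0 Xv
      by (subst meet_at_ends_commute, intro meet_at_ends_touching[of 1 0 _ "fst (pt p)" _ _ _ 0 1])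
        (auto simp: lf_def rot_def)
  next
    case 6
    \<comment> \<open>As in \<open>intra_intra_aux\<close>, \<open>p\<close> is strictly to the left
      of the line through \<open>u\<close> and \<open>v\<close>. Moving left and up from there to
      \<open>rot (pt c)\<close> cannot increase the functional, because \<open>?n\<close> is
      positive and \<open>1 - ?n\<close> is not.\<close>
    have d: "d v = Suc (d u)" "d v \<le> d p" using a 6 by (auto simp: intra_def)
    let ?n = "real v - real u"
    let ?f = "lf ?n (1 - ?n)"
    have n: "1 \<le> ?n" using 6 by auto
    have "?f (pt v) = ?f (pt u)"
      using jv d by (simp add: coords eq algebra_simps of_nat_diff)
    moreover have p: "?f (pt p) < ?f (pt u)"
    proof -
      have "?f (pt p) - ?f (pt u) = real p - real u - ?n * (real (d p) - real (d u))"
        using 6 by (simp add: coords algebra_simps of_nat_diff)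
      also have "\<dots> \<le> real p - real u - ?n * 1"
        using d n by (intro diff_left_mono mult_left_mono) auto
      also have "\<dots> < 0" using 6 by simp
      finally show ?thesis by simp
    qed
    moreover have "?f (rot (pt c)) \<le> ?f (pt p)"
    proof -
      have "?n * (- snd (pt c)) \<le> ?n * fst (pt p)" "(1 - ?n) * fst (pt c) \<le> (1 - ?n) * snd (pt p)"
        using X_bounds(1,3,5,6,7)[OF S(3)] X_bounds(1,3,6,7)[OF S(4)] n
        by (intro mult_left_mono mult_left_mono_neg; linarith)+
      then show ?thesis unfolding lf_def rot_def by simp
    qed
    ultimately show ?thesis
      by (subst meet_at_ends_commute, intro meet_at_ends_separated[of ?n "1 - ?n" _ "?f (pt u)"]) auto
  qed
qed

text \<open>This is the line of the roots, \<open>x - 2 * y = 2 * W\<close>, which guards the ray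
  against links that arrive from the previous one.\<close>

lemma inter_root: "inter p c \<Longrightarrow> pt c = (2 * real W + 2 * K c, real (K c))"
  by (auto simp: inter_def pt_def)

text \<open>In the frame of the ray of \<open>c\<close>, the link starts below the horizontal axis.
  Vertices ranked after \<open>c\<close> lie above the height of \<open>c\<close>. Vertices ranked
  before \<open>c\<close> lie on or above the line of the roots because
  \<open>K + d \<le> j\<close>, whereas the link is strictly below that line except at
  \<open>c\<close>; those that lie on the line have smaller abscissae than \<open>c\<close>.\<close>

lemma intra_inter_3:
  assumes a: "intra u v" and b: "inter p c" and r: "ry u = ry c"
  shows "meet_at_ends (pt u) (pt v) (rot (rot (rot (pt p)))) (pt c)"
proof -
  have S: "u \<in> S" "v \<in> S" "p \<in> S" "c \<in> S" using a b by (auto simp: intra_def inter_def)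
  have eq: "ry v = ry c" "K v = K u" "K c = j c" using a b r by (auto simp: intra_def inter_def)
  have jv: "j u \<le> j v" using intra_j[OF a] by auto
  have W0: "0 < real W" using X_bounds(5,6)[OF S(1)] by linarith
  consider "j c < j u" | "u = c" | "j u < K c" "j v < K c"
    using same_rayD[OF S(1,4) r] same_rayD[OF S(2,4) eq(1)] depth[OF S(1)] depth[OF S(2)] depth[OF S(4)] eq(2,3) jv
    by auto
  then show ?thesis
  proof cases
    case 1
    then show ?thesis using X_bounds(1,5,7)[OF S(3)] X_bounds(3)[OF S(1)] X_bounds(3)[OF S(2)] X_bounds(6)[OF S(1)] inter_root[OF b] jv eq
      by (subst meet_at_ends_commute, intro meet_at_ends_separated[of 0 1 _ "real (j u)"]) (auto simp: lf_def rot_def)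
  next
    case 2
    then show ?thesis using X_bounds(1,5,7)[OF S(3)] X_bounds(3)[OF S(2)] X_bounds(3,6)[OF S(1)] jv
      by (subst meet_at_ends_commute, subst meet_at_ends_flip1, intro meet_at_ends_touching[of 0 1 _ "real (j u)"]) (auto simp: lf_def rot_def)
  next
    case 3
    have "fst (pt w) < 2 * real W + 2 * K c" "fst (pt w) \<le> 2 * real W + 2 * snd (pt w)"
      if "w \<in> S" "j w < K c" for w
      using X_bounds(2,3,4,8)[OF that(1)] that(2) by linarith+
    from this[OF S(1) 3(1)] this[OF S(2) 3(2)] show ?thesis
      using X_bounds(1,3,6,7)[OF S(3)] W0
      by (subst meet_at_ends_commute, subst meet_at_ends_flip1,
          intro meet_at_ends_touching[of "-1" 2 _ "- 2 * real W" _ _ _ "-1" 0])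
        (simp_all add: lf_def rot_def inter_root[OF b])
  qed
qed

lemma intra_inter_opposite:
  assumes a: "intra u v" and b: "inter p c" and s: "s \<in> {1, 2 :: nat}"
  shows "meet_at_ends (pt u) (pt v) ((rot ^^ s) (pt p)) ((rot ^^ Suc s) (pt c))"
proof -
  have S: "u \<in> S" "v \<in> S" "p \<in> S" "c \<in> S" using a b by (auto simp: intra_def inter_def)
  note B = S[THEN X_bounds(1)] S[THEN X_bounds(2)] S[THEN X_bounds(3)]
    S[THEN X_bounds(4)] S[THEN X_bounds(5)] S[THEN X_bounds(6)] S[THEN X_bounds(7)]
  show ?thesis
    apply (rule meet_at_ends_separated[of "-1" 0 _ "- real W"])
    using s B by (auto simp: lf_def rot_def eval_nat_numeral)
qed

section \<open>Pairs of links between rays\<close>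

lemma inter_inter_1:
  assumes a: "inter p c" and b: "inter q e" and r: "ry q = ry c"
  shows "meet_at_ends (rot (rot (rot (pt p)))) (pt c) (pt q) (rot (pt e))"
proof -
  have S: "p \<in> S" "c \<in> S" "q \<in> S" "e \<in> S" using a b by (auto simp: inter_def)
  have eq: "K c = j c" using a by (auto simp: inter_def)
  have W0: "0 < real W" using X_bounds(5,6)[OF S(1)] by linarith
  \<comment> \<open>One link enters the ray on which the other starts. The lines of
    \<open>intra_inter_3\<close> work again, with the far end \<open>rot (pt e)\<close> above each
    of them.\<close>
  consider "j c < j q" | "q = c" | "j q < K c"
    using same_rayD[OF S(3,2) r] depth[OF S(3)] depth[OF S(2)] eq by auto
  then show ?thesis
  proof cases
    case 1
    then show ?thesis using X_bounds(1,7)[OF S(1)] X_bounds(3)[OF S(3)] X_bounds(1,7)[OF S(4)] X_bounds(5,6)[OF S(3)] inter_root[OF a] eq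
      by (intro meet_at_ends_separated[of 0 1 _ "real (j q)"]) (auto simp: lf_def rot_def)
  next
    case 2
    then show ?thesis using X_bounds(1,5,7)[OF S(1)] X_bounds(1,7)[OF S(4)] X_bounds(3,5,6)[OF S(3)]
      by (subst meet_at_ends_flip1, intro meet_at_ends_touching[of 0 1 _ "real (j q)"]) (auto simp: lf_def rot_def)
  next
    case 3
    then have "fst (pt q) < 2 * real W + 2 * K c" "fst (pt q) \<le> 2 * real W + 2 * snd (pt q)"
      using X_bounds(2,3,4,8)[OF S(3)] by linarith+
    then show ?thesis
      using X_bounds(1,3,6,7)[OF S(1)] X_bounds(7)[OF S(4)] X_bounds(7)[OF S(2)] W0
      by (subst meet_at_ends_flip1, intro meet_at_ends_touching[of "-1" 2 _ "- 2 * real W" _ _ _ "-1" 0])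
        (simp_all add: lf_def rot_def inter_root[OF a] inter_root[OF b])
  qed
qed

text \<open>The links are in opposite quadrants, and the antidiagonal \<open>x + y = 0\<close> lies
  between them. The rotated root reaches past its quadrant, to abscissa \<open>- K c\<close>, but
  its ordinate \<open>2 * W + 2 * K c\<close> keeps it on the right side.\<close>

lemma inter_inter_2:
  assumes a: "inter p c" and b: "inter q e"
  shows "meet_at_ends (pt p) (rot (pt c)) (rot (rot (pt q))) (rot (rot (rot (pt e))))"
proof -
  have S: "p \<in> S" "c \<in> S" "q \<in> S" "e \<in> S" using a b by (auto simp: inter_def)
  show ?thesis
    using X_bounds(1,5,6,7)[OF S(1)] X_bounds(1,6,7)[OF S(3)] X_bounds(7)[OF S(2)] X_bounds(7)[OF S(4)]
      X_bounds(3)[OF S(1)] X_bounds(3)[OF S(3)]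
    by (intro meet_at_ends_separated[of "-1" "-1" _ 0])
      (simp_all add: lf_def rot_def inter_root[OF a] inter_root[OF b])
qed

text \<open>\<open>(l, m)\<close> is the direction of the link from \<open>p\<close> to
  \<open>c\<close>, and \<open>?f\<close> is constant along it. A later parent is reached by moving
  up and not left, a later root by a multiple of \<open>(-1, 2)\<close>. Both moves decrease
  \<open>?f\<close>; for the roots this is \<open>2 * l + m < 0\<close>, which says that the link is
  less steep than the rotated line of roots.\<close>

lemma inter_inter_0_aux:
  assumes a: "inter p c" and b: "inter p' c'" and r: "ry p = ry p'"
    and lt: "p < p' \<or> p = p'" "c < c'"
  shows "meet_at_ends (pt p) (rot (pt c)) (pt p') (rot (pt c'))"
proof -
  have S: "p \<in> S" "c \<in> S" "p' \<in> S" "c' \<in> S" using a b by (auto simp: inter_def)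
  have eq: "K c = j c" "K c' = j c'" "ry c = ry c'" using a b r by (auto simp: inter_def)
  have Kc: "K c < K c'" using same_ray[OF S(2,4) eq(3) lt(2)] lt(2) eq(1,2) by linarith
  define l where "l = - real (K c) - fst (pt p)"
  define m where "m = 2 * real W + 2 * real (K c) - snd (pt p)"
  let ?f = "lf (- m) l"
  have lm: "2 * l + m < 0" "l < 0" "0 < m"
    unfolding l_def m_def using X_bounds(1,3,5,6,7)[OF S(1)] X_bounds(7)[OF S(2)] by auto
  have fc: "?f (rot (pt c)) = ?f (pt p)"
    by (simp add: lf_def rot_def l_def m_def inter_root[OF a] algebra_simps)
  have "?f (rot (pt c')) - ?f (rot (pt c)) = (real (K c') - K c) * (2 * l + m)"
    by (simp add: lf_def rot_def inter_root[OF a] inter_root[OF b] algebra_simps)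
  also have "\<dots> < 0" using lm Kc by (intro mult_pos_neg) auto
  finally have fc': "?f (rot (pt c')) < ?f (pt p)" using fc by simp
  show ?thesis
  proof (cases "p = p'")
    case True
    then show ?thesis using fc fc'
      by (subst meet_at_ends_commute, intro meet_at_ends_touching[of "- m" l _ "?f (pt p)"]) auto
  next
    case False
    then have "p < p'" using lt by simp
    from same_ray[OF S(1,3) r this]
    have "fst (pt p) \<le> fst (pt p')" "snd (pt p) < snd (pt p')" 
      using X_bounds(1,3,7,9)[OF S(3)] X_bounds(2,3,4,8,9)[OF S(1)] \<open>p < p'\<close> by auto
    then have "l * (snd (pt p') - snd (pt p)) < 0" "m * (fst (pt p') - fst (pt p)) \<ge> 0"
      using lm by (auto intro: mult_neg_pos)
    then have "?f (pt p') < ?f (pt p)" by (simp add: lf_def algebra_simps)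
    then show ?thesis using fc fc'
      by (subst meet_at_ends_commute, intro meet_at_ends_separated[of "- m" l _ "?f (pt p)"]) auto
  qed
qed

end

text \<open>\<open>fifo\<close> is the queue discipline for component roots: on one ray, earlier
  parents have earlier roots. It makes the links in one quadrant nested. Being phrased with
  \<open>inter\<close>, it needs the smaller locale first.\<close>

locale spiral_drawing = spiral_layout +
  assumes ray: "\<And>v. v \<in> S \<Longrightarrow> ry v < 4"
    and fifo: "\<And>p c p' c'. inter p c \<Longrightarrow> inter p' c' \<Longrightarrow> ry p = ry p' \<Longrightarrow> p < p' \<Longrightarrow> c < c'"
begin

lemma inter_inter_0:
  assumes a: "inter p c" and b: "inter p' c'" and r: "ry p = ry p'" and ne: "(p, c) \<noteq> (p', c')"
  shows "meet_at_ends (pt p) (rot (pt c)) (pt p') (rot (pt c'))"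
proof -
  consider "(p < p' \<or> p = p') \<and> c < c'" | "(p' < p \<or> p' = p) \<and> c' < c"
    using ne fifo[OF a b r] fifo[OF b a r[symmetric]]
    by (cases p p' rule: linorder_cases; cases c c' rule: linorder_cases) auto
  then show ?thesis
    using inter_inter_0_aux[OF a b r] inter_inter_0_aux[OF b a r[symmetric]]
    by cases (auto simp: meet_at_ends_commute)
qed

section \<open>Arbitrary pairs of rays, reduced to the normal positions\<close>

lemma pos_via:
  assumes "ry w = (r + s) mod 4"
  shows "pos w = (rot ^^ r) ((rot ^^ s) (pt w))"
  unfolding pos_def assms rot_funpow_mod by (simp add: funpow_add)

lemma pos_inter: "inter p c \<Longrightarrow> pos c = (rot ^^ ry p) (rot (pt c))"
  using pos_via[of c "ry p" 1] by (simp add: inter_def)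

lemma intra_inter:
  assumes a: "intra u v" and b: "inter p c"
  shows "meet_at_ends (pos u) (pos v) (pos p) (pos c)"
proof -
  have S: "u \<in> S" "v \<in> S" "p \<in> S" "c \<in> S" and rv: "ry v = ry u" and rc: "ry c = Suc (ry p) mod 4"
    using a b by (auto simp: intra_def inter_def)
  \<comment> \<open>Turning everything back by \<open>ry u\<close> puts the first link on ray 0 and
    the start of the second one \<open>s\<close> quarter turns ahead; the added 4 keeps the natural
    subtraction exact.\<close>
  define s where "s = (ry p + 4 - ry u) mod 4"
  have s: "ry p = (ry u + s) mod 4" "s < 4" using mod4_diff ray[OF S(1)] ray[OF S(3)] unfolding s_def by auto
  then have sc: "ry c = (ry u + Suc s) mod 4" using rc by (simp add: mod_simps)
  have "meet_at_ends (pt u) (pt v) ((rot ^^ s) (pt p)) ((rot ^^ Suc s) (pt c))"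
  proof -
    consider "s = 0" | "s = 3" | "s \<in> {1, 2}" using s by force
    then show ?thesis
    proof cases
      case 1
      then have "ry u = ry p" using s ray[OF S(1)] by simp
      then show ?thesis using intra_inter_0[OF a b] 1 by simp
    next
      case 2
      then have "ry u = ry c" using sc ray[OF S(1)] by simp
      then show ?thesis using intra_inter_3[OF a b] 2 by (simp add: eval_nat_numeral rot_4)
    next
      case 3
      then show ?thesis by (rule intra_inter_opposite[OF a b])
    qed
  qed
  then show ?thesis
    unfolding pos_via[OF s(1)] pos_via[OF sc] by (simp add: pos_def rv meet_at_ends_funpow_rot del: funpow.simps)
qed

lemma intra_intra:
  assumes a: "intra u v" and b: "intra u' v'" and ne: "(u, v) \<noteq> (u', v')"
  shows "meet_at_ends (pos u) (pos v) (pos u') (pos v')"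
proof -
  have S: "u \<in> S" "v \<in> S" "u' \<in> S" "v' \<in> S" and rv: "ry v = ry u" "ry v' = ry u'"
    using a b by (auto simp: intra_def)
  define s where "s = (ry u' + 4 - ry u) mod 4"
  have s: "ry u' = (ry u + s) mod 4" "s < 4" using mod4_diff ray[OF S(1)] ray[OF S(3)] unfolding s_def by auto
  have "meet_at_ends (pt u) (pt v) ((rot ^^ s) (pt u')) ((rot ^^ s) (pt v'))"
  proof (cases "s = 0")
    case True
    then have "ry u = ry u'" using s ray[OF S(1)] by simp
    then show ?thesis using intra_intra_same_ray[OF a b _ ne] True by simp
  next
    case False
    then show ?thesis using s(2) by (intro intra_intra_other_ray[OF a b]) force
  qed
  then show ?thesis
    unfolding pos_via[OF s(1)] pos_via[OF s(1)[folded rv(2)]] by (simp add: pos_def rv meet_at_ends_funpow_rot)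
qed

lemma inter_inter:
  assumes a: "inter p c" and b: "inter p' c'" and ne: "(p, c) \<noteq> (p', c')"
  shows "meet_at_ends (pos p) (pos c) (pos p') (pos c')"
proof -
  have succ: "meet_at_ends (pos p) (pos c) (pos q) (pos e)"
    if a: "inter p c" and b: "inter q e" and q: "ry q = ry c" for p c q e
  proof -
    have "ry p = (ry c + 3) mod 4"
      using a ray[of p] by (auto simp: inter_def mod_simps)
    from pos_via[OF this] have "pos p = (rot ^^ ry c) (rot (rot (rot (pt p))))"
      by (simp add: eval_nat_numeral)
    then show ?thesis
      using inter_inter_1[OF a b q] pos_inter[OF b] by (simp add: pos_def q meet_at_ends_funpow_rot)
  qed
  have S: "p \<in> S" "c \<in> S" "p' \<in> S" "c' \<in> S" and rc: "ry c = Suc (ry p) mod 4" "ry c' = Suc (ry p') mod 4"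
    using a b by (auto simp: inter_def)
  consider "ry p' = ry p" | "ry p' = ry c" | "ry p = ry c'" | "ry p' = (ry p + 2) mod 4"
  proof -
    define s where "s = (ry p' + 4 - ry p) mod 4"
    have s: "ry p' = (ry p + s) mod 4" "s < 4"
      using mod4_diff ray[OF S(1)] ray[OF S(3)] unfolding s_def by auto
    consider "s = 0" | "s = 1" | "s = 2" | "s = 3" using s(2) by linarith
    then show thesis
    proof cases
      case 1
      then show thesis using that(1) s(1) ray[OF S(1)] by simp
    next
      case 2
      then show thesis using that(2) s(1) rc(1) by simp
    next
      case 3
      then show thesis using that(4) s(1) by simp
    next
      case 4
      then have "ry c' = (ry p + 4) mod 4" unfolding rc(2) s(1) by (simp add: mod_simps)
      then show thesis using that(3) ray[OF S(1)] by simp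
    qed
  qed
  then show ?thesis
  proof cases
    case 1
    then show ?thesis using inter_inter_0[OF a b _ ne] pos_inter[OF a] pos_inter[OF b]
      by (simp add: pos_def meet_at_ends_funpow_rot)
  next
    case 2
    then show ?thesis by (rule succ[OF a b])
  next
    case 3
    then show ?thesis using succ[OF b a] by (simp add: meet_at_ends_commute)
  next
    case 4
    then have 5: "ry c' = (ry p + 3) mod 4" 
      using mod_Suc_eq[of "ry p + 2" 4] unfolding rc(2) by (simp add: add.commute)
    show ?thesis
      unfolding pos_via[OF 4] pos_via[OF 5] pos_inter[OF a] pos_def[of p] meet_at_ends_funpow_rot
      using inter_inter_2[OF a b] by (simp add: eval_nat_numeral)
  qed
qed

definition link :: "nat \<Rightarrow> nat \<Rightarrow> bool" where
  "link u v \<longleftrightarrow> intra u v \<or> inter u v"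

theorem links_meet_at_ends:
  assumes "link u v" "link u' v'" "(u, v) \<noteq> (u', v')"
  shows "meet_at_ends (pos u) (pos v) (pos u') (pos v')"
  using assms(1,2) intra_intra[OF _ _ assms(3)] inter_inter[OF _ _ assms(3)]
    intra_inter[of u v u' v'] intra_inter[of u' v' u v] unfolding link_def
  by (metis meet_at_ends_commute)

lemma inj_on_pos: "inj_on pos S"
proof (rule inj_onI, rule ccontr)
  fix u v assume uv: "u \<in> S" "v \<in> S" "pos u = pos v" "u \<noteq> v"
  define s where "s = (ry v + 4 - ry u) mod 4"
  have s: "ry v = (ry u + s) mod 4" "s < 4" using mod4_diff ray[OF uv(1)] ray[OF uv(2)] unfolding s_def by auto
  have "inj (rot ^^ ry u)" by (induction "ry u") (auto intro: inj_compose inj_rot simp: inj_rot inj_fn)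
  then have "pt u = (rot ^^ s) (pt v)"
    using uv(3) unfolding pos_via[OF s(1)] by (simp add: pos_def inj_eq)
  moreover have "j u \<noteq> j v" if "ry u = ry v"
    using same_rayD[OF uv(1,2) that] uv(4) depth[OF uv(1)] depth[OF uv(2)] by arith
  moreover have "ry u = ry v" if "s = 0" using that s ray[OF uv(1)] by simp
  moreover have "s = 0 \<or> s = 1 \<or> s = 2 \<or> s = 3" using s by auto
  ultimately show False
    using X_bounds(1-7)[OF uv(1)] X_bounds(1-7)[OF uv(2)]
    by (auto simp: prod_eq_iff rot_def eval_nat_numeral)
qed

lemma abs_pos_le:
  assumes "v \<in> S"
  shows "\<bar>fst (pos v)\<bar> \<le> 4 * real W" "\<bar>snd (pos v)\<bar> \<le> 4 * real W"
proof -
  have "\<bar>fst ((rot ^^ r) (pt v))\<bar> \<le> 4 * real W \<and> \<bar>snd ((rot ^^ r) (pt v))\<bar> \<le> 4 * real W" for r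
    using X_bounds[OF assms] by (induction r) (auto simp: rot_def)
  then show "\<bar>fst (pos v)\<bar> \<le> 4 * real W" "\<bar>snd (pos v)\<bar> \<le> 4 * real W"
    by (auto simp: pos_def)
qed

end

section \<open>The traversal\<close>

text \<open>The ray always has the parity of the bucket. Different buckets of equal parity are at
  least two apart, so an edge between them is in no window and the ray may stay the same.\<close>

definition child_ray :: "nat \<Rightarrow> nat \<Rightarrow> nat \<Rightarrow> nat" where
  "child_ray r a b = (r + (if a mod 2 = b mod 2 then 0 else 1)) mod 4"

lemma child_ray_parity: "r mod 2 = a mod 2 \<Longrightarrow> child_ray r a b mod 2 = b mod 2"
  using mod_mod_cancel[of 2 4 "Suc r"]
  by (cases "a mod 2 = 0"; cases "b mod 2 = 0") (auto simp: child_ray_def mod_mod_cancel mod_Suc)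

locale traversal =
  fixes E :: "(nat \<times> nat) set" and bk :: "nat \<Rightarrow> nat"
begin

text \<open>\<open>k\<close> is the position of \<open>w\<close> in the visiting order, or the
  number of visited vertices while \<open>w\<close> still waits. The last condition makes the parent
  the latest visited vertex that is less deep than \<open>w\<close>, as \<open>intra\<close>
  requires.\<close>

definition attached ::
    "nat list \<Rightarrow> (nat \<Rightarrow> nat) \<Rightarrow> (nat \<Rightarrow> nat) \<Rightarrow> (nat \<Rightarrow> nat) \<Rightarrow> nat \<Rightarrow> nat \<Rightarrow> bool" where
  "attached out ry dep pp k w \<longleftrightarrow> pp w < k \<and> (out ! pp w, w) \<in> E \<and>
     (if dep w = 0 then bk w \<noteq> bk (out ! pp w) \<and> ry w = child_ray (ry (out ! pp w)) (bk (out ! pp w)) (bk w)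
      else bk w = bk (out ! pp w) \<and> ry w = ry (out ! pp w) \<and> dep w = Suc (dep (out ! pp w)) \<and>
        (\<forall>m. pp w < m \<and> m < k \<longrightarrow> dep w \<le> dep (out ! m)))"

text \<open>Counting over the whole bucket rather than over a window makes the point of a vertex
  independent of time.\<close>

definition rank :: "nat list \<Rightarrow> (nat \<Rightarrow> nat) \<Rightarrow> nat \<Rightarrow> nat" where
  "rank out ry i = card {m. m < i \<and> bk (out ! m) = bk (out ! i) \<and> ry (out ! m) = ry (out ! i)}"

text \<open>\<open>out\<close> lists the visited vertices in the order of their visits and \<open>q\<close> is the worklist.
  Per vertex, \<open>dep\<close> is the depth in its component within the bucket, \<open>pp\<close> the position of the parent in
  \<open>out\<close>, and \<open>kx\<close> the rank of the first vertex of the component.\<close>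

definition valid ::
    "nat list \<Rightarrow> nat list \<Rightarrow> (nat \<Rightarrow> nat) \<Rightarrow> (nat \<Rightarrow> nat) \<Rightarrow> (nat \<Rightarrow> nat) \<Rightarrow> (nat \<Rightarrow> nat) \<Rightarrow> bool" where
  "valid out q ry dep pp kx \<longleftrightarrow>
     distinct (out @ q) \<and>
     (\<forall>v. v \<in> set (out @ q) \<longrightarrow> ry v < 4 \<and> ry v mod 2 = bk v mod 2) \<and>
     (out = [] \<longrightarrow> length q = 1) \<and> (out \<noteq> [] \<longrightarrow> dep (hd out) = 0) \<and>
     (\<forall>v. v \<in> set q \<longrightarrow> out = [] \<longrightarrow> dep v = 0) \<and>
     (\<forall>v. v \<in> set q \<longrightarrow> out \<noteq> [] \<longrightarrow> attached out ry dep pp (length out) v) \<and>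
     (\<forall>k. 0 < k \<longrightarrow> k < length out \<longrightarrow> attached out ry dep pp k (out ! k)) \<and>
     (\<forall>k. k < length out \<longrightarrow> dep (out ! k) = 0 \<longrightarrow> kx (out ! k) = rank out ry k) \<and>
     (\<forall>k. k < length out \<longrightarrow> 0 < dep (out ! k) \<longrightarrow>
        dep (out ! k) \<le> Suc (dep (out ! (k - 1))) \<and> bk (out ! k) = bk (out ! (k - 1)) \<and>
          ry (out ! k) = ry (out ! (k - 1)) \<and> kx (out ! k) = kx (out ! (k - 1))) \<and>
     (\<forall>v. v \<in> set q \<longrightarrow> 0 < dep v \<longrightarrow> dep v \<le> Suc (dep (last out)) \<and> bk v = bk (last out) \<and>
          ry v = ry (last out) \<and> kx v = kx (last out)) \<and>
     sorted_wrt (\<lambda>x y. dep y \<le> dep x) q \<and>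
     sorted_wrt (\<lambda>x y. pp x \<le> pp y) (filter (\<lambda>w. dep w = 0) (tl (out @ q)))"

lemma validD:
  assumes "valid out q ry dep pp kx"
  shows "distinct (out @ q)"
    and "v \<in> set (out @ q) \<Longrightarrow> ry v < 4" and "v \<in> set (out @ q) \<Longrightarrow> ry v mod 2 = bk v mod 2"
    and "out = [] \<Longrightarrow> length q = 1" and "out \<noteq> [] \<Longrightarrow> dep (hd out) = 0"
    and "v \<in> set q \<Longrightarrow> out = [] \<Longrightarrow> dep v = 0"
    and "v \<in> set q \<Longrightarrow> out \<noteq> [] \<Longrightarrow> attached out ry dep pp (length out) v"
    and "0 < k \<Longrightarrow> k < length out \<Longrightarrow> attached out ry dep pp k (out ! k)"
    and "k < length out \<Longrightarrow> dep (out ! k) = 0 \<Longrightarrow> kx (out ! k) = rank out ry k"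
    and "k < length out \<Longrightarrow> 0 < dep (out ! k) \<Longrightarrow>
        dep (out ! k) \<le> Suc (dep (out ! (k - 1))) \<and> bk (out ! k) = bk (out ! (k - 1)) \<and>
          ry (out ! k) = ry (out ! (k - 1)) \<and> kx (out ! k) = kx (out ! (k - 1))"
    and "v \<in> set q \<Longrightarrow> 0 < dep v \<Longrightarrow> dep v \<le> Suc (dep (last out)) \<and> bk v = bk (last out) \<and>
          ry v = ry (last out) \<and> kx v = kx (last out)"
    and "sorted_wrt (\<lambda>x y. dep y \<le> dep x) q"
    and "sorted_wrt (\<lambda>x y. pp x \<le> pp y) (filter (\<lambda>w. dep w = 0) (tl (out @ q)))"
  using assms unfolding valid_def by blast+

lemma validI:
  assumes "distinct (out @ q)"
    and "\<And>v. v \<in> set (out @ q) \<Longrightarrow> ry v < 4 \<and> ry v mod 2 = bk v mod 2"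
    and "out \<noteq> []" "dep (hd out) = 0"
    and "\<And>v. v \<in> set q \<Longrightarrow> attached out ry dep pp (length out) v"
    and "\<And>k. 0 < k \<Longrightarrow> k < length out \<Longrightarrow> attached out ry dep pp k (out ! k)"
    and "\<And>k. k < length out \<Longrightarrow> dep (out ! k) = 0 \<Longrightarrow> kx (out ! k) = rank out ry k"
    and "\<And>k. k < length out \<Longrightarrow> 0 < dep (out ! k) \<Longrightarrow>
        dep (out ! k) \<le> Suc (dep (out ! (k - 1))) \<and> bk (out ! k) = bk (out ! (k - 1)) \<and>
          ry (out ! k) = ry (out ! (k - 1)) \<and> kx (out ! k) = kx (out ! (k - 1))"
    and "\<And>v. v \<in> set q \<Longrightarrow> 0 < dep v \<Longrightarrow> dep v \<le> Suc (dep (last out)) \<and> bk v = bk (last out) \<and>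
          ry v = ry (last out) \<and> kx v = kx (last out)"
    and "sorted_wrt (\<lambda>x y. dep y \<le> dep x) q"
    and "sorted_wrt (\<lambda>x y. pp x \<le> pp y) (filter (\<lambda>w. dep w = 0) (tl (out @ q)))"
  shows "valid out q ry dep pp kx"
  unfolding valid_def using assms by blast

section \<open>Steps of the worklist preserve the invariant\<close>

lemma valid_init: "dep r = 0 \<Longrightarrow> ry r = bk r mod 2 \<Longrightarrow> valid [] [r] ry dep pp kx"
  by (auto simp: valid_def intro: less_trans[of _ 2])

lemma rank_append: "i < length out \<Longrightarrow> rank (out @ xs) ry i = rank out ry i"
  unfolding rank_def by (rule arg_cong[of _ _ card]) (auto simp: nth_append)

lemma rank_snoc:
  "rank (out @ [v]) ry (length out) = card {m. m < length out \<and> bk (out ! m) = bk v \<and> ry (out ! m) = ry v}"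
  unfolding rank_def by (rule arg_cong[of _ _ card]) (auto simp: nth_append)

lemma attached_append:
  "k \<le> length out \<Longrightarrow> attached (out @ xs) ry dep pp k w \<longleftrightarrow> attached out ry dep pp k w"
  unfolding attached_def by (auto simp: nth_append)

lemma attached_snoc:
  "attached out ry dep pp (length out) w \<Longrightarrow> dep w \<le> dep v \<Longrightarrow>
     attached (out @ [v]) ry dep pp (Suc (length out)) w"
  unfolding attached_def by (auto simp: nth_append less_Suc_eq)

text \<open>Depths in the worklist do not increase, so \<open>v\<close> is at least as deep as
  everything that still waits and never separates a waiting vertex from its parent. The base rank of
  a new component is fixed only now, when the rank of its root is known.\<close>

lemma valid_pop:
  assumes I: "valid out (v # q) ry dep pp kx"
    and kx': "kx' = (if dep v = 0 then kx(v := card {m. m < length out \<and> bk (out ! m) = bk v \<and> ry (out ! m) = ry v}) else kx)"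
  shows "valid (out @ [v]) q ry dep pp kx'"
proof -
  note D = validD[OF I]
  have dist: "v \<notin> set out" "v \<notin> set q" using D(1) by auto
  have kxo: "kx' (out ! k) = kx (out ! k)" if "k < length out" for k
    using dist that nth_mem[OF that] by (auto simp: kx')
  have q_le: "dep w \<le> dep v" if "w \<in> set q" for w using D(12) that by auto
  have ne: "out \<noteq> []" if "0 < dep v \<or> w \<in> set q" for w using that D(4) D(6)[of v] by auto
  show ?thesis
  proof (rule validI)
    fix k assume k: "k < length (out @ [v])" "dep ((out @ [v]) ! k) = 0"
    then show "kx' ((out @ [v]) ! k) = rank (out @ [v]) ry k"
      using D(9)[of k] kxo[of k] rank_append[of k out] rank_snoc[of out v ry]
      by (cases "k < length out") (auto simp: nth_append kx' less_Suc_eq)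
  next
    fix k assume k: "k < length (out @ [v])" "0 < dep ((out @ [v]) ! k)"
    show "dep ((out @ [v]) ! k) \<le> Suc (dep ((out @ [v]) ! (k - 1))) \<and> bk ((out @ [v]) ! k) = bk ((out @ [v]) ! (k - 1)) \<and>
          ry ((out @ [v]) ! k) = ry ((out @ [v]) ! (k - 1)) \<and> kx' ((out @ [v]) ! k) = kx' ((out @ [v]) ! (k - 1))"
    proof (cases "k < length out")
      case True
      then have "(out @ [v]) ! k = out ! k" "(out @ [v]) ! (k - 1) = out ! (k - 1)" "k - 1 < length out"
        by (auto simp: nth_append)
      with True D(10)[of k] k show ?thesis by (simp only: kxo)
    next
      case False
      with k(1) have "k = length out" by simp
      with k(2) have k': "k = length out" "0 < dep v" by auto
      with ne have "(out @ [v]) ! (k - 1) = last out" by (auto simp: nth_append last_conv_nth)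
      then show ?thesis using D(11)[of v] k' by (simp add: kx' del: One_nat_def)
    qed
  next
    fix w assume w: "w \<in> set q"
    then show "attached (out @ [v]) ry dep pp (length (out @ [v])) w"
      using attached_snoc[OF D(7) q_le[OF w]] ne by auto
  next
    fix k assume "0 < k" "k < length (out @ [v])"
    then show "attached (out @ [v]) ry dep pp k ((out @ [v]) ! k)"
      using D(8)[of k] D(7)[of v] by (cases "k < length out") (auto simp: attached_append nth_append less_Suc_eq)
  next
    fix w assume w: "w \<in> set q" "0 < dep w"
    then have "0 < dep v" using q_le[of w] by simp
    with w D(11)[of v] D(11)[of w] q_le[of w]
    show "dep w \<le> Suc (dep (last (out @ [v]))) \<and> bk w = bk (last (out @ [v])) \<and>
          ry w = ry (last (out @ [v])) \<and> kx' w = kx' (last (out @ [v]))"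
      by (simp add: kx')
  next
    show "dep (hd (out @ [v])) = 0" using D(5) D(6)[of v] by (cases out) auto
  qed (use D(1-3,12,13) in auto)
qed

lemma tl_snoc_append: "tl ((xs @ [x]) @ ys) = tl (xs @ [x]) @ ys"
  by (cases xs) auto

lemma attached_cong:
  assumes "pp' w = pp w" "dep' w = dep w" "ry' w = ry w"
    and "\<And>m. m < k \<Longrightarrow> dep' (out ! m) = dep (out ! m) \<and> ry' (out ! m) = ry (out ! m)"
  shows "attached out ry' dep' pp' k w \<longleftrightarrow> attached out ry dep pp k w"
proof (cases "pp w < k")
  case True
  have "(\<forall>m. pp w < m \<and> m < k \<longrightarrow> dep w \<le> dep' (out ! m)) \<longleftrightarrow> (\<forall>m. pp w < m \<and> m < k \<longrightarrow> dep w \<le> dep (out ! m))"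
    using assms(4) by auto
  then show ?thesis using assms(4)[OF True] unfolding attached_def assms(1-3) by simp
qed (simp add: attached_def assms(1))

text \<open>The invariant speaks only of discovered vertices, so the data of a new vertex can be
  filled in before it is pushed.\<close>

lemma valid_update:
  assumes I: "valid out q ry dep pp kx" and ne: "out \<noteq> []" and w: "w \<notin> set (out @ q)"
  shows "valid out q (ry(w := a)) (dep(w := b)) (pp(w := c)) (kx(w := e))"
    (is "valid _ _ ?ry ?dep ?pp ?kx")
proof -
  note D = validD[OF I]
  have upd: "(f(w := x)) v = f v" if "v \<in> set (out @ q)" for f :: "nat \<Rightarrow> nat" and v x
    using w that by auto
  have updo: "(f(w := x)) (out ! k) = f (out ! k)" if "k < length out" for f :: "nat \<Rightarrow> nat" and k x
    using w that by auto
  have att: "attached out ?ry ?dep ?pp k v \<longleftrightarrow> attached out ry dep pp k v"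
    if "v \<in> set (out @ q)" "k \<le> length out" for k v
    using that by (intro attached_cong upd conjI updo) auto
  have rk: "rank out ?ry k = rank out ry k" if "k < length out" for k
    unfolding rank_def using that by (intro arg_cong[of _ _ card]) (auto simp: updo simp del: fun_upd_apply)
  have tl: "set (tl (out @ q)) \<subseteq> set (out @ q)" by (cases "out @ q") auto
  have filt: "filter (\<lambda>v. ?dep v = 0) (tl (out @ q)) = filter (\<lambda>v. dep v = 0) (tl (out @ q))"
    using tl w by (intro filter_cong) auto
  show ?thesis
  proof (rule validI)
    show "sorted_wrt (\<lambda>x y. ?pp x \<le> ?pp y) (filter (\<lambda>v. ?dep v = 0) (tl (out @ q)))"
      unfolding filt using tl w by (intro sorted_wrt_mono_rel[OF _ D(13)]) auto
    show "sorted_wrt (\<lambda>x y. ?dep y \<le> ?dep x) q"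
      using w by (intro sorted_wrt_mono_rel[OF _ D(12)]) auto
    show "?ry v < 4 \<and> ?ry v mod 2 = bk v mod 2" if "v \<in> set (out @ q)" for v
      using D(2,3)[OF that] upd[OF that] by simp
    show "attached out ?ry ?dep ?pp (length out) v" if "v \<in> set q" for v
      using D(7)[OF that ne] att that by simp
    show "attached out ?ry ?dep ?pp k (out ! k)" if "0 < k" "k < length out" for k
      using D(8)[OF that] att that by simp
    show "?kx (out ! k) = rank out ?ry k" if "k < length out" "?dep (out ! k) = 0" for k
      using D(9)[of k] that(2) unfolding updo[OF that(1)] rk[OF that(1)] using that(1) by simp
    show "?dep (out ! k) \<le> Suc (?dep (out ! (k - 1))) \<and> bk (out ! k) = bk (out ! (k - 1)) \<and>
        ?ry (out ! k) = ?ry (out ! (k - 1)) \<and> ?kx (out ! k) = ?kx (out ! (k - 1))"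
      if "k < length out" "0 < ?dep (out ! k)" for k
    proof -
      have k1: "k - 1 < length out" using that(1) by simp
      show ?thesis using D(10)[OF that(1)] that(2) unfolding updo[OF that(1)] updo[OF k1] by simp
    qed
    show "?dep v \<le> Suc (?dep (last out)) \<and> bk v = bk (last out) \<and>
        ?ry v = ?ry (last out) \<and> ?kx v = ?kx (last out)" if "v \<in> set q" "0 < ?dep v" for v
    proof -
      have m: "v \<in> set (out @ q)" "last out \<in> set (out @ q)" using that(1) ne by auto
      show ?thesis using D(11)[OF that(1)] that(2) unfolding upd[OF m(1)] upd[OF m(2)] by simp
    qed
  qed (use D(1,5) ne w in auto)
qed

text \<open>Everything that waits has depth at most \<open>Suc (dep v)\<close>, the depth of
  \<open>w\<close>, so the front is a position that keeps the depths sorted. The component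
  continues, hence \<open>w\<close> inherits ray and base rank.\<close>

lemma valid_push_same:
  assumes I: "valid (out @ [v]) q ry dep pp kx" and w: "w \<notin> set (out @ [v] @ q)"
    and E: "(v, w) \<in> E" and b: "bk w = bk v"
  shows "valid (out @ [v]) (w # q) (ry(w := ry v)) (dep(w := Suc (dep v))) (pp(w := length out)) (kx(w := kx v))"
    (is "valid _ _ ?ry ?dep ?pp ?kx")
proof -
  have wv: "w \<noteq> v" "w \<notin> set q" "w \<notin> set (out @ [v])" using w by auto
  have J: "valid (out @ [v]) q ?ry ?dep ?pp ?kx" using w by (intro valid_update[OF I]) auto
  note D = validD[OF I] and D' = validD[OF J]
  have att: "attached (out @ [v]) ?ry ?dep ?pp (length (out @ [v])) w"
    using E b wv by (auto simp: attached_def)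
  have q: "?dep x \<le> ?dep w" if "x \<in> set q" for x
    using D(11)[OF that] wv that by (cases "dep x") auto
  show ?thesis
  proof (rule validI)
    show "attached (out @ [v]) ?ry ?dep ?pp (length (out @ [v])) x" if "x \<in> set (w # q)" for x
      using that att D'(7)[of x] by (cases "x = w") auto
    show "?ry x < 4 \<and> ?ry x mod 2 = bk x mod 2" if "x \<in> set ((out @ [v]) @ w # q)" for x
      using that D(2,3)[of x] D(2,3)[of v] b by (cases "x = w") auto
    show "?dep x \<le> Suc (?dep (last (out @ [v]))) \<and> bk x = bk (last (out @ [v])) \<and>
          ?ry x = ?ry (last (out @ [v])) \<and> ?kx x = ?kx (last (out @ [v]))" if "x \<in> set (w # q)" "0 < ?dep x" for x
      using that D'(11)[of x] b wv by (cases "x = w") auto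
    show "sorted_wrt (\<lambda>x y. ?dep y \<le> ?dep x) (w # q)" using D'(12) q by simp
    show "sorted_wrt (\<lambda>x y. ?pp x \<le> ?pp y) (filter (\<lambda>w. ?dep w = 0) (tl ((out @ [v]) @ w # q)))"
      using D'(13) unfolding tl_snoc_append by simp
  qed (use w D'(1,5,8,9,10) in \<open>auto simp del: fun_upd_apply\<close>)
qed

text \<open>Depth zero fits at the back of the worklist. No parent position exceeds
  \<open>length out\<close>, the position of \<open>v\<close>, so the roots remain sorted by their
  parents; this is the origin of \<open>fifo\<close>.\<close>

lemma valid_push_diff:
  assumes I: "valid (out @ [v]) q ry dep pp kx" and w: "w \<notin> set (out @ [v] @ q)"
    and E: "(v, w) \<in> E" and b: "bk w \<noteq> bk v"
  shows "valid (out @ [v]) (q @ [w]) (ry(w := child_ray (ry v) (bk v) (bk w))) (dep(w := 0)) (pp(w := length out)) kx"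
    (is "valid _ _ ?ry ?dep ?pp _")
proof -
  have wv: "w \<noteq> v" "w \<notin> set q" "w \<notin> set out" using w by auto
  have J: "valid (out @ [v]) q ?ry ?dep ?pp kx"
    using valid_update[OF I _ , of w _ 0 "length out" "kx w"] w by simp
  note D = validD[OF I] and D' = validD[OF J]
  have att: "attached (out @ [v]) ?ry ?dep ?pp (length (out @ [v])) w"
    using E b wv by (auto simp: attached_def)
  have ry: "child_ray (ry v) (bk v) (bk w) mod 2 = bk w mod 2" "child_ray (ry v) (bk v) (bk w) < 4"
    using D(3)[of v] child_ray_parity by (auto simp: child_ray_def)
  have pp: "?pp x \<le> length out" if "x \<in> set (tl (out @ [v]) @ q)" for x
  proof (cases "x \<in> set q")
    case True
    then show ?thesis using D'(7)[OF True] by (auto simp: attached_def)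
  next
    case False
    with that have "x \<in> set (tl (out @ [v]))" by simp
    then obtain i where "i < length (tl (out @ [v]))" "x = tl (out @ [v]) ! i" by (metis in_set_conv_nth)
    then have "0 < Suc i" "Suc i < length (out @ [v])" "x = (out @ [v]) ! Suc i"
      by (auto simp: nth_tl)
    then show ?thesis using D'(8)[of "Suc i"] by (auto simp: attached_def simp del: fun_upd_apply)
  qed
  show ?thesis
  proof (rule validI)
    show "attached (out @ [v]) ?ry ?dep ?pp (length (out @ [v])) x" if "x \<in> set (q @ [w])" for x
      using that att D'(7)[of x] by (cases "x = w") auto
    show "?ry x < 4 \<and> ?ry x mod 2 = bk x mod 2" if "x \<in> set ((out @ [v]) @ q @ [w])" for x
      using that D(2,3)[of x] ry by (cases "x = w") auto
    show "?dep x \<le> Suc (?dep (last (out @ [v]))) \<and> bk x = bk (last (out @ [v])) \<and>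
          ?ry x = ?ry (last (out @ [v])) \<and> kx x = kx (last (out @ [v]))" if "x \<in> set (q @ [w])" "0 < ?dep x" for x
      using that D'(11)[of x] by (cases "x = w") auto
    show "sorted_wrt (\<lambda>x y. ?dep y \<le> ?dep x) (q @ [w])"
      using D'(12) by (simp add: sorted_wrt_append)
    show "sorted_wrt (\<lambda>x y. ?pp x \<le> ?pp y) (filter (\<lambda>w. ?dep w = 0) (tl ((out @ [v]) @ q @ [w])))"
    proof -
      have "?pp w = length out" by simp
      then show ?thesis using D'(13) pp unfolding tl_snoc_append append_assoc[symmetric]
        by (auto simp: sorted_wrt_append simp del: fun_upd_apply append_assoc)
    qed
  qed (use w D'(1,5,8,9,10) in \<open>auto simp del: fun_upd_apply\<close>)
qed

end

lemma sorted_wrt_filter_nth: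
  assumes "sorted_wrt R (filter P xs)" "i < k" "k < length xs" "P (xs ! i)" "P (xs ! k)"
  shows "R (xs ! i) (xs ! k)"
proof -
  have "xs ! i \<in> set (take k xs)" "xs ! k \<in> set (drop k xs)"
    using assms(2,3) by (auto simp: in_set_conv_nth Cons_nth_drop_Suc[symmetric])
  moreover have "sorted_wrt R (filter P (take k xs) @ filter P (drop k xs))"
    using assms(1) by (simp flip: filter_append)
  ultimately show ?thesis using assms(4,5) by (auto simp: sorted_wrt_append)
qed

section \<open>From a finished traversal to the layout of a window\<close>

context traversal
begin

lemma rank_less:
  assumes "u < v" "bk (out ! u) = bk (out ! v)" "ry (out ! u) = ry (out ! v)"
  shows "rank out ry u < rank out ry v"
  unfolding rank_def using assms by (intro psubset_card_mono) auto

lemma rank_Suc: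
  assumes "bk (out ! Suc u) = bk (out ! u)" "ry (out ! Suc u) = ry (out ! u)"
  shows "rank out ry (Suc u) = Suc (rank out ry u)"
proof -
  have "{m. m < Suc u \<and> bk (out ! m) = bk (out ! Suc u) \<and> ry (out ! m) = ry (out ! Suc u)}
      = insert u {m. m < u \<and> bk (out ! m) = bk (out ! u) \<and> ry (out ! m) = ry (out ! u)}"
    using assms by (auto simp: less_Suc_eq)
  then show ?thesis by (simp add: rank_def)
qed

text \<open>Equality holds at the root of a component. Each further vertex of it raises the rank by
  exactly one and the depth by at most one.\<close>

lemma base_plus_depth_le_rank:
  assumes I: "valid out q ry dep pp kx"
  shows "k < length out \<Longrightarrow> kx (out ! k) + dep (out ! k) \<le> rank out ry k"
proof (induction k)
  case 0
  then show ?case using validD(5)[OF I] validD(9)[OF I, of 0] by (simp add: hd_conv_nth)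
next
  case (Suc k)
  show ?case
  proof (cases "dep (out ! Suc k) = 0")
    case True
    then show ?thesis using validD(9)[OF I Suc.prems] by simp
  next
    case False
    then show ?thesis using validD(10)[OF I Suc.prems] Suc rank_Suc[of out k ry] by simp
  qed
qed

lemma component_segment:
  assumes I: "valid out q ry dep pp kx" and v: "v < length out" and le: "u \<le> v"
    and pos: "\<And>m. u < m \<Longrightarrow> m \<le> v \<Longrightarrow> 0 < dep (out ! m)"
  shows "bk (out ! v) = bk (out ! u) \<and> ry (out ! v) = ry (out ! u) \<and> kx (out ! v) = kx (out ! u) \<and>
    rank out ry v = rank out ry u + (v - u) \<and> dep (out ! v) \<le> dep (out ! u) + (v - u)"
  using le v pos
proof (induction v rule: dec_induct)
  case (step v)
  then have "0 < dep (out ! Suc v)" by simp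
  from validD(10)[OF I step.prems(1) this] step rank_Suc[of out v ry] show ?case by auto
qed simp

lemma same_group_rank:
  assumes I: "valid out q ry dep pp kx" and v: "v < length out" and le: "u < v"
    and g: "bk (out ! u) = bk (out ! v)" "ry (out ! u) = ry (out ! v)"
  shows "rank out ry u < kx (out ! v) \<or> kx (out ! u) = kx (out ! v) \<and>
    rank out ry v = rank out ry u + (v - u) \<and> dep (out ! v) \<le> dep (out ! u) + (v - u)"
proof (cases "\<exists>m. u < m \<and> m \<le> v \<and> dep (out ! m) = 0")
  case True
  \<comment> \<open>\<open>s\<close> is the position of the root of the component of
    \<open>v\<close>. It comes after \<open>u\<close>, so its rank, the base rank of
    \<open>v\<close>, exceeds the rank of \<open>u\<close>.\<close>
  define s where "s = (GREATEST m. u < m \<and> m \<le> v \<and> dep (out ! m) = 0)"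
  have s: "u < s" "s \<le> v" "dep (out ! s) = 0"
    using GreatestI_ex_nat[OF True, of v] unfolding s_def by auto
  have "0 < dep (out ! m)" if "s < m" "m \<le> v" for m
    using Greatest_le_nat[of "\<lambda>m. u < m \<and> m \<le> v \<and> dep (out ! m) = 0" m v] that s
    unfolding s_def[symmetric] by fastforce
  from component_segment[OF I v s(2) this]
  have "bk (out ! v) = bk (out ! s)" "ry (out ! v) = ry (out ! s)" "kx (out ! v) = kx (out ! s)" by auto
  moreover have "kx (out ! s) = rank out ry s" using validD(9)[OF I] s v by auto
  ultimately show ?thesis using rank_less[OF s(1), of out ry] g by simp
next
  case False
  then show ?thesis using component_segment[OF I v, of u] le by force
qed

lemma rank_bound:
  assumes I: "valid out q ry dep pp kx" and k: "k < length out"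
    and W: "card {v \<in> set out. bk v = bk (out ! k)} \<le> W"
  shows "rank out ry k < W"
proof -
  have d: "distinct out" using validD(1)[OF I] by simp
  let ?A = "{m. m < k \<and> bk (out ! m) = bk (out ! k) \<and> ry (out ! m) = ry (out ! k)}"
  \<comment> \<open>Counting \<open>k\<close> itself makes the bound strict.\<close>
  have "card (insert k ?A) = card ((!) out ` insert k ?A)"
    using d k by (intro card_image[symmetric]) (auto simp: inj_on_def nth_eq_iff_index_eq)
  also have "\<dots> \<le> card {v \<in> set out. bk v = bk (out ! k)}"
    using k by (intro card_mono) auto
  finally show ?thesis using W by (simp add: rank_def)
qed

lemma spiral_drawing_traversal:
  assumes I: "valid out [] ry dep pp kx"
    and S: "S \<subseteq> {..<length out}"
    and near: "\<And>u v. u \<in> S \<Longrightarrow> v \<in> S \<Longrightarrow> bk (out ! u) \<le> Suc (bk (out ! v))"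
    and W: "\<And>b. card {v \<in> set out. bk v = b} \<le> W"
  shows "spiral_drawing S W (\<lambda>i. kx (out ! i)) (rank out ry) (\<lambda>i. dep (out ! i)) (\<lambda>i. ry (out ! i)) (\<lambda>i. pp (out ! i))"
    (is "spiral_drawing S W ?K ?j ?d ?ry ?par")
proof -
  have lt: "v < length out" if "v \<in> S" for v using S that by auto
  \<comment> \<open>Equal rays give buckets of equal parity, and \<open>near\<close> leaves no room
    for two different ones.\<close>
  have group: "bk (out ! u) = bk (out ! v)" if "u \<in> S" "v \<in> S" "ry (out ! u) = ry (out ! v)" for u v
  proof -
    have "bk (out ! u) mod 2 = bk (out ! v) mod 2"
      using validD(3)[OF I, of "out ! u"] validD(3)[OF I, of "out ! v"] lt that by simp
    moreover have "bk (out ! u) \<le> Suc (bk (out ! v))" "bk (out ! v) \<le> Suc (bk (out ! u))"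
      using near that by auto
    ultimately show ?thesis by presburger
  qed
  interpret spiral_layout S W ?K ?j ?d ?ry ?par
  proof
    show "?K v + ?d v \<le> ?j v" if "v \<in> S" for v using base_plus_depth_le_rank[OF I lt[OF that]] .
    show "?j v < W" if "v \<in> S" for v using rank_bound[OF I lt[OF that] W] .
    show "?j u < ?K v \<or> ?K u = ?K v \<and> ?j v = ?j u + (v - u) \<and> ?d v \<le> ?d u + (v - u)"
      if "u \<in> S" "v \<in> S" "?ry u = ?ry v" "u < v" for u v
      using same_group_rank[OF I lt[OF that(2)] that(4) group[OF that(1-3)] that(3)] .
  qed
  show ?thesis
  proof
    show "?ry v < 4" if "v \<in> S" for v using validD(2)[OF I] lt[OF that] by simp
    show "c < c'" if "inter p c" "inter p' c'" "ry (out ! p) = ry (out ! p')" "p < p'" for p c p' c'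
    proof (rule ccontr)
      assume "\<not> c < c'"
      moreover have "c \<noteq> c'" using that by (auto simp: inter_def)
      ultimately have "c' < c" by simp
      have c: "0 < c" "0 < c'" "c < length out" "c' < length out" "dep (out ! c) = 0" "dep (out ! c') = 0"
        "pp (out ! c) = p" "pp (out ! c') = p'"
        using that lt by (auto simp: inter_def)
      \<comment> \<open>The sortedness in \<open>valid\<close> omits the first visited vertex, whose
        parent position means nothing; hence the shift by one, which \<open>0 < c\<close> and
        \<open>0 < c'\<close> permit.\<close>
      then have "pp (tl out ! (c' - 1)) \<le> pp (tl out ! (c - 1))"
        using validD(13)[OF I] c \<open>c' < c\<close>
        by (intro sorted_wrt_filter_nth[where R = "\<lambda>x y. pp x \<le> pp y" and P = "\<lambda>w. dep w = 0"]) (auto simp: nth_tl)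
      then show False using c that(4) by (simp add: nth_tl)
    qed
  qed
qed

lemma link_traversal:
  assumes I: "valid out [] ry dep pp kx"
    and S: "S \<subseteq> {..<length out}"
    and near: "\<And>u v. u \<in> S \<Longrightarrow> v \<in> S \<Longrightarrow> bk (out ! u) \<le> Suc (bk (out ! v))"
    and W: "\<And>b. card {v \<in> set out. bk v = b} \<le> W"
    and v: "v \<in> S" "0 < v" "pp (out ! v) \<in> S"
  shows "pp (out ! v) < v"
    and "spiral_drawing.link S (\<lambda>i. kx (out ! i)) (rank out ry) (\<lambda>i. dep (out ! i)) (\<lambda>i. ry (out ! i)) (\<lambda>i. pp (out ! i))
      (pp (out ! v)) v"
proof -
  interpret spiral_drawing S W "\<lambda>i. kx (out ! i)" "rank out ry" "\<lambda>i. dep (out ! i)" "\<lambda>i. ry (out ! i)" "\<lambda>i. pp (out ! i)"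
    using spiral_drawing_traversal[OF I S near W] .
  define u where "u = pp (out ! v)"
  have lt: "v < length out" "u < length out" using S v by (auto simp: u_def)
  have A: "attached out ry dep pp v (out ! v)" using validD(8)[OF I v(2) lt(1)] .
  then show uv: "pp (out ! v) < v" by (simp add: attached_def)
  show "link (pp (out ! v)) v"
  proof (cases "dep (out ! v) = 0")
    case True
    with A have "bk (out ! v) \<noteq> bk (out ! u)" and r: "ry (out ! v) = child_ray (ry (out ! u)) (bk (out ! u)) (bk (out ! v))"
      by (auto simp: attached_def u_def)
    moreover have "bk (out ! u) \<le> Suc (bk (out ! v))" "bk (out ! v) \<le> Suc (bk (out ! u))"
      using near v by (auto simp: u_def)
    \<comment> \<open>Both ends being in the window, the buckets are consecutive, so
      \<open>child_ray\<close> does advance the ray.\<close>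
    ultimately have "bk (out ! u) mod 2 \<noteq> bk (out ! v) mod 2" by presburger
    then have "ry (out ! v) = Suc (ry (out ! u)) mod 4" using r by (simp add: child_ray_def)
    then have "inter u v"
      using True v validD(9)[OF I lt(1) True] by (simp add: inter_def u_def)
    then show ?thesis by (simp add: link_def u_def)
  next
    case False
    have dv: "dep (out ! v) = Suc (dep (out ! u))" "\<And>m. u < m \<Longrightarrow> m < v \<Longrightarrow> dep (out ! v) \<le> dep (out ! m)"
      using A False by (auto simp: attached_def u_def)
    have "0 < dep (out ! m)" if "u < m" "m \<le> v" for m
      using dv(2)[of m] that False by (cases "m = v") auto
    from component_segment[OF I lt(1) _ this] uv
    have "ry (out ! v) = ry (out ! u)" "kx (out ! v) = kx (out ! u)" by (auto simp: u_def)
    then have "intra u v"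
      using v dv uv by (auto simp: intra_def u_def)
    then show ?thesis by (simp add: link_def u_def)
  qed
qed

end

section \<open>Drawing stories from traversals\<close>

locale tree_story =
  fixes T :: "'a pair_pre_digraph" and \<tau> :: "'a \<Rightarrow> nat" and W :: nat and vs :: "'a list"
  assumes story: "graph_story T \<tau> W" and tree: "undirected_tree T"
    and vs: "distinct vs" "set vs = pverts T"
begin

definition bucket :: "nat \<Rightarrow> nat" where
  "bucket i = (\<tau> (vs ! i) - 1) div W"

definition adjacent :: "(nat \<times> nat) set" where
  "adjacent = {(i, k). i < length vs \<and> k < length vs \<and> (vs ! i, vs ! k) \<in> parcs T}"

sublocale traversal adjacent bucket .

lemma W_pos: "0 < W"
  using story by (simp add: graph_story_def)

lemma card_verts: "card (pverts T) = length vs"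
  using vs distinct_card by metis

lemma tau_bij: "bij_betw \<tau> (pverts T) {1..length vs}"
  using story by (simp add: graph_story_def card_verts)

lemma tau_range: "i < length vs \<Longrightarrow> \<tau> (vs ! i) \<in> {1..length vs}"
  using tau_bij vs(2) nth_mem[of i vs] by (auto simp: bij_betw_def)

lemma card_bucket:
  assumes "A \<subseteq> {..<length vs}"
  shows "card {i \<in> A. bucket i = b} \<le> W"
proof -
  have "inj_on (\<lambda>i. \<tau> (vs ! i)) {..<length vs}"
  proof (rule inj_onI)
    fix i k assume ik: "i \<in> {..<length vs}" "k \<in> {..<length vs}" "\<tau> (vs ! i) = \<tau> (vs ! k)"
    then have "vs ! i = vs ! k"
      using tau_bij vs(2) nth_mem[of i vs] nth_mem[of k vs] by (auto simp: bij_betw_def inj_on_def)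
    with ik show "i = k" using vs(1) by (simp add: nth_eq_iff_index_eq)
  qed
  then have "card {i \<in> A. bucket i = b} = card ((\<lambda>i. \<tau> (vs ! i)) ` {i \<in> A. bucket i = b})"
    using assms by (intro card_image[symmetric]) (auto simp: inj_on_def)
  also have "\<dots> \<le> card {b * W + 1 .. b * W + W}"
  proof (intro card_mono subsetI)
    fix x assume "x \<in> (\<lambda>i. \<tau> (vs ! i)) ` {i \<in> A. bucket i = b}"
    then obtain i where i: "i \<in> A" "(\<tau> (vs ! i) - 1) div W = b" "x = \<tau> (vs ! i)"
      by (auto simp: bucket_def)
    have "1 \<le> x" using i assms tau_range by auto
    have "x - 1 = b * W + (x - 1) mod W"
      using div_mult_mod_eq[of "x - 1" W] unfolding i(3) i(2) by simp
    moreover have "(x - 1) mod W < W" using W_pos by simp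
    ultimately have "b * W \<le> x - 1" "x - 1 < b * W + W" by linarith+
    then show "x \<in> {b * W + 1 .. b * W + W}" using \<open>1 \<le> x\<close> by auto
  qed simp
  finally show ?thesis by simp
qed

lemma drawing_of_traversal:
  fixes mx my :: "nat \<Rightarrow> int"
  assumes I: "valid out [] ry dep pp kx"
    and out: "set out = {..<length vs}" and ne: "out \<noteq> []"
    and mxy: "\<And>k. k < length out \<Longrightarrow> (real_of_int (mx (out ! k)), real_of_int (my (out ! k))) =
      spiral_layout.pos W (\<lambda>i. kx (out ! i)) (rank out ry) (\<lambda>i. dep (out ! i)) (\<lambda>i. ry (out ! i)) k"
  shows "\<exists>\<Gamma>. drawing_story T \<tau> W \<Gamma> \<and> planar_story T \<tau> W \<Gamma> \<and> straight_line_story T \<tau> W \<Gamma> \<and>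
    lies_on_grid T \<tau> W (8 * W + 1) (8 * W + 1) \<Gamma> \<and>
    (\<forall>t. \<forall>i<length vs. vpos (\<Gamma> t) (vs ! i) = (real_of_int (mx i), real_of_int (my i)))"
proof -
  interpret G: pair_graph T using tree by (simp add: undirected_tree_def)
  let ?n = "length out"
  define \<phi> where "\<phi> k = vs ! (out ! k)" for k
  have dout: "distinct out" using validD(1)[OF I] by simp
  have out_lt: "out ! k < length vs" if "k < ?n" for k using out nth_mem[OF that] by auto
  have inj: "u = v" if "u < ?n" "v < ?n" "\<phi> u = \<phi> v" for u v
    using that dout vs(1) out_lt by (auto simp: \<phi>_def nth_eq_iff_index_eq)
  have surj: "\<exists>k<?n. \<phi> k = x" if x: "x \<in> pverts T" for x
  proof -
    obtain i where i: "i < length vs" "vs ! i = x" using x vs(2) by (metis in_set_conv_nth)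
    then obtain k where "k < ?n" "out ! k = i" using out by (metis in_set_conv_nth lessThan_iff)
    with i show ?thesis by (auto simp: \<phi>_def)
  qed
  have \<phi>_verts: "\<phi> k \<in> pverts T" if "k < ?n" for k
    using out_lt[OF that] vs(2) nth_mem by (auto simp: \<phi>_def)
  have parent: "pp (out ! k) < k \<and> (\<phi> (pp (out ! k)), \<phi> k) \<in> parcs T" if "0 < k" "k < ?n" for k
    using validD(8)[OF I that] unfolding attached_def by (auto simp: adjacent_def \<phi>_def)
  define P where "P = (\<lambda>k. (\<phi> k, \<phi> (pp (out ! k)))) ` {0<..<?n}"
  \<comment> \<open>Here the graph must be a tree: the parent arcs reach every vertex, so an edge
    outside them would close a cycle. Otherwise there could be edges that are not links.\<close>
  have "parcs T \<subseteq> P \<union> P\<inverse>"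
  proof (rule tree_arcs_subset_connecting[OF tree])
    show "P \<subseteq> parcs T" using parent G.arcs_symmetric by (auto simp: P_def)
    have "k < ?n \<Longrightarrow> (\<phi> k, \<phi> 0) \<in> P\<^sup>*" for k
    proof (induction k rule: less_induct)
      case (less k)
      show ?case
      proof (cases "k = 0")
        case False
        with less parent[of k] have "(\<phi> (pp (out ! k)), \<phi> 0) \<in> P\<^sup>*" by auto
        moreover have "(\<phi> k, \<phi> (pp (out ! k))) \<in> P" using False less.prems by (auto simp: P_def)
        ultimately show ?thesis by (meson converse_rtrancl_into_rtrancl)
      qed simp
    qed
    then show "(v, \<phi> 0) \<in> P\<^sup>*" if "v \<in> pverts T" for v using surj[OF that] by auto
  qed
  then have arcs: "\<exists>k. 0 < k \<and> k < ?n \<and> {x, y} = {\<phi> k, \<phi> (pp (out ! k))}" if "(x, y) \<in> parcs T" for x y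
  proof -
    have "(x, y) \<in> P \<or> (y, x) \<in> P" using \<open>parcs T \<subseteq> P \<union> P\<inverse>\<close> that by blast
    then obtain k where "0 < k" "k < ?n"
      "(x, y) = (\<phi> k, \<phi> (pp (out ! k))) \<or> (y, x) = (\<phi> k, \<phi> (pp (out ! k)))"
      unfolding P_def by auto
    then show ?thesis by (intro exI[of _ k]) auto
  qed
  define p where "p v = (let i = (THE i. i < length vs \<and> vs ! i = v) in (real_of_int (mx i), real_of_int (my i)))" for v
  have p_vs: "p (vs ! i) = (real_of_int (mx i), real_of_int (my i))" if "i < length vs" for i
  proof -
    have "(THE k. k < length vs \<and> vs ! k = vs ! i) = i"
      using that vs(1) by (intro the_equality) (auto simp: nth_eq_iff_index_eq)
    then show ?thesis by (simp add: p_def)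
  qed
  \<comment> \<open>The same drawing data serve all times, which settles consistency. The convex
    hull expresses the segment by the unordered edge, without a choice of direction.\<close>
  define \<Gamma> where "\<Gamma> t = \<lparr>vpos = p, ecurve = \<lambda>e. convex hull (p ` e)\<rparr>" for t :: nat
  define V where "V t = {v \<in> pverts T. int t - int W < int (\<tau> v) \<and> \<tau> v \<le> t}" for t
  have H: "verts (window_graph T \<tau> W t) = V t"
      "arcs (window_graph T \<tau> W t) = {a \<in> parcs T. fst a \<in> V t \<and> snd a \<in> V t}"
      "tail (window_graph T \<tau> W t) = fst" "head (window_graph T \<tau> W t) = snd" for t
    by (auto simp: window_graph_def V_def)
  have window: "inj_on p (V t) \<and>
      (\<forall>v\<in>V t. \<exists>x\<in>{- (4 * int W)..4 * int W}. \<exists>y\<in>{- (4 * int W)..4 * int W}. p v = (real_of_int x, real_of_int y)) \<and>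
      (\<forall>a b c d. (a, b) \<in> parcs T \<longrightarrow> (c, d) \<in> parcs T \<longrightarrow> a \<in> V t \<longrightarrow> b \<in> V t \<longrightarrow> c \<in> V t \<longrightarrow> d \<in> V t \<longrightarrow>
        {a, b} \<noteq> {c, d} \<longrightarrow> meet_at_ends (p a) (p b) (p c) (p d)) \<and>
      (\<forall>v a b. (a, b) \<in> parcs T \<longrightarrow> a \<in> V t \<longrightarrow> b \<in> V t \<longrightarrow> v \<in> V t \<longrightarrow>
        meet_at_ends (p v) (p v) (p a) (p b))" for t
  proof -
    define S where "S = {k. k < ?n \<and> \<phi> k \<in> V t}"
    have S: "S \<subseteq> {..<?n}" by (auto simp: S_def)
    have near: "bucket (out ! u) \<le> Suc (bucket (out ! v))" if "u \<in> S" "v \<in> S" for u v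
    proof -
      \<comment> \<open>A window spans fewer than \<open>W\<close> time steps, hence at most two
        consecutive buckets.\<close>
      have "\<tau> (\<phi> u) < \<tau> (\<phi> v) + W" using that by (auto simp: S_def V_def)
      then have "\<tau> (\<phi> u) - 1 \<le> \<tau> (\<phi> v) - 1 + W" by simp
      then have "(\<tau> (\<phi> u) - 1) div W \<le> (\<tau> (\<phi> v) - 1 + W) div W" by (rule div_le_mono)
      then show ?thesis using W_pos by (simp add: bucket_def \<phi>_def)
    qed
    have W: "card {v \<in> set out. bucket v = b} \<le> W" for b
      using out by (intro card_bucket) auto
    interpret spiral_drawing S W "\<lambda>i. kx (out ! i)" "rank out ry" "\<lambda>i. dep (out ! i)" "\<lambda>i. ry (out ! i)" "\<lambda>i. pp (out ! i)"
      using spiral_drawing_traversal[OF I S near W] .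
    have pos: "p (\<phi> k) = pos k" if "k < ?n" for k
      using mxy[OF that] p_vs[OF out_lt[OF that]] by (simp add: \<phi>_def)
    have inV: "\<exists>k\<in>S. \<phi> k = x" if "x \<in> V t" for x
      using that surj[of x] by (auto simp: S_def V_def)
    have edge: "\<exists>u v. link u v \<and> u < v \<and> u \<in> S \<and> v \<in> S \<and> {a, b} = {\<phi> u, \<phi> v}"
      if ab: "(a, b) \<in> parcs T" "a \<in> V t" "b \<in> V t" for a b
    proof -
      obtain k where k: "0 < k" "k < ?n" "{a, b} = {\<phi> k, \<phi> (pp (out ! k))}" using arcs[OF ab(1)] by blast
      then have "\<phi> k \<in> V t" "\<phi> (pp (out ! k)) \<in> V t" using ab by (auto simp: doubleton_eq_iff)
      then have "k \<in> S" "pp (out ! k) \<in> S" using k parent[of k] by (auto simp: S_def)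
      with link_traversal[OF I S near W this(1) k(1) this(2)] k(3) show ?thesis
        by (intro exI[of _ "pp (out ! k)"] exI[of _ k]) auto
    qed
    have meet_sym: "meet_at_ends (p a) (p b) c d \<longleftrightarrow> meet_at_ends (p x) (p y) c d"
      "meet_at_ends c d (p a) (p b) \<longleftrightarrow> meet_at_ends c d (p x) (p y)"
      if "{a, b} = {x, y}" for a b x y c d
      using that by (metis doubleton_eq_iff meet_at_ends_flip1, metis doubleton_eq_iff meet_at_ends_flip2)
    show ?thesis
    proof (intro conjI allI impI ballI)
      show "inj_on p (V t)"
      proof (rule inj_onI)
        fix x y assume xy: "x \<in> V t" "y \<in> V t" "p x = p y"
        then obtain u v where uv: "u \<in> S" "\<phi> u = x" "v \<in> S" "\<phi> v = y" using inV by metis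
        from uv have "u < ?n" "v < ?n" using S by auto
        then have "pos u = pos v" using xy(3) pos[of u] pos[of v] uv by simp
        then show "x = y" using inj_onD[OF inj_on_pos] uv by blast
      qed
    next
      fix x assume "x \<in> V t"
      then obtain k where k: "k \<in> S" "\<phi> k = x" using inV by blast
      then have kn: "k < ?n" using S by auto
      have "\<bar>real_of_int (mx (out ! k))\<bar> \<le> 4 * real W" "\<bar>real_of_int (my (out ! k))\<bar> \<le> 4 * real W"
        using abs_pos_le[OF k(1)] mxy[OF kn, symmetric] by auto
      then have "mx (out ! k) \<in> {- (4 * int W)..4 * int W}" "my (out ! k) \<in> {- (4 * int W)..4 * int W}"
        by auto
      moreover have "p x = (real_of_int (mx (out ! k)), real_of_int (my (out ! k)))"
        using k(2) pos[OF kn] mxy[OF kn] by simp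
      ultimately show "\<exists>xa\<in>{- (4 * int W)..4 * int W}. \<exists>y\<in>{- (4 * int W)..4 * int W}. p x = (real_of_int xa, real_of_int y)"
        by blast
    next
      fix a b c d
      assume ab: "(a, b) \<in> parcs T" "(c, d) \<in> parcs T" "a \<in> V t" "b \<in> V t" "c \<in> V t" "d \<in> V t" "{a, b} \<noteq> {c, d}"
      obtain u v where uv: "link u v" "u \<in> S" "v \<in> S" "{a, b} = {\<phi> u, \<phi> v}" using edge ab by metis
      obtain u' v' where uv': "link u' v'" "u' \<in> S" "v' \<in> S" "{c, d} = {\<phi> u', \<phi> v'}" using edge ab by metis
      have "(u, v) \<noteq> (u', v')" using uv(4) uv'(4) ab(7) by auto
      from links_meet_at_ends[OF uv(1) uv'(1) this]
      have "meet_at_ends (p (\<phi> u)) (p (\<phi> v)) (p (\<phi> u')) (p (\<phi> v'))"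
        using pos uv(2,3) uv'(2,3) S by (auto simp: subset_eq)
      then show "meet_at_ends (p a) (p b) (p c) (p d)"
        using meet_sym[OF uv(4)] meet_sym[OF uv'(4)] by simp
    next
      fix x a b
      assume ab: "(a, b) \<in> parcs T" "a \<in> V t" "b \<in> V t" "x \<in> V t"
      obtain u v where uv: "link u v" "u < v" "u \<in> S" "v \<in> S" "{a, b} = {\<phi> u, \<phi> v}" using edge ab by metis
      obtain k where k: "k \<in> S" "\<phi> k = x" using inV ab(4) by blast
      have "link k k" using k by (simp add: link_def intra_def)
      from links_meet_at_ends[OF this uv(1)]
      have "meet_at_ends (pos k) (pos k) (pos u) (pos v)" using uv(2) by auto
      then show "meet_at_ends (p x) (p x) (p a) (p b)"
        using meet_sym[OF uv(5)] pos uv(3,4) k S by (auto simp: subset_eq)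
    qed
  qed
  have grid: "\<forall>v\<in>V t. \<exists>x\<in>{- (4 * int W)..4 * int W}. \<exists>y\<in>{- (4 * int W)..4 * int W}. p v = (real_of_int x, real_of_int y)" for t
    using window[of t] by (elim conjE)
  have curve: "ecurve (\<Gamma> t) {a, b} = closed_segment (p a) (p b)" for t a b
    by (simp add: \<Gamma>_def segment_convex_hull)
  have edge_set: "e \<in> edge_set (window_graph T \<tau> W t) \<longleftrightarrow>
      (\<exists>a b. (a, b) \<in> parcs T \<and> a \<in> V t \<and> b \<in> V t \<and> e = {a, b})" for e t
    by (auto simp: edge_set_def H image_iff Bex_def)
  have drawing: "is_drawing (window_graph T \<tau> W t) (\<Gamma> t)" for t
    unfolding is_drawing_def H edge_set
  proof (intro conjI ballI)
    show "inj_on (vpos (\<Gamma> t)) (V t)" using window[of t] by (simp add: \<Gamma>_def)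
    fix e assume "e \<in> edge_set (window_graph T \<tau> W t)"
    then obtain a b where ab: "(a, b) \<in> parcs T" "a \<in> V t" "b \<in> V t" "e = {a, b}" by (auto simp: edge_set)
    have "a \<noteq> b" using G.pair_no_loops[OF ab(1)] by simp
    then have "p a \<noteq> p b" using window[of t] ab by (auto simp: inj_on_def)
    then show "\<exists>g. arc g \<and> path_image g = ecurve (\<Gamma> t) e \<and> {pathstart g, pathfinish g} = vpos (\<Gamma> t) ` e"
      by (intro exI[of _ "linepath (p a) (p b)"]) (simp add: ab(4) curve, simp add: \<Gamma>_def)
  qed
  have planar: "planar_drawing (window_graph T \<tau> W t) (\<Gamma> t)" for t
    unfolding planar_drawing_def
  proof (intro conjI drawing ballI impI)
    fix e f assume "e \<in> edge_set (window_graph T \<tau> W t)" "f \<in> edge_set (window_graph T \<tau> W t)" and ef: "e \<noteq> f"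
    then obtain a b c d where ab: "(a, b) \<in> parcs T" "a \<in> V t" "b \<in> V t" "e = {a, b}"
      and cd: "(c, d) \<in> parcs T" "c \<in> V t" "d \<in> V t" "f = {c, d}" by (auto simp: edge_set)
    with ef window[of t] have m: "meet_at_ends (p a) (p b) (p c) (p d)" and inj: "inj_on p (V t)" by auto
    have "{p a, p b} \<inter> {p c, p d} = p ` e \<inter> p ` f" by (simp add: ab cd)
    also have "\<dots> = p ` (e \<inter> f)" using inj_on_image_Int[OF inj, of e f] ab cd by auto
    finally show "ecurve (\<Gamma> t) e \<inter> ecurve (\<Gamma> t) f \<subseteq> vpos (\<Gamma> t) ` (e \<inter> f)"
      using m unfolding meet_at_ends_def ab(4) cd(4) curve by (simp add: \<Gamma>_def)
  next
    fix v e assume v: "v \<in> verts (window_graph T \<tau> W t)" and "e \<in> edge_set (window_graph T \<tau> W t)"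
      and on: "vpos (\<Gamma> t) v \<in> ecurve (\<Gamma> t) e"
    then obtain a b where ab: "(a, b) \<in> parcs T" "a \<in> V t" "b \<in> V t" "e = {a, b}" by (auto simp: edge_set)
    have "meet_at_ends (p v) (p v) (p a) (p b)" and inj: "inj_on p (V t)" using window[of t] ab v H by auto
    moreover have "p v \<in> closed_segment (p a) (p b)" using on unfolding ab(4) curve by (simp add: \<Gamma>_def)
    ultimately have "p v \<in> {p a, p b}" by (auto simp: meet_at_ends_def)
    then show "v \<in> e" using inj ab v H by (auto simp: inj_on_def)
  qed
  have "straight_line_drawing (window_graph T \<tau> W t) (\<Gamma> t)" for t
    unfolding straight_line_drawing_def H curve using drawing by (simp add: \<Gamma>_def)
  moreover have "lies_on_grid T \<tau> W (8 * W + 1) (8 * W + 1) \<Gamma>"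
    unfolding lies_on_grid_def
  proof (intro exI conjI ballI)
    let ?b = "4 * int W" and ?a = "- (4 * int W)"
    show "?b - ?a + 1 = int (8 * W + 1)" "?b - ?a + 1 = int (8 * W + 1)" by auto
    fix t assume "t \<in> story_times T W"
    show "\<exists>x\<in>{?a..?b}. \<exists>y\<in>{?a..?b}. vpos (\<Gamma> t) v = (real_of_int x, real_of_int y)"
      if "v \<in> verts (window_graph T \<tau> W t)" for v
      using grid that H by (simp add: \<Gamma>_def)
    show "ecurve (\<Gamma> t) e \<subseteq> {real_of_int ?a..real_of_int ?b} \<times> {real_of_int ?a..real_of_int ?b}"
      if e: "e \<in> edge_set (window_graph T \<tau> W t)" for e
    proof -
      obtain a b where ab: "(a, b) \<in> parcs T" "a \<in> V t" "b \<in> V t" "e = {a, b}" using e by (auto simp: edge_set)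
      have "p x \<in> {real_of_int ?a..real_of_int ?b} \<times> {real_of_int ?a..real_of_int ?b}" if x: "x \<in> V t" for x
      proof -
        obtain k l where kl: "k \<in> {?a..?b}" "l \<in> {?a..?b}" "p x = (real_of_int k, real_of_int l)"
          using grid x by blast
        then show ?thesis
          by (simp only: kl(3) mem_Times_iff fst_conv snd_conv atLeastAtMost_iff of_int_le_iff simp_thms)
      qed
      with ab have "p a \<in> {real_of_int ?a..real_of_int ?b} \<times> {real_of_int ?a..real_of_int ?b}"
        "p b \<in> {real_of_int ?a..real_of_int ?b} \<times> {real_of_int ?a..real_of_int ?b}" by blast+
      then show ?thesis unfolding ab(4) curve
        by (intro closed_segment_subset convex_Times convex_real_interval)
    qed
  qed
  moreover have "drawing_story T \<tau> W \<Gamma>"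
    unfolding drawing_story_def using drawing by (simp add: \<Gamma>_def)
  moreover have "vpos (\<Gamma> t) (vs ! i) = (real_of_int (mx i), real_of_int (my i))" if "i < length vs" for t i
    using p_vs[OF that] by (simp add: \<Gamma>_def)
  ultimately show ?thesis
    using planar by (intro exI[of _ \<Gamma>]) (simp add: planar_story_def straight_line_story_def)
qed

end

section \<open>Running time of programs\<close>

text \<open>The credit \<open>k\<close> is what remains of a time budget; it may be negative in between.\<close>

definition runs :: "int \<Rightarrow> com \<Rightarrow> mstate \<Rightarrow> int \<Rightarrow> (mstate \<Rightarrow> int \<Rightarrow> bool) \<Rightarrow> bool" where
  "runs B c s k Q \<longleftrightarrow> (\<exists>t s'. exec B c s t s' \<and> Q s' (k - int t))"

lemma exec_time_pos: "exec B c s t s' \<Longrightarrow> 0 < t"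
  by (induction rule: exec.induct) auto

inductive_cases exec_SkipE: "exec B Skip s t s'"
inductive_cases exec_AssignE: "exec B (Assign r a) s t s'"
inductive_cases exec_StoreE: "exec B (Store m i a) s t s'"
inductive_cases exec_SeqE: "exec B (Seq c1 c2) s t s'"
inductive_cases exec_CondE: "exec B (Cond b c1 c2) s t s'"

lemma runs_Skip: "runs B Skip s k Q \<longleftrightarrow> Q s (k - 1)"
  unfolding runs_def using exec.Skip[of B s] by (fastforce elim: exec_SkipE)

lemma runs_Assign:
  "runs B (Assign r a) s k Q \<longleftrightarrow> \<bar>aval a s\<bar> \<le> B \<and> Q (s\<lparr>reg := (reg s)(r := aval a s)\<rparr>) (k - 1)"
  unfolding runs_def using exec.Assign[of a s B r] by (fastforce elim: exec_AssignE)

lemma runs_Store: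
  "runs B (Store m i a) s k Q \<longleftrightarrow>
    \<bar>aval a s\<bar> \<le> B \<and> Q (s\<lparr>mem := (mem s)(m := (mem s m)(aval i s := aval a s))\<rparr>) (k - 1)"
  unfolding runs_def using exec.Store[of a s B m i] by (fastforce elim: exec_StoreE)

lemma runs_Seq: "runs B (Seq c1 c2) s k Q \<longleftrightarrow> runs B c1 s k (\<lambda>s' k'. runs B c2 s' k' Q)"
proof
  assume "runs B (Seq c1 c2) s k Q"
  then obtain t s' where "exec B (Seq c1 c2) s t s'" "Q s' (k - int t)" unfolding runs_def by blast
  then show "runs B c1 s k (\<lambda>s' k'. runs B c2 s' k' Q)"
    unfolding runs_def by (elim exec_SeqE) (metis diff_diff_eq of_nat_add)
next
  assume "runs B c1 s k (\<lambda>s' k'. runs B c2 s' k' Q)"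
  then show "runs B (Seq c1 c2) s k Q"
    unfolding runs_def by (metis exec.Seq diff_diff_eq of_nat_add)
qed

lemma runs_Cond:
  "runs B (Cond b c1 c2) s k Q \<longleftrightarrow> (if bval b s then runs B c1 s (k - 1) Q else runs B c2 s (k - 1) Q)"
proof
  assume "runs B (Cond b c1 c2) s k Q"
  then obtain t s' where "exec B (Cond b c1 c2) s t s'" "Q s' (k - int t)" unfolding runs_def by blast
  then show "if bval b s then runs B c1 s (k - 1) Q else runs B c2 s (k - 1) Q"
    unfolding runs_def by (elim exec_CondE) (auto simp: algebra_simps)
next
  assume "if bval b s then runs B c1 s (k - 1) Q else runs B c2 s (k - 1) Q"
  then obtain t s' where "exec B (Cond b c1 c2) s (t + 1) s'" "Q s' (k - 1 - int t)"
    using exec.CondTrue exec.CondFalse unfolding runs_def by (metis (full_types))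
  then show "runs B (Cond b c1 c2) s k Q"
    unfolding runs_def by (intro exI[of _ "t + 1"] exI[of _ s']) (simp add: algebra_simps)
qed

text \<open>As rewrite rules these execute a loop-free program symbolically. A conditional is moved
  in front of its continuation, so that each branch runs to the end on an explicit state.\<close>

lemma runs_Seq_simps:
  "runs B (Seq (Assign r a) c) s k Q \<longleftrightarrow>
    \<bar>aval a s\<bar> \<le> B \<and> runs B c (s\<lparr>reg := (reg s)(r := aval a s)\<rparr>) (k - 1) Q"
  "runs B (Seq (Store m i a) c) s k Q \<longleftrightarrow>
    \<bar>aval a s\<bar> \<le> B \<and> runs B c (s\<lparr>mem := (mem s)(m := (mem s m)(aval i s := aval a s))\<rparr>) (k - 1) Q"
  "runs B (Seq Skip c) s k Q \<longleftrightarrow> runs B c s (k - 1) Q"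
  "runs B (Seq (Seq c1 c2) c) s k Q \<longleftrightarrow> runs B (Seq c1 (Seq c2 c)) s k Q"
  "runs B (Seq (Cond b c1 c2) c) s k Q \<longleftrightarrow>
    (if bval b s then runs B (Seq c1 c) s (k - 1) Q else runs B (Seq c2 c) s (k - 1) Q)"
  unfolding runs_Seq runs_Assign runs_Store runs_Skip runs_Cond by (rule refl)+

lemmas runs_simps = runs_Seq_simps runs_Skip runs_Assign runs_Store runs_Cond

lemma runs_mono: "runs B c s k Q \<Longrightarrow> (\<And>s' k'. Q s' k' \<Longrightarrow> Q' s' k') \<Longrightarrow> runs B c s k Q'"
  unfolding runs_def by blast

text \<open>The credit is also the termination measure: it is positive whenever the body is entered,
  and each run of the body takes at least one step.\<close>

lemma runs_While:
  assumes "I s k"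
    and step: "\<And>s k. I s k \<Longrightarrow> bval b s \<Longrightarrow> 0 < k \<and> runs B c s (k - 1) I"
    and exit: "\<And>s k. I s k \<Longrightarrow> \<not> bval b s \<Longrightarrow> Q s (k - 1)"
  shows "runs B (While b c) s k Q"
  using assms(1)
proof (induction "nat k" arbitrary: s k rule: less_induct)
  case less
  show ?case
  proof (cases "bval b s")
    case True
    with step[OF less.prems] obtain t s' where t: "0 < k" "exec B c s t s'" "I s' (k - 1 - int t)"
      unfolding runs_def by blast
    from t(1) exec_time_pos[OF t(2)] have "nat (k - 1 - int t) < nat k" by auto
    from less.hyps[OF this t(3)] obtain t' s'' where
      "exec B (While b c) s' t' s''" "Q s'' (k - 1 - int t - int t')"
      unfolding runs_def by blast
    with exec.WhileTrue[OF True t(2)] show ?thesis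
      unfolding runs_def by (intro exI[of _ "t + t' + 1"] exI[of _ s'']) (simp add: algebra_simps)
  next
    case False
    with exit[OF less.prems] exec.WhileFalse show ?thesis unfolding runs_def by fastforce
  qed
qed

section \<open>The program and the effect of its loop-free pieces\<close>

definition bucket_expr :: "aexp \<Rightarrow> aexp" where
  "bucket_expr a = Quot (Minus (Mem 0 a) (Const 1)) (Reg 1)"

text \<open>Four consecutive cells per bucket, one per ray, so different pairs of bucket and ray do
  not collide.\<close>

definition counter_cell :: aexp where
  "counter_cell = Plus (Times (Const 4) (Reg 5)) (Reg 6)"

definition store_position :: "aexp \<Rightarrow> aexp \<Rightarrow> com" where
  "store_position x y = Seq (Store 3 (Reg 4) x) (Store 4 (Reg 4) y)"

definition place_vertex :: com where
  "place_vertex =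
    Cond (Equal (Reg 6) (Const 0)) (store_position (Reg 8) (Reg 7))
   (Cond (Equal (Reg 6) (Const 1)) (store_position (Minus (Const 0) (Reg 7)) (Reg 8))
   (Cond (Equal (Reg 6) (Const 2)) (store_position (Minus (Const 0) (Reg 8)) (Minus (Const 0) (Reg 7)))
      (store_position (Reg 7) (Minus (Const 0) (Reg 8)))))"

text \<open>Array 5 contains the ray plus one of each discovered vertex, array 6 the base rank of its component,
  array 7 its depth, array 8 the worklist between the positions in registers 2 and 3, and array 9
  the number of placed vertices per bucket and ray.\<close>

definition visit :: com where
  "visit =
    Seq (Assign 4 (Mem 8 (Reg 2)))
   (Seq (Assign 2 (Plus (Reg 2) (Const 1)))
   (Seq (Assign 5 (bucket_expr (Reg 4)))
   (Seq (Assign 6 (Minus (Mem 5 (Reg 4)) (Const 1)))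
   (Seq (Assign 7 (Mem 9 counter_cell))
   (Seq (Store 9 counter_cell (Plus (Reg 7) (Const 1)))
   (Seq (Cond (Equal (Mem 7 (Reg 4)) (Const 0)) (Store 6 (Reg 4) (Reg 7)) Skip)
   (Seq (Assign 8 (Minus (Plus (Plus (Times (Const 2) (Reg 1)) (Mem 6 (Reg 4))) (Reg 7)) (Mem 7 (Reg 4))))
   (Seq place_vertex
        (Assign 9 (Mem 1 (Reg 4)))))))))))"

text \<open>The front register may become negative. Cells have integer addresses, so the worklist
  grows in both directions from cell 0.\<close>

definition discover_same :: com where
  "discover_same =
    Seq (Store 5 (Reg 10) (Plus (Reg 6) (Const 1)))
   (Seq (Store 7 (Reg 10) (Plus (Mem 7 (Reg 4)) (Const 1)))
   (Seq (Store 6 (Reg 10) (Mem 6 (Reg 4)))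
   (Seq (Assign 2 (Minus (Reg 2) (Const 1)))
        (Store 8 (Reg 2) (Reg 10)))))"

text \<open>Array 6 is left alone: the base rank of a new component is stored when its root is
  visited.\<close>

definition discover_other :: com where
  "discover_other =
    Seq (Store 5 (Reg 10)
      (Plus (Rem (Plus (Reg 6) (Rem (Minus (Reg 11) (Reg 5)) (Const 2))) (Const 4)) (Const 1)))
   (Seq (Store 7 (Reg 10) (Const 0))
   (Seq (Store 8 (Reg 3) (Reg 10))
        (Assign 3 (Plus (Reg 3) (Const 1)))))"

definition scan_neighbour :: com where
  "scan_neighbour =
    Seq (Assign 10 (Mem 2 (Reg 9)))
   (Seq (Assign 9 (Plus (Reg 9) (Const 1)))
   (Cond (Equal (Mem 5 (Reg 10)) (Const 0))
     (Seq (Assign 11 (bucket_expr (Reg 10)))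
     (Cond (Equal (Reg 11) (Reg 5)) discover_same discover_other))
     Skip))"

definition scan_all :: com where
  "scan_all = While (Less (Reg 9) (Mem 1 (Plus (Reg 4) (Const 1)))) scan_neighbour"

text \<open>Memory starts at zero, so cell 0 of array 8 already contains vertex 0 and array 7 its
  depth. Setting register 3 to 1 puts that vertex on the worklist.\<close>

definition draw_story :: com where
  "draw_story =
    Seq (Store 5 (Const 0) (Plus (Rem (bucket_expr (Const 0)) (Const 2)) (Const 1)))
   (Seq (Assign 3 (Const 1))
   (While (Less (Reg 2) (Reg 3)) (Seq visit scan_all)))"

definition quarter_turns :: "int \<Rightarrow> int \<Rightarrow> int \<Rightarrow> int \<times> int" where
  "quarter_turns r x y = (if r = 0 then (x, y) else if r = 1 then (- y, x) else if r = 2 then (- x, - y) else (y, - x))"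

text \<open>The values read and computed are named by equations, so that they can later be replaced
  by their meanings in the traversal. The 20 is a rounded bound on the steps.\<close>

lemma runs_visit:
  assumes v: "mem s 8 (reg s 2) = v" and b: "(mem s 0 v - 1) div reg s 1 = b"
    and r: "mem s 5 v - 1 = r" and j: "mem s 9 (4 * b + r) = j"
    and K: "(if mem s 7 v = 0 then j else mem s 6 v) = K"
    and x: "2 * reg s 1 + K + j - mem s 7 v = x"
    and B: "\<bar>v\<bar> \<le> B" "\<bar>reg s 2 + 1\<bar> \<le> B" "\<bar>b\<bar> \<le> B" "\<bar>r\<bar> \<le> B" "\<bar>j\<bar> \<le> B" "\<bar>j + 1\<bar> \<le> B" "\<bar>x\<bar> \<le> B" "\<bar>mem s 1 v\<bar> \<le> B"
    and Q: "\<And>s' k'. k - 20 \<le> k' \<Longrightarrow> reg s' 0 = reg s 0 \<Longrightarrow> reg s' 1 = reg s 1 \<Longrightarrow> reg s' 2 = reg s 2 + 1 \<Longrightarrow>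
      reg s' 3 = reg s 3 \<Longrightarrow> reg s' 4 = v \<Longrightarrow> reg s' 5 = b \<Longrightarrow> reg s' 6 = r \<Longrightarrow> reg s' 9 = mem s 1 v \<Longrightarrow>
      mem s' = (mem s)(
        3 := (mem s 3)(v := fst (quarter_turns r x j)),
        4 := (mem s 4)(v := snd (quarter_turns r x j)),
        6 := (if mem s 7 v = 0 then (mem s 6)(v := j) else mem s 6),
        9 := (mem s 9)(4 * b + r := j + 1)) \<Longrightarrow> Q s' k'"
  shows "runs B visit s k Q"
proof -
  have "runs B visit s k (\<lambda>s' k'. k - 20 \<le> k' \<and> reg s' 0 = reg s 0 \<and> reg s' 1 = reg s 1 \<and> reg s' 2 = reg s 2 + 1 \<and>
      reg s' 3 = reg s 3 \<and> reg s' 4 = v \<and> reg s' 5 = b \<and> reg s' 6 = r \<and> reg s' 9 = mem s 1 v \<and>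
      mem s' = (mem s)(
        3 := (mem s 3)(v := fst (quarter_turns r x j)),
        4 := (mem s 4)(v := snd (quarter_turns r x j)),
        6 := (if mem s 7 v = 0 then (mem s 6)(v := j) else mem s 6),
        9 := (mem s 9)(4 * b + r := j + 1)))"
    unfolding visit_def place_vertex_def store_position_def bucket_expr_def counter_cell_def
    using B K
    by (simp del: One_nat_def add: runs_simps v b r j x[symmetric] quarter_turns_def fun_upd_twist split: if_splits;
        simp add: abs_le_iff)
  then show ?thesis by (rule runs_mono) (use Q in blast)
qed

lemma runs_scan_known:
  assumes w: "mem s 2 (reg s 9) = w" and known: "mem s 5 w \<noteq> 0"
    and B: "\<bar>w\<bar> \<le> B" "\<bar>reg s 9 + 1\<bar> \<le> B"
    and Q: "Q (s\<lparr>reg := (reg s)(10 := w, 9 := reg s 9 + 1)\<rparr>) (k - 4)"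
  shows "runs B scan_neighbour s k Q"
  unfolding scan_neighbour_def
  using B Q by (simp del: One_nat_def add: runs_simps w known)

lemma runs_scan_same:
  assumes w: "mem s 2 (reg s 9) = w" and new: "mem s 5 w = 0"
    and b: "(mem s 0 w - 1) div reg s 1 = reg s 5" and neq: "reg s 4 \<noteq> w"
    and B: "\<bar>w\<bar> \<le> B" "\<bar>reg s 9 + 1\<bar> \<le> B" "\<bar>reg s 5\<bar> \<le> B" "\<bar>reg s 6 + 1\<bar> \<le> B"
      "\<bar>mem s 7 (reg s 4) + 1\<bar> \<le> B" "\<bar>mem s 6 (reg s 4)\<bar> \<le> B" "\<bar>reg s 2 - 1\<bar> \<le> B"
    and Q: "\<And>s'. reg s' = (reg s)(2 := reg s 2 - 1, 9 := reg s 9 + 1, 10 := w, 11 := reg s 5) \<Longrightarrow>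
       mem s' = (mem s)(5 := (mem s 5)(w := reg s 6 + 1), 6 := (mem s 6)(w := mem s 6 (reg s 4)),
         7 := (mem s 7)(w := mem s 7 (reg s 4) + 1), 8 := (mem s 8)(reg s 2 - 1 := w)) \<Longrightarrow> Q s' (k - 10)"
  shows "runs B scan_neighbour s k Q"
proof -
  have "runs B scan_neighbour s k (\<lambda>s' k'. k' = k - 10 \<and>
      reg s' = (reg s)(2 := reg s 2 - 1, 9 := reg s 9 + 1, 10 := w, 11 := reg s 5) \<and>
      mem s' = (mem s)(5 := (mem s 5)(w := reg s 6 + 1), 6 := (mem s 6)(w := mem s 6 (reg s 4)),
         7 := (mem s 7)(w := mem s 7 (reg s 4) + 1), 8 := (mem s 8)(reg s 2 - 1 := w)))"
    unfolding scan_neighbour_def discover_same_def bucket_expr_def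
    using B neq by (simp del: One_nat_def add: runs_simps w new b fun_upd_twist)
  then show ?thesis by (rule runs_mono) (use Q in blast)
qed

lemma runs_scan_other:
  assumes w: "mem s 2 (reg s 9) = w" and new: "mem s 5 w = 0"
    and b: "(mem s 0 w - 1) div reg s 1 = b" "b \<noteq> reg s 5"
    and r: "(reg s 6 + (b - reg s 5) mod 2) mod 4 = r"
    and B: "\<bar>w\<bar> \<le> B" "\<bar>reg s 9 + 1\<bar> \<le> B" "\<bar>b\<bar> \<le> B" "\<bar>r + 1\<bar> \<le> B" "\<bar>reg s 3 + 1\<bar> \<le> B"
    and Q: "\<And>s'. reg s' = (reg s)(3 := reg s 3 + 1, 9 := reg s 9 + 1, 10 := w, 11 := b) \<Longrightarrow>
       mem s' = (mem s)(5 := (mem s 5)(w := r + 1), 7 := (mem s 7)(w := 0), 8 := (mem s 8)(reg s 3 := w)) \<Longrightarrow>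
       Q s' (k - 9)"
  shows "runs B scan_neighbour s k Q"
proof -
  have "runs B scan_neighbour s k (\<lambda>s' k'. k' = k - 9 \<and>
      reg s' = (reg s)(3 := reg s 3 + 1, 9 := reg s 9 + 1, 10 := w, 11 := b) \<and>
      mem s' = (mem s)(5 := (mem s 5)(w := r + 1), 7 := (mem s 7)(w := 0), 8 := (mem s 8)(reg s 3 := w)))"
    unfolding scan_neighbour_def discover_other_def bucket_expr_def
    using B b(2) by (simp del: One_nat_def add: runs_simps w new b(1) r fun_upd_twist)
  then show ?thesis by (rule runs_mono) (use Q in blast)
qed

section \<open>The program simulates the traversal\<close>

lemma nth_concat_sum:
  "v < length xss \<Longrightarrow> e < length (xss ! v) \<Longrightarrow>
     concat xss ! ((\<Sum>k<v. length (xss ! k)) + e) = xss ! v ! e \<and>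
     (\<Sum>k<v. length (xss ! k)) + e < length (concat xss)"
proof (induction xss arbitrary: v)
  case (Cons xs xss)
  show ?case
  proof (cases v)
    case 0
    with Cons.prems show ?thesis by (simp add: nth_append)
  next
    case (Suc u)
    have "(\<Sum>k<v. length ((xs # xss) ! k)) = length xs + (\<Sum>k<u. length (xss ! k))"
      unfolding Suc sum.lessThan_Suc_shift by simp
    with Cons Suc show ?thesis by (simp add: nth_append)
  qed
qed simp

text \<open>The right-hand side is what \<open>discover_other\<close> computes. With a positive
  modulus \<open>mod\<close> is nonnegative, also when the child has the smaller bucket.\<close>

lemma int_child_ray: "int (child_ray r a b) = (int r + (int b - int a) mod 2) mod 4"
proof -
  have "(int b - int a) mod 2 = (if a mod 2 = b mod 2 then 0 else 1)"
    by presburger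
  then show ?thesis by (simp add: child_ray_def zmod_int)
qed

lemma quarter_turns_rot:
  assumes "r < 4"
  shows "map_prod real_of_int real_of_int (quarter_turns (int r) x y) = (rot ^^ r) (real_of_int x, real_of_int y)"
proof -
  consider "r = 0" | "r = 1" | "r = 2" | "r = 3" using assms by linarith
  then show ?thesis by cases (auto simp: quarter_turns_def rot_def eval_nat_numeral)
qed

locale tree_input = tree_story T \<tau> W vs for T :: "'a pair_pre_digraph" and \<tau> W vs +
  fixes adj :: "nat list list"
  assumes adj: "adjacency_lists T vs adj"
begin

abbreviation n :: nat where "n \<equiv> length vs"

definition offset :: "nat \<Rightarrow> nat" where
  "offset v = (\<Sum>k<v. length (adj ! k))"

definition input_kept :: "mstate \<Rightarrow> bool" where
  "input_kept s \<longleftrightarrow> reg s 1 = int W \<and> mem s 0 = array_of (map \<tau> vs) \<and>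
     mem s 1 = array_of (map offset [0..<Suc n]) \<and> mem s 2 = array_of (concat adj)"

definition place :: "nat \<Rightarrow> nat \<Rightarrow> nat \<Rightarrow> nat \<Rightarrow> int \<times> int" where
  "place r K j d = quarter_turns (int r) (2 * int W + int K + int j - int d) (int j)"

definition cell_count :: "nat list \<Rightarrow> (nat \<Rightarrow> nat) \<Rightarrow> nat \<Rightarrow> nat \<Rightarrow> nat" where
  "cell_count out ry b r = card {m. m < length out \<and> bucket (out ! m) = b \<and> ry (out ! m) = r}"

text \<open>A waiting component root has no base rank yet, so array 6 is constrained only for
  visited vertices and for waiting ones of positive depth. The bounds on register 3 limit both ends
  of the worklist to the order of \<open>n\<close>.\<close>

definition linked ::
    "nat list \<Rightarrow> nat list \<Rightarrow> (nat \<Rightarrow> nat) \<Rightarrow> (nat \<Rightarrow> nat) \<Rightarrow> (nat \<Rightarrow> nat) \<Rightarrow> mstate \<Rightarrow> bool" where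
  "linked out q ry dep kx s \<longleftrightarrow> input_kept s \<and>
     (\<forall>i. i < n \<longrightarrow> mem s 5 (int i) = (if i \<in> set (out @ q) then int (ry i) + 1 else 0)) \<and>
     (\<forall>i. i \<in> set (out @ q) \<longrightarrow> mem s 7 (int i) = int (dep i)) \<and>
     (\<forall>i. i \<in> set out \<or> i \<in> set q \<and> 0 < dep i \<longrightarrow> mem s 6 (int i) = int (kx i)) \<and>
     (\<forall>t. t < length q \<longrightarrow> mem s 8 (reg s 2 + int t) = int (q ! t)) \<and>
     reg s 3 = reg s 2 + int (length q) \<and> 1 \<le> reg s 3 \<and> reg s 3 \<le> int (length (out @ q)) \<and>
     (\<forall>b r. r < 4 \<longrightarrow> mem s 9 (4 * int b + int r) = int (cell_count out ry b r)) \<and>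
     (\<forall>k. k < length out \<longrightarrow> (mem s 3 (int (out ! k)), mem s 4 (int (out ! k))) =
        place (ry (out ! k)) (kx (out ! k)) (rank out ry k) (dep (out ! k)))"

lemma adj_length: "length adj = n"
  and adj_distinct: "i < n \<Longrightarrow> distinct (adj ! i)"
  and adj_set: "i < n \<Longrightarrow> set (adj ! i) = {j. (i, j) \<in> adjacent}"
  using adj by (auto simp: adjacency_lists_def adjacent_def)

lemma n_pos: "0 < n"
proof -
  have "pverts T \<noteq> {}" using tree by (auto simp: undirected_tree_def connected_conv)
  then show ?thesis using vs(2) by auto
qed

lemma total_degree: "(\<Sum>i<n. length (adj ! i)) \<le> 2 * n"
proof -
  have "(\<Sum>i<n. length (adj ! i)) = (\<Sum>i<n. card {j. (i, j) \<in> adjacent})"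
    using adj_distinct adj_set by (intro sum.cong) (auto simp flip: distinct_card)
  also have "\<dots> = card (SIGMA i:{..<n}. {j. (i, j) \<in> adjacent})"
    by (subst card_SigmaI) (auto simp: adjacent_def intro: finite_subset[of _ "{..<n}"])
  also have "\<dots> = card ((\<lambda>(i, j). (vs ! i, vs ! j)) ` (SIGMA i:{..<n}. {j. (i, j) \<in> adjacent}))"
    using vs(1) by (intro card_image[symmetric]) (auto simp: inj_on_def adjacent_def nth_eq_iff_index_eq)
  also have "\<dots> \<le> card (parcs T)"
  proof (rule card_mono)
    interpret pair_graph T using tree by (simp add: undirected_tree_def)
    show "finite (parcs T)" by (rule pair_finite_arcs)
  qed (auto simp: adjacent_def)
  also have "\<dots> \<le> 2 * n" using card_tree_arcs[OF tree] card_verts by simp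
  finally show ?thesis .
qed

lemma offset_le: "v \<le> n \<Longrightarrow> offset v \<le> 2 * n"
  using total_degree sum_mono2[of "{..<n}" "{..<v}" "\<lambda>k. length (adj ! k)"] by (auto simp: offset_def)

lemma input_bucket:
  assumes "input_kept s" "i < n"
  shows "(mem s 0 (int i) - 1) div reg s 1 = int (bucket i)"
proof -
  have "mem s 0 (int i) - 1 = int (\<tau> (vs ! i) - 1)"
    using assms tau_range[OF assms(2)] by (auto simp: input_kept_def array_of_def of_nat_diff)
  then show ?thesis using assms(1) by (simp add: input_kept_def bucket_def zdiv_int)
qed

lemma input_offset: "input_kept s \<Longrightarrow> v \<le> n \<Longrightarrow> mem s 1 (int v) = int (offset v)"
  by (auto simp: input_kept_def array_of_def simp del: upt_Suc)

lemma input_neighbour: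
  assumes "input_kept s" "v < n" "e < length (adj ! v)"
  shows "mem s 2 (int (offset v + e)) = int (adj ! v ! e)"
  using assms nth_concat_sum[of v adj e] adj_length
  by (simp add: input_kept_def array_of_def offset_def del: of_nat_add of_nat_sum)

lemma bucket_le: "i < n \<Longrightarrow> bucket i \<le> n"
  using tau_range[of i] order_trans[OF div_le_dividend[of "\<tau> (vs ! i) - 1" W], of n] by (auto simp: bucket_def)

lemma cell_count_le: "cell_count out ry b r \<le> length out"
  using card_mono[of "{..<length out}" "{m. m < length out \<and> bucket (out ! m) = b \<and> ry (out ! m) = r}"]
  by (auto simp: cell_count_def)

lemma cell_count_snoc:
  "cell_count (out @ [v]) ry b r = cell_count out ry b r + (if b = bucket v \<and> r = ry v then 1 else 0)"
proof -
  have "{m. m < length (out @ [v]) \<and> bucket ((out @ [v]) ! m) = b \<and> ry ((out @ [v]) ! m) = r}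
      = {m. m < length out \<and> bucket (out ! m) = b \<and> ry (out ! m) = r} \<union>
        (if b = bucket v \<and> r = ry v then {length out} else {})"
    by (auto simp: nth_append less_Suc_eq)
  then show ?thesis by (simp add: cell_count_def)
qed

lemma rank_snoc_count: "rank (out @ [v]) ry (length out) = cell_count out ry (bucket v) (ry v)"
  by (simp add: rank_snoc cell_count_def)

lemma rank_update:
  assumes "w \<notin> set out" "i < length out"
  shows "rank out (ry(w := a)) i = rank out ry i"
proof -
  have "(ry(w := a)) (out ! m) = ry (out ! m)" if "m < length out" for m
    using assms nth_mem[OF that] by auto
  then show ?thesis
    unfolding rank_def using assms(2) by (intro arg_cong[of _ _ card]) (auto simp del: fun_upd_apply)
qed

section \<open>Machine states follow the steps of the traversal\<close>

lemma linked_cong: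
  assumes "linked out q ry dep kx s" "mem s' = mem s" "reg s' 1 = reg s 1" "reg s' 2 = reg s 2" "reg s' 3 = reg s 3"
  shows "linked out q ry dep kx s'"
  using assms unfolding linked_def input_kept_def by simp

lemma linked_pop:
  assumes L: "linked out (v # q) ry dep kx s" and I: "valid out (v # q) ry dep pp kx"
    and j: "j = cell_count out ry (bucket v) (ry v)"
    and kx': "kx' = (if dep v = 0 then kx(v := j) else kx)"
    and s': "reg s' 1 = reg s 1" "reg s' 2 = reg s 2 + 1" "reg s' 3 = reg s 3"
      "mem s' = (mem s)(
        3 := (mem s 3)(int v := fst (place (ry v) (kx' v) j (dep v))),
        4 := (mem s 4)(int v := snd (place (ry v) (kx' v) j (dep v))),
        6 := (if mem s 7 (int v) = 0 then (mem s 6)(int v := int j) else mem s 6),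
        9 := (mem s 9)(4 * int (bucket v) + int (ry v) := int j + 1))"
  shows "linked (out @ [v]) q ry dep kx' s'"
proof -
  have v: "v \<notin> set out" "v \<notin> set q" using validD(1)[OF I] by auto
  have rv: "ry v < 4" using validD(2)[OF I] by simp
  note L' = L[unfolded linked_def]
  have kxo: "kx' i = kx i" if "i \<noteq> v" for i using that by (simp add: kx')
  have m7: "mem s 7 (int v) = int (dep v)" using L' by simp
  show ?thesis
    unfolding linked_def
  proof (intro conjI allI impI)
    show "input_kept s'" using L' by (simp add: input_kept_def s' del: One_nat_def)
    show "mem s' 5 (int i) = (if i \<in> set ((out @ [v]) @ q) then int (ry i) + 1 else 0)" if "i < n" for i
      using L' that by (simp add: s')
    show "mem s' 7 (int i) = int (dep i)" if "i \<in> set ((out @ [v]) @ q)" for i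
      using L' that by (auto simp: s')
    show "mem s' 6 (int i) = int (kx' i)" if "i \<in> set (out @ [v]) \<or> i \<in> set q \<and> 0 < dep i" for i
      using L' that m7 by (cases "i = v") (auto simp: s' kx')
    show "mem s' 8 (reg s' 2 + int t) = int (q ! t)" if "t < length q" for t
    proof -
      have "mem s 8 (reg s 2 + int (Suc t)) = int ((v # q) ! Suc t)" using L' that by (metis Suc_less_eq length_Cons)
      then show ?thesis by (simp add: s' add.assoc)
    qed
    show "reg s' 3 = reg s' 2 + int (length q)" "1 \<le> reg s' 3" "reg s' 3 \<le> int (length ((out @ [v]) @ q))"
      using L' by (auto simp: s')
    show "mem s' 9 (4 * int b + int r) = int (cell_count (out @ [v]) ry b r)" if r: "r < 4" for b r
    proof -
      have "4 * int b + int r = 4 * int (bucket v) + int (ry v) \<longleftrightarrow> b = bucket v \<and> r = ry v"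
        using r rv by (cases b "bucket v" rule: linorder_cases) auto
      moreover have "mem s 9 (4 * int b + int r) = int (cell_count out ry b r)" using L' r by blast
      ultimately show ?thesis by (auto simp: s' j cell_count_snoc)
    qed
    fix k assume k: "k < length (out @ [v])"
    show "(mem s' 3 (int ((out @ [v]) ! k)), mem s' 4 (int ((out @ [v]) ! k))) =
        place (ry ((out @ [v]) ! k)) (kx' ((out @ [v]) ! k)) (rank (out @ [v]) ry k) (dep ((out @ [v]) ! k))"
    proof (cases "k < length out")
      case True
      then have "out ! k \<noteq> v" using v nth_mem by metis
      with True L' show ?thesis by (simp add: s' nth_append rank_append kxo)
    next
      case False
      with k have "k = length out" by simp
      then show ?thesis using rank_snoc_count[of out v ry] by (simp add: s' j)
    qed
  qed
qed

lemma linked_discover_same: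
  assumes L: "linked (out @ [v]) q ry dep kx s"
    and w: "w \<notin> set (out @ v # q)" "w < n"
    and s': "reg s' 1 = reg s 1" "reg s' 2 = reg s 2 - 1" "reg s' 3 = reg s 3"
      "mem s' = (mem s)(5 := (mem s 5)(int w := int (ry v) + 1), 6 := (mem s 6)(int w := mem s 6 (int v)),
         7 := (mem s 7)(int w := mem s 7 (int v) + 1), 8 := (mem s 8)(reg s 2 - 1 := int w))"
  shows "linked (out @ [v]) (w # q) (ry(w := ry v)) (dep(w := Suc (dep v))) (kx(w := kx v)) s'"
    (is "linked _ _ ?ry ?dep ?kx _")
proof -
  note L' = L[unfolded linked_def]
  have out: "(out @ [v]) ! k \<noteq> w" if "k < length (out @ [v])" for k
    using w(1) nth_mem[OF that] by auto
  show ?thesis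
    unfolding linked_def
  proof (intro conjI allI impI)
    show "input_kept s'" using L' by (simp add: input_kept_def s' del: One_nat_def)
    show "mem s' 5 (int i) = (if i \<in> set ((out @ [v]) @ w # q) then int (?ry i) + 1 else 0)" if "i < n" for i
      using L' that by (auto simp: s')
    show "mem s' 7 (int i) = int (?dep i)" if "i \<in> set ((out @ [v]) @ w # q)" for i
      using L' that by (auto simp: s')
    show "mem s' 6 (int i) = int (?kx i)" if "i \<in> set (out @ [v]) \<or> i \<in> set (w # q) \<and> 0 < ?dep i" for i
      using L' that by (cases "i = w") (auto simp: s')
    show "mem s' 8 (reg s' 2 + int t) = int ((w # q) ! t)" if "t < length (w # q)" for t
    proof (cases t)
      case (Suc t')
      then have "mem s 8 (reg s 2 + int t') = int (q ! t')" using L' that by simp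
      then show ?thesis using Suc by (simp add: s')
    qed (simp add: s')
    show "reg s' 3 = reg s' 2 + int (length (w # q))" "1 \<le> reg s' 3" "reg s' 3 \<le> int (length ((out @ [v]) @ w # q))"
      using L' by (auto simp: s')
    show "mem s' 9 (4 * int b + int r) = int (cell_count (out @ [v]) ?ry b r)" if r: "r < 4" for b r
    proof -
      have "cell_count (out @ [v]) ?ry b r = cell_count (out @ [v]) ry b r"
        unfolding cell_count_def using out by (intro arg_cong[of _ _ card]) auto
      then show ?thesis using L' r by (simp add: s')
    qed
    fix k assume k: "k < length (out @ [v])"
    have "rank (out @ [v]) ?ry k = rank (out @ [v]) ry k"
      using w k by (intro rank_update) auto
    moreover have "(mem s 3 (int ((out @ [v]) ! k)), mem s 4 (int ((out @ [v]) ! k))) =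
        place (ry ((out @ [v]) ! k)) (kx ((out @ [v]) ! k)) (rank (out @ [v]) ry k) (dep ((out @ [v]) ! k))"
      using L' k by blast
    ultimately show "(mem s' 3 (int ((out @ [v]) ! k)), mem s' 4 (int ((out @ [v]) ! k))) =
        place (?ry ((out @ [v]) ! k)) (?kx ((out @ [v]) ! k)) (rank (out @ [v]) ?ry k) (?dep ((out @ [v]) ! k))"
      using out[OF k] by (simp add: s')
  qed
qed

lemma linked_discover_other:
  assumes L: "linked (out @ [v]) q ry dep kx s"
    and w: "w \<notin> set (out @ v # q)" "w < n"
    and s': "reg s' 1 = reg s 1" "reg s' 2 = reg s 2" "reg s' 3 = reg s 3 + 1"
      "mem s' = (mem s)(5 := (mem s 5)(int w := int r + 1), 7 := (mem s 7)(int w := 0), 8 := (mem s 8)(reg s 3 := int w))"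
  shows "linked (out @ [v]) (q @ [w]) (ry(w := r)) (dep(w := 0)) kx s'"
    (is "linked _ _ ?ry ?dep ?kx _")
proof -
  note L' = L[unfolded linked_def]
  have out: "(out @ [v]) ! k \<noteq> w" if "k < length (out @ [v])" for k
    using w(1) nth_mem[OF that] by auto
  show ?thesis
    unfolding linked_def
  proof (intro conjI allI impI)
    show "input_kept s'" using L' by (simp add: input_kept_def s' del: One_nat_def)
    show "mem s' 5 (int i) = (if i \<in> set ((out @ [v]) @ q @ [w]) then int (?ry i) + 1 else 0)" if "i < n" for i
      using L' that by (auto simp: s')
    show "mem s' 7 (int i) = int (?dep i)" if "i \<in> set ((out @ [v]) @ q @ [w])" for i
      using L' that by (auto simp: s')
    show "mem s' 6 (int i) = int (?kx i)" if "i \<in> set (out @ [v]) \<or> i \<in> set (q @ [w]) \<and> 0 < ?dep i" for i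
      using L' that by (cases "i = w") (auto simp: s')
    show "mem s' 8 (reg s' 2 + int t) = int ((q @ [w]) ! t)" if "t < length (q @ [w])" for t
      using L' that by (cases "t < length q") (auto simp: s' nth_append)
    show "reg s' 3 = reg s' 2 + int (length (q @ [w]))" "1 \<le> reg s' 3" "reg s' 3 \<le> int (length ((out @ [v]) @ q @ [w]))"
      using L' by (auto simp: s')
    show "mem s' 9 (4 * int b + int r) = int (cell_count (out @ [v]) ?ry b r)" if r: "r < 4" for b r
    proof -
      have "cell_count (out @ [v]) ?ry b r = cell_count (out @ [v]) ry b r"
        unfolding cell_count_def using out by (intro arg_cong[of _ _ card]) auto
      then show ?thesis using L' r by (simp add: s')
    qed
    fix k assume k: "k < length (out @ [v])"
    have "rank (out @ [v]) ?ry k = rank (out @ [v]) ry k"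
      using w k by (intro rank_update) auto
    moreover have "(mem s 3 (int ((out @ [v]) ! k)), mem s 4 (int ((out @ [v]) ! k))) =
        place (ry ((out @ [v]) ! k)) (kx ((out @ [v]) ! k)) (rank (out @ [v]) ry k) (dep ((out @ [v]) ! k))"
      using L' k by blast
    ultimately show "(mem s' 3 (int ((out @ [v]) ! k)), mem s' 4 (int ((out @ [v]) ! k))) =
        place (?ry ((out @ [v]) ! k)) (?kx ((out @ [v]) ! k)) (rank (out @ [v]) ?ry k) (?dep ((out @ [v]) ! k))"
      using out[OF k] by (simp add: s')
  qed
qed

end

section \<open>Loop invariants with time credit\<close>

context tree_input
begin

text \<open>Adjacency positions are at most \<open>2 * n\<close> and coordinates at most
  \<open>4 * W\<close> in absolute value; the factor 8 covers these and the small additive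
  constants.\<close>

definition cell_bound :: int where
  "cell_bound = int (8 * (n + W))"

definition unread :: "nat list \<Rightarrow> nat" where
  "unread out = (\<Sum>v\<in>{..<n} - set out. length (adj ! v))"

text \<open>Thirty steps are reserved per unvisited vertex and per unread adjacency entry. A visit
  uses at most 20 and an entry at most 10, which leaves room for the loop tests; the 2 pays for the
  last test.\<close>

definition outer_inv :: "mstate \<Rightarrow> int \<Rightarrow> bool" where
  "outer_inv s k \<longleftrightarrow> (\<exists>out q ry dep pp kx. valid out q ry dep pp kx \<and> linked out q ry dep kx s \<and>
     set (out @ q) \<subseteq> {..<n} \<and> 0 \<in> set (out @ q) \<and>
     (\<forall>u\<in>set out. \<forall>w. (u, w) \<in> adjacent \<longrightarrow> w \<in> set (out @ q)) \<and>
     30 * int (n - length out) + 30 * int (unread out) + 2 \<le> k)"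

definition inner_inv :: "nat list \<Rightarrow> nat \<Rightarrow> mstate \<Rightarrow> int \<Rightarrow> bool" where
  "inner_inv out v s k \<longleftrightarrow> (\<exists>q ry dep pp kx e. valid (out @ [v]) q ry dep pp kx \<and> linked (out @ [v]) q ry dep kx s \<and>
     set (out @ v # q) \<subseteq> {..<n} \<and> 0 \<in> set (out @ v # q) \<and>
     (\<forall>u\<in>set out. \<forall>w. (u, w) \<in> adjacent \<longrightarrow> w \<in> set (out @ v # q)) \<and>
     set (take e (adj ! v)) \<subseteq> set (out @ v # q) \<and> e \<le> length (adj ! v) \<and>
     reg s 4 = int v \<and> reg s 5 = int (bucket v) \<and> reg s 6 = int (ry v) \<and> reg s 9 = int (offset v + e) \<and>
     30 * int (n - Suc (length out)) + 30 * int (unread (out @ [v])) + 30 * int (length (adj ! v) - e) + 3 \<le> k)"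

lemma inner_invI:
  assumes "valid (out @ [v]) q ry dep pp kx" "linked (out @ [v]) q ry dep kx s"
    "set (out @ v # q) \<subseteq> {..<n}" "0 \<in> set (out @ v # q)"
    "\<forall>u\<in>set out. \<forall>w. (u, w) \<in> adjacent \<longrightarrow> w \<in> set (out @ v # q)"
    "set (take e (adj ! v)) \<subseteq> set (out @ v # q)" "e \<le> length (adj ! v)"
    "reg s 4 = int v" "reg s 5 = int (bucket v)" "reg s 6 = int (ry v)" "reg s 9 = int (offset v + e)"
    "30 * int (n - Suc (length out)) + 30 * int (unread (out @ [v])) + 30 * int (length (adj ! v) - e) + 3 \<le> k"
  shows "inner_inv out v s k"
  unfolding inner_inv_def using assms by blast

lemma valid_length: "valid out q ry dep pp kx \<Longrightarrow> set (out @ q) \<subseteq> {..<n} \<Longrightarrow> length (out @ q) \<le> n"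
  using distinct_card[OF validD(1)] card_mono[of "{..<n}" "set (out @ q)"] by auto

lemma valid_small:
  assumes "valid out q ry dep pp kx" "set (out @ q) \<subseteq> {..<n}" "v \<in> set out"
  shows "kx v + dep v < W"
proof -
  obtain k where k: "k < length out" "out ! k = v" using assms(3) by (metis in_set_conv_nth)
  have le: "kx v + dep v \<le> rank out ry k" using base_plus_depth_le_rank[OF assms(1) k(1)] k(2) by simp
  have "rank out ry k < W"
    using assms(2) by (intro rank_bound[OF assms(1) k(1)] card_bucket) auto
  with le show "kx v + dep v < W" by simp
qed

lemma offset_Suc: "offset (Suc v) = offset v + length (adj ! v)"
  by (simp add: offset_def)

lemma cell_bound_ge: "8 * int n + 8 * int W \<le> cell_bound" "1 \<le> int n" "1 \<le> int W"
  using n_pos W_pos by (simp_all add: cell_bound_def Suc_le_eq)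

lemma runs_scan_step:
  assumes I: "inner_inv out v s k" and b: "reg s 9 < mem s 1 (reg s 4 + 1)"
  shows "0 < k \<and> runs cell_bound scan_neighbour s (k - 1) (inner_inv out v)"
proof -
  obtain q ry dep pp kx e where i: "valid (out @ [v]) q ry dep pp kx" and L: "linked (out @ [v]) q ry dep kx s"
    and range: "set (out @ v # q) \<subseteq> {..<n}" and zero: "0 \<in> set (out @ v # q)"
    and closed: "\<forall>u\<in>set out. \<forall>w. (u, w) \<in> adjacent \<longrightarrow> w \<in> set (out @ v # q)"
    and seen: "set (take e (adj ! v)) \<subseteq> set (out @ v # q)" and e: "e \<le> length (adj ! v)"
    and r: "reg s 4 = int v" "reg s 5 = int (bucket v)" "reg s 6 = int (ry v)" "reg s 9 = int (offset v + e)"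
    and k: "30 * int (n - Suc (length out)) + 30 * int (unread (out @ [v])) + 30 * int (length (adj ! v) - e) + 3 \<le> k"
    using I unfolding inner_inv_def by blast
  have kept: "input_kept s" using L by (simp add: linked_def)
  have v: "v < n" using range by simp
  have "mem s 1 (reg s 4 + 1) = int (offset (Suc v))"
    using input_offset[OF kept, of "Suc v"] v r(1) by (simp add: add.commute)
  then have e_lt: "e < length (adj ! v)" using b r(4) by (simp add: offset_Suc)
  define w where "w = adj ! v ! e"
  have "w \<in> set (adj ! v)" using e_lt by (simp add: w_def)
  then have vw: "(v, w) \<in> adjacent" using adj_set[OF v] by simp
  then have w: "w < n" by (simp add: adjacent_def)
  have take: "set (take (Suc e) (adj ! v)) = insert w (set (take e (adj ! v)))"
    using e_lt by (simp add: take_Suc_conv_app_nth w_def)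
  have mw: "mem s 2 (reg s 9) = int w"
    using input_neighbour[OF kept v e_lt] r(4) by (simp add: w_def)
  have bw: "(mem s 0 (int w) - 1) div reg s 1 = int (bucket w)" by (rule input_bucket[OF kept w])
  have "offset v + e + 1 \<le> 2 * n" using offset_le[of "Suc v"] v e_lt by (simp add: offset_Suc)
  then have b9: "\<bar>reg s 9 + 1\<bar> \<le> cell_bound" using r(4) cell_bound_ge by simp
  have bw': "\<bar>int w\<bar> \<le> cell_bound" using w cell_bound_ge by simp
  have b5: "\<bar>int (bucket v)\<bar> \<le> cell_bound" "\<bar>int (bucket w)\<bar> \<le> cell_bound"
    using bucket_le[OF v] bucket_le[OF w] cell_bound_ge by auto
  have rv: "ry v < 4" using validD(2)[OF i] by simp
  have len: "length (out @ [v] @ q) \<le> n" using valid_length[OF i] range by simp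
  have regs: "reg s 3 = reg s 2 + int (length q)" "1 \<le> reg s 3" "reg s 3 \<le> int (length ((out @ [v]) @ q))"
    using L by (auto simp: linked_def)
  have mem5: "mem s 5 (int w) = (if w \<in> set (out @ v # q) then int (ry w) + 1 else 0)"
    using L w by (simp add: linked_def)
  have credit: "30 * int (n - Suc (length out)) + 30 * int (unread (out @ [v])) + 30 * int (length (adj ! v) - Suc e) + 3 \<le> k - 30"
  proof -
    have "length (adj ! v) - e = Suc (length (adj ! v) - Suc e)" using e_lt by auto
    then show ?thesis using k by simp
  qed
  have "0 < k" using k by linarith
  moreover have "runs cell_bound scan_neighbour s (k - 1) (inner_inv out v)"
  proof (cases "w \<in> set (out @ v # q)")
    case True
    show ?thesis
    proof (rule runs_scan_known[OF mw _ bw' b9])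
      show "mem s 5 (int w) \<noteq> 0" using mem5 True by simp
      have "linked (out @ [v]) q ry dep kx (s\<lparr>reg := (reg s)(10 := int w, 9 := reg s 9 + 1)\<rparr>)"
        by (rule linked_cong[OF L]) auto
      then show "inner_inv out v (s\<lparr>reg := (reg s)(10 := int w, 9 := reg s 9 + 1)\<rparr>) (k - 1 - 4)"
        using seen take True e_lt r credit by (intro inner_invI[OF i _ range zero closed, of _ "Suc e"]) simp_all
    qed
  next
    case False
    have new: "mem s 5 (int w) = 0" using mem5 False by simp
    have wv: "w \<noteq> v" "w \<notin> set ((out @ [v]) @ q)" "w \<notin> set (out @ [v] @ q)" using False by auto
    have sub: "set (out @ v # w # q) \<subseteq> {..<n}" "set (out @ v # q @ [w]) \<subseteq> {..<n}" using range w by auto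
    show ?thesis
    proof (cases "bucket w = bucket v")
      case True
      have small: "kx v + dep v < W" using valid_small[OF i] range by simp
      have m7: "mem s 7 (int v) = int (dep v)" and m6: "mem s 6 (int v) = int (kx v)"
        using L by (auto simp: linked_def)
      show ?thesis
      proof (rule runs_scan_same[OF mw new _ _ bw' b9])
        show "(mem s 0 (int w) - 1) div reg s 1 = reg s 5" using bw True r by simp
        show "reg s 4 \<noteq> int w" using wv r by simp
        show "\<bar>reg s 5\<bar> \<le> cell_bound" using b5 r by simp
        show "\<bar>reg s 6 + 1\<bar> \<le> cell_bound" using rv r cell_bound_ge by simp
        show "\<bar>mem s 7 (reg s 4) + 1\<bar> \<le> cell_bound" "\<bar>mem s 6 (reg s 4)\<bar> \<le> cell_bound"
          using small cell_bound_ge r m6 m7 by simp_all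
        show "\<bar>reg s 2 - 1\<bar> \<le> cell_bound" using regs len cell_bound_ge by simp
        fix s' :: mstate assume s': "reg s' = (reg s)(2 := reg s 2 - 1, 9 := reg s 9 + 1, 10 := int w, 11 := reg s 5)"
          "mem s' = (mem s)(5 := (mem s 5)(int w := reg s 6 + 1), 6 := (mem s 6)(int w := mem s 6 (reg s 4)),
            7 := (mem s 7)(int w := mem s 7 (reg s 4) + 1), 8 := (mem s 8)(reg s 2 - 1 := int w))"
        have L2: "linked (out @ [v]) (w # q) (ry(w := ry v)) (dep(w := Suc (dep v))) (kx(w := kx v)) s'"
          by (rule linked_discover_same[OF L False w]) (simp_all add: s' r)
        have I2: "valid (out @ [v]) (w # q) (ry(w := ry v)) (dep(w := Suc (dep v))) (pp(w := length out)) (kx(w := kx v))"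
          by (rule valid_push_same[OF i wv(3) vw True])
        show "inner_inv out v s' (k - 1 - 10)"
        proof (rule inner_invI[OF I2 L2, where e = "Suc e"])
          show "set (out @ v # w # q) \<subseteq> {..<n}" "0 \<in> set (out @ v # w # q)" using sub zero by auto
          show "\<forall>u\<in>set out. \<forall>w'. (u, w') \<in> adjacent \<longrightarrow> w' \<in> set (out @ v # w # q)"
            using closed by fastforce
          show "set (take (Suc e) (adj ! v)) \<subseteq> set (out @ v # w # q)" using seen unfolding take by auto
          show "Suc e \<le> length (adj ! v)" using e_lt by simp
        qed (use r credit wv(1) in \<open>simp_all add: s'\<close>)
      qed
    next
      case neq: False
      define r' where "r' = child_ray (ry v) (bucket v) (bucket w)"
      have r'4: "r' < 4" by (simp add: r'_def child_ray_def)
      show ?thesis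
      proof (rule runs_scan_other[OF mw new bw _ _ bw' b9 b5(2)])
        show "int (bucket w) \<noteq> reg s 5" using neq r by simp
        show "(reg s 6 + (int (bucket w) - reg s 5) mod 2) mod 4 = int r'"
          by (simp add: r int_child_ray r'_def)
        show "\<bar>int r' + 1\<bar> \<le> cell_bound" using r'4 cell_bound_ge by simp
        show "\<bar>reg s 3 + 1\<bar> \<le> cell_bound" using regs len cell_bound_ge by simp
        fix s' :: mstate assume s': "reg s' = (reg s)(3 := reg s 3 + 1, 9 := reg s 9 + 1, 10 := int w, 11 := int (bucket w))"
          "mem s' = (mem s)(5 := (mem s 5)(int w := int r' + 1), 7 := (mem s 7)(int w := 0), 8 := (mem s 8)(reg s 3 := int w))"
        have L2: "linked (out @ [v]) (q @ [w]) (ry(w := r')) (dep(w := 0)) kx s'"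
          by (rule linked_discover_other[OF L False w]) (simp_all add: s' r)
        have I2: "valid (out @ [v]) (q @ [w]) (ry(w := r')) (dep(w := 0)) (pp(w := length out)) kx"
          unfolding r'_def by (rule valid_push_diff[OF i wv(3) vw neq])
        show "inner_inv out v s' (k - 1 - 9)"
        proof (rule inner_invI[OF I2 L2, where e = "Suc e"])
          show "set (out @ v # q @ [w]) \<subseteq> {..<n}" "0 \<in> set (out @ v # q @ [w])" using sub zero by auto
          show "\<forall>u\<in>set out. \<forall>w'. (u, w') \<in> adjacent \<longrightarrow> w' \<in> set (out @ v # q @ [w])"
            using closed by fastforce
          show "set (take (Suc e) (adj ! v)) \<subseteq> set (out @ v # q @ [w])" using seen unfolding take by auto
          show "Suc e \<le> length (adj ! v)" using e_lt by simp
        qed (use r credit wv(1) in \<open>simp_all add: s'\<close>)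
      qed
    qed
  qed
  ultimately show ?thesis by simp
qed

lemma inner_exit:
  assumes I: "inner_inv out v s k" and b: "\<not> reg s 9 < mem s 1 (reg s 4 + 1)"
  shows "outer_inv s (k - 1)"
proof -
  obtain q ry dep pp kx e where i: "valid (out @ [v]) q ry dep pp kx" and L: "linked (out @ [v]) q ry dep kx s"
    and range: "set (out @ v # q) \<subseteq> {..<n}" and zero: "0 \<in> set (out @ v # q)"
    and closed: "\<forall>u\<in>set out. \<forall>w. (u, w) \<in> adjacent \<longrightarrow> w \<in> set (out @ v # q)"
    and seen: "set (take e (adj ! v)) \<subseteq> set (out @ v # q)" and e: "e \<le> length (adj ! v)"
    and r: "reg s 4 = int v" "reg s 9 = int (offset v + e)"
    and k: "30 * int (n - Suc (length out)) + 30 * int (unread (out @ [v])) + 30 * int (length (adj ! v) - e) + 3 \<le> k"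
    using I unfolding inner_inv_def by blast
  have kept: "input_kept s" using L by (simp add: linked_def)
  have v: "v < n" using range by simp
  have "mem s 1 (reg s 4 + 1) = int (offset (Suc v))"
    using input_offset[OF kept, of "Suc v"] v r(1) by (simp add: add.commute)
  \<comment> \<open>The scan stops where the list of the next vertex begins, so every neighbour of
    \<open>v\<close> has been discovered and \<open>v\<close> joins the closed part.\<close>
  then have "e = length (adj ! v)" using b r(2) e by (simp add: offset_Suc)
  then have "{w. (v, w) \<in> adjacent} \<subseteq> set (out @ v # q)" using seen adj_set[OF v] by simp
  then have closed': "\<forall>u\<in>set (out @ [v]). \<forall>w. (u, w) \<in> adjacent \<longrightarrow> w \<in> set ((out @ [v]) @ q)"
    using closed by (simp add: subset_iff)
  show ?thesis
    unfolding outer_inv_def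
  proof (intro exI conjI)
    show "valid (out @ [v]) q ry dep pp kx" by (rule i)
    show "linked (out @ [v]) q ry dep kx s" by (rule L)
    show "\<forall>u\<in>set (out @ [v]). \<forall>w. (u, w) \<in> adjacent \<longrightarrow> w \<in> set ((out @ [v]) @ q)" by (rule closed')
  qed (use range zero k in simp_all)
qed

lemma runs_visit_step:
  assumes I: "outer_inv s k" and b: "reg s 2 < reg s 3"
  shows "0 < k \<and> runs cell_bound (Seq visit scan_all) s (k - 1) outer_inv"
proof -
  obtain out q0 ry dep pp kx where i: "valid out q0 ry dep pp kx" and L: "linked out q0 ry dep kx s"
    and range: "set (out @ q0) \<subseteq> {..<n}" and zero: "0 \<in> set (out @ q0)"
    and closed: "\<forall>u\<in>set out. \<forall>w. (u, w) \<in> adjacent \<longrightarrow> w \<in> set (out @ q0)"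
    and k: "30 * int (n - length out) + 30 * int (unread out) + 2 \<le> k"
    using I unfolding outer_inv_def by blast
  have kept: "input_kept s" using L by (simp add: linked_def)
  have regs: "reg s 3 = reg s 2 + int (length q0)" "1 \<le> reg s 3" "reg s 3 \<le> int (length (out @ q0))"
    using L by (auto simp: linked_def)
  with b obtain v q where q: "q0 = v # q" by (cases q0) auto
  note i = i[unfolded q] and L = L[unfolded q] and range = range[unfolded q] and zero = zero[unfolded q]
    and closed = closed[unfolded q]
  have v: "v < n" using range by simp
  have len: "length (out @ v # q) \<le> n" using valid_length[OF i] range by simp
  have vout: "v \<notin> set out" using validD(1)[OF i] by simp
  have rv: "ry v < 4" using validD(2)[OF i] by simp
  define j where "j = cell_count out ry (bucket v) (ry v)"
  define kx' where "kx' = (if dep v = 0 then kx(v := j) else kx)"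
  have i': "valid (out @ [v]) q ry dep pp kx'"
    by (rule valid_pop[OF i]) (simp add: kx'_def j_def cell_count_def)
  have jn: "j \<le> length out" unfolding j_def by (rule cell_count_le)
  have j_rank: "kx' v + dep v \<le> j" "j < W"
  proof -
    have r: "rank (out @ [v]) ry (length out) = j" by (simp add: rank_snoc_count j_def)
    show "kx' v + dep v \<le> j" using base_plus_depth_le_rank[OF i', of "length out"] r by simp
    show "j < W" using rank_bound[OF i', of "length out" W] r card_bucket[of "set (out @ [v])"] range by simp
  qed
  have "\<forall>t. t < length (v # q) \<longrightarrow> mem s 8 (reg s 2 + int t) = int ((v # q) ! t)"
    using L unfolding linked_def by blast
  from this[rule_format, of 0] have m8: "mem s 8 (reg s 2) = int v" by simp
  have m5: "mem s 5 (int v) - 1 = int (ry v)" using L v by (simp add: linked_def)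
  have m9: "mem s 9 (4 * int (bucket v) + int (ry v)) = int j"
    using L rv unfolding linked_def j_def by blast
  have m7: "mem s 7 (int v) = int (dep v)" using L by (simp add: linked_def)
  have m6: "(if mem s 7 (int v) = 0 then int j else mem s 6 (int v)) = int (kx' v)"
    using L m7 by (auto simp: linked_def kx'_def)
  have "unread out = length (adj ! v) + unread (out @ [v])"
  proof -
    have "{..<n} - set out = insert v ({..<n} - set (out @ [v]))" using v vout by auto
    then have "unread out = (\<Sum>u\<in>insert v ({..<n} - set (out @ [v])). length (adj ! u))"
      by (simp only: unread_def)
    also have "\<dots> = length (adj ! v) + unread (out @ [v])"
      unfolding unread_def by (rule sum.insert) auto
    finally show ?thesis .
  qed
  moreover have "n - length out = Suc (n - Suc (length out))" using len by auto
  ultimately have k': "30 * int (n - Suc (length out)) + 30 * int (unread (out @ [v])) + 30 * int (length (adj ! v)) + 32 \<le> k"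
    using k by simp
  have "runs cell_bound visit s (k - 1) (inner_inv out v)"
  proof (rule runs_visit[OF m8 input_bucket[OF kept v] m5 m9 m6 refl])
    show "\<bar>int v\<bar> \<le> cell_bound" using v cell_bound_ge by simp
    show "\<bar>reg s 2 + 1\<bar> \<le> cell_bound" using regs len cell_bound_ge q by simp
    show "\<bar>int (bucket v)\<bar> \<le> cell_bound" using bucket_le[OF v] cell_bound_ge by simp
    show "\<bar>int (ry v)\<bar> \<le> cell_bound" using rv cell_bound_ge by simp
    show "\<bar>int j\<bar> \<le> cell_bound" "\<bar>int j + 1\<bar> \<le> cell_bound" using jn len cell_bound_ge by simp_all
    show "\<bar>2 * reg s 1 + int (kx' v) + int j - mem s 7 (int v)\<bar> \<le> cell_bound"
      using kept m7 j_rank cell_bound_ge by (simp add: input_kept_def)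
    show "\<bar>mem s 1 (int v)\<bar> \<le> cell_bound"
      using input_offset[OF kept, of v] offset_le[of v] v cell_bound_ge by simp
    fix s' :: mstate and k'
    assume c: "k - 1 - 20 \<le> k'" and s': "reg s' 1 = reg s 1" "reg s' 2 = reg s 2 + 1" "reg s' 3 = reg s 3"
      and r: "reg s' 4 = int v" "reg s' 5 = int (bucket v)" "reg s' 6 = int (ry v)" "reg s' 9 = mem s 1 (int v)"
      and m: "mem s' = (mem s)(
        3 := (mem s 3)(int v := fst (quarter_turns (int (ry v)) (2 * reg s 1 + int (kx' v) + int j - mem s 7 (int v)) (int j))),
        4 := (mem s 4)(int v := snd (quarter_turns (int (ry v)) (2 * reg s 1 + int (kx' v) + int j - mem s 7 (int v)) (int j))),
        6 := if mem s 7 (int v) = 0 then (mem s 6)(int v := int j) else mem s 6,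
        9 := (mem s 9)(4 * int (bucket v) + int (ry v) := int j + 1))"
    have "linked (out @ [v]) q ry dep kx' s'"
    proof (rule linked_pop[OF L i j_def kx'_def s'])
      have "quarter_turns (int (ry v)) (2 * reg s 1 + int (kx' v) + int j - mem s 7 (int v)) (int j) =
          place (ry v) (kx' v) j (dep v)"
        using kept m7 by (simp add: place_def input_kept_def)
      then show "mem s' = (mem s)(
        3 := (mem s 3)(int v := fst (place (ry v) (kx' v) j (dep v))),
        4 := (mem s 4)(int v := snd (place (ry v) (kx' v) j (dep v))),
        6 := (if mem s 7 (int v) = 0 then (mem s 6)(int v := int j) else mem s 6),
        9 := (mem s 9)(4 * int (bucket v) + int (ry v) := int j + 1))" unfolding m by simp
    qed
    moreover have "reg s' 9 = int (offset v + 0)" using r(4) input_offset[OF kept, of v] v by simp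
    ultimately show "inner_inv out v s' k'"
      using r k' c by (intro inner_invI[OF i' _ range zero closed, of _ 0]) simp_all
  qed
  moreover have "runs cell_bound scan_all s' k' outer_inv" if "inner_inv out v s' k'" for s' k'
    unfolding scan_all_def
  proof (rule runs_While[where I = "inner_inv out v", OF that])
    show "0 < k \<and> runs cell_bound scan_neighbour s (k - 1) (inner_inv out v)"
      if "inner_inv out v s k" "bval (Less (Reg 9) (Mem 1 (Plus (Reg 4) (Const 1)))) s" for s k
      using runs_scan_step[OF that(1)] that(2) by simp
    show "outer_inv s (k - 1)"
      if "inner_inv out v s k" "\<not> bval (Less (Reg 9) (Mem 1 (Plus (Reg 4) (Const 1)))) s" for s k
      using inner_exit[OF that(1)] that(2) by simp
  qed
  ultimately have "runs cell_bound (Seq visit scan_all) s (k - 1) outer_inv"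
    unfolding runs_Seq by (rule runs_mono)
  moreover have "0 < k" using k by linarith
  ultimately show ?thesis by simp
qed

lemma runs_draw_story:
  "runs cell_bound draw_story (input_state \<tau> W vs adj) (100 * int n)
    (\<lambda>s k. 0 \<le> k \<and> (\<exists>out ry dep pp kx. valid out [] ry dep pp kx \<and> linked out [] ry dep kx s \<and> set out = {..<n}))"
proof -
  let ?s0 = "input_state \<tau> W vs adj"
  define s1 where "s1 = ?s0\<lparr>mem := (mem ?s0)(5 := (mem ?s0 5)(0 := int (bucket 0 mod 2) + 1))\<rparr>"
  define s2 where "s2 = s1\<lparr>reg := (reg s1)(3 := 1)\<rparr>"
  let ?Q = "\<lambda>s k. 0 \<le> k \<and> (\<exists>out ry dep pp kx. valid out [] ry dep pp kx \<and> linked out [] ry dep kx s \<and> set out = {..<n})"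
  have kept: "input_kept ?s0"
    by (simp add: input_kept_def input_state_def offset_def[abs_def] del: upt_Suc One_nat_def)
  have b0: "(mem ?s0 0 0 - 1) div reg ?s0 1 = int (bucket 0)"
    using input_bucket[OF kept n_pos] by simp
  have kept2: "input_kept s2"
    using kept by (simp add: input_kept_def s1_def s2_def del: One_nat_def)
  define ry :: "nat \<Rightarrow> nat" where "ry = (\<lambda>v. if v = 0 then bucket 0 mod 2 else 0)"
  have "valid [] [0] ry (\<lambda>_. 0) (\<lambda>_. 0) (\<lambda>_. 0)"
    by (rule valid_init) (simp_all add: ry_def)
  moreover have "linked [] [0] ry (\<lambda>_. 0) (\<lambda>_. 0) s2"
    using kept2 by (auto simp: linked_def s1_def s2_def input_state_def ry_def cell_count_def)
  moreover have "unread [] \<le> 2 * n" using total_degree by (simp add: unread_def)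
  \<comment> \<open>At most \<open>90 * n\<close> is reserved for vertices and entries; as
    \<open>n\<close> is positive, the remaining \<open>10 * n\<close> covers the two initial steps
    and the last test.\<close>
  moreover have "30 * int n + 30 * int (unread []) + 2 \<le> 100 * int n - 2"
    using \<open>unread [] \<le> 2 * n\<close> cell_bound_ge(2) by linarith
  ultimately have "outer_inv s2 (100 * int n - 2)"
    unfolding outer_inv_def using n_pos
    by (intro exI[of _ "[]"] exI[of _ "[0]"] exI[of _ ry] exI[of _ "\<lambda>_. 0"] conjI)
      (simp_all add: lessThan_def del: length_greater_0_conv)
  then have "runs cell_bound (While (Less (Reg 2) (Reg 3)) (Seq visit scan_all)) s2 (100 * int n - 2) ?Q"
  proof (rule runs_While)
    show "0 < k \<and> runs cell_bound (Seq visit scan_all) s (k - 1) outer_inv"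
      if "outer_inv s k" "bval (Less (Reg 2) (Reg 3)) s" for s k
      using runs_visit_step[OF that(1)] that(2) by simp
    fix s :: mstate and k
    assume "outer_inv s k" and nb: "\<not> bval (Less (Reg 2) (Reg 3)) s"
    then obtain out q ry dep pp kx where i: "valid out q ry dep pp kx" and L: "linked out q ry dep kx s"
      and range: "set (out @ q) \<subseteq> {..<n}" and zero: "0 \<in> set (out @ q)"
      and closed: "\<forall>u\<in>set out. \<forall>w. (u, w) \<in> adjacent \<longrightarrow> w \<in> set (out @ q)"
      and k: "30 * int (n - length out) + 30 * int (unread out) + 2 \<le> k"
      unfolding outer_inv_def by blast
    have "reg s 3 = reg s 2 + int (length q)" using L by (simp add: linked_def)
    with nb have q: "q = []" by simp
    \<comment> \<open>With an empty worklist the visited vertices are closed under adjacency and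
      contain vertex 0, so connectedness yields all vertices.\<close>
    have reach: "\<exists>i\<in>set out. vs ! i = x" if "(vs ! 0, x) \<in> (parcs T)\<^sup>*" for x
      using that
    proof (induction rule: rtrancl_induct)
      case base
      then show ?case using zero q by auto
    next
      case (step y z)
      then obtain i where i: "i \<in> set out" "vs ! i = y" by blast
      interpret pair_graph T using tree by (simp add: undirected_tree_def)
      have "z \<in> set vs" using in_arcsD2[OF step.hyps(2)] vs(2) by simp
      then obtain l where l: "l < n" "vs ! l = z" by (metis in_set_conv_nth)
      then have "(i, l) \<in> adjacent" using i step.hyps(2) range by (auto simp: adjacent_def)
      then show ?case using closed i(1) l(2) q by auto
    qed
    have "{..<n} \<subseteq> set out"
    proof
      fix l assume l: "l \<in> {..<n}"
      then have "vs ! 0 \<in> pverts T" "vs ! l \<in> pverts T"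
        using nth_mem[OF n_pos] nth_mem[of l vs] unfolding vs(2) by simp_all
      then have "(vs ! 0, vs ! l) \<in> (parcs T)\<^sup>*" by (rule tree_connected[OF tree])
      then obtain i where i: "i \<in> set out" "vs ! i = vs ! l" using reach by blast
      from i(1) range have "i < n" by auto
      with i(2) l have "i = l"
        using nth_eq_iff_index_eq[OF vs(1), of i l] by simp
      with i(1) show "l \<in> set out" by simp
    qed
    with range q have "set out = {..<n}" by auto
    moreover have "0 \<le> k - 1" using k by linarith
    ultimately show "?Q s (k - 1)" using i L unfolding q by blast
  qed
  moreover have "runs cell_bound draw_story ?s0 (100 * int n) ?Q \<longleftrightarrow>
      runs cell_bound (While (Less (Reg 2) (Reg 3)) (Seq visit scan_all)) s2 (100 * int n - 2) ?Q"
  proof -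
    have "\<bar>int (bucket 0 mod 2) + 1\<bar> \<le> cell_bound" "\<bar>1\<bar> \<le> cell_bound" using cell_bound_ge by auto
    then show ?thesis
      unfolding draw_story_def bucket_expr_def s2_def s1_def
      by (simp add: runs_Seq_simps b0 zmod_int del: One_nat_def)
  qed
  ultimately show ?thesis by simp
qed

lemma place_pos:
  assumes "valid out [] ry dep pp kx" "k < length out"
  shows "map_prod real_of_int real_of_int (place (ry (out ! k)) (kx (out ! k)) (rank out ry k) (dep (out ! k))) =
    spiral_layout.pos W (\<lambda>i. kx (out ! i)) (rank out ry) (\<lambda>i. dep (out ! i)) (\<lambda>i. ry (out ! i)) k"
proof -
  \<comment> \<open>The formula for \<open>pos\<close> does not involve the window, so the empty
    one, where the assumptions hold trivially, gives access to it.\<close>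
  have "spiral_drawing {} W (\<lambda>i. kx (out ! i)) (rank out ry) (\<lambda>i. dep (out ! i)) (\<lambda>i. ry (out ! i)) (\<lambda>i. pp (out ! i))"
    by unfold_locales (auto simp: spiral_layout.inter_def spiral_layout_def)
  then interpret spiral_drawing "{}" W "\<lambda>i. kx (out ! i)" "rank out ry" "\<lambda>i. dep (out ! i)" "\<lambda>i. ry (out ! i)" "\<lambda>i. pp (out ! i)" .
  have "ry (out ! k) < 4" using validD(2)[OF assms(1)] assms(2) by simp
  then show ?thesis by (simp add: place_def quarter_turns_rot pos_def pt_def)
qed

lemma drawing_story_computed:
  "\<exists>t s. exec (int (8 * (n + W))) draw_story (input_state \<tau> W vs adj) t s \<and> t \<le> 100 * n \<and>
    (\<exists>\<Gamma>. drawing_story T \<tau> W \<Gamma> \<and> planar_story T \<tau> W \<Gamma> \<and> straight_line_story T \<tau> W \<Gamma> \<and>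
      lies_on_grid T \<tau> W (8 * W + 1) (8 * W + 1) \<Gamma> \<and> output_positions T \<tau> W vs s \<Gamma>)"
proof -
  obtain t s out ry dep pp kx where t: "exec cell_bound draw_story (input_state \<tau> W vs adj) t s" "int t \<le> 100 * int n"
    and i: "valid out [] ry dep pp kx" and L: "linked out [] ry dep kx s" and out: "set out = {..<n}"
    using runs_draw_story unfolding runs_def by auto
  have "\<exists>\<Gamma>. drawing_story T \<tau> W \<Gamma> \<and> planar_story T \<tau> W \<Gamma> \<and> straight_line_story T \<tau> W \<Gamma> \<and>
    lies_on_grid T \<tau> W (8 * W + 1) (8 * W + 1) \<Gamma> \<and>
    (\<forall>t. \<forall>i<n. vpos (\<Gamma> t) (vs ! i) = (real_of_int (mem s 3 (int i)), real_of_int (mem s 4 (int i))))"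
  proof (rule drawing_of_traversal[OF i out])
    show "out \<noteq> []"
    proof
      assume "out = []"
      then have "{..<n} = {}" using out by simp
      with n_pos show False by (simp only: lessThan_empty_iff)
    qed
    fix k assume k: "k < length out"
    then have "(mem s 3 (int (out ! k)), mem s 4 (int (out ! k))) =
        place (ry (out ! k)) (kx (out ! k)) (rank out ry k) (dep (out ! k))"
      using L by (simp add: linked_def)
    from place_pos[OF i k, folded this]
    show "(real_of_int (mem s 3 (int (out ! k))), real_of_int (mem s 4 (int (out ! k)))) =
      spiral_layout.pos W (\<lambda>i. kx (out ! i)) (rank out ry) (\<lambda>i. dep (out ! i)) (\<lambda>i. ry (out ! i)) k"
      by simp
  qed
  then show ?thesis
    using t unfolding cell_bound_def output_positions_def by (intro exI[of _ t] exI[of _ s]) auto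
qed

end

theorem theorem3:
  shows "\<exists>(P :: com) (C :: nat) (K :: nat).
    \<forall>(T :: 'a pair_pre_digraph) (\<tau> :: 'a \<Rightarrow> nat) (W :: nat) (vs :: 'a list) (adj :: nat list list).
      graph_story T \<tau> W \<and> undirected_tree T \<and> adjacency_lists T vs adj \<longrightarrow>
      (let n = card (pverts T) in
        \<exists>t s. exec (int (K * (n + W))) P (input_state \<tau> W vs adj) t s \<and> t \<le> C * n \<and>
          (\<exists>\<Gamma>. drawing_story T \<tau> W \<Gamma> \<and> planar_story T \<tau> W \<Gamma> \<and> straight_line_story T \<tau> W \<Gamma> \<and>
               lies_on_grid T \<tau> W (8 * W + 1) (8 * W + 1) \<Gamma> \<and>
               output_positions T \<tau> W vs s \<Gamma>))"
proof (intro exI allI impI)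
  fix T :: "'a pair_pre_digraph" and \<tau> W vs adj
  assume "graph_story T \<tau> W \<and> undirected_tree T \<and> adjacency_lists T vs adj"
  then interpret tree_input T \<tau> W vs adj
    by unfold_locales (auto simp: adjacency_lists_def)
  \<comment> \<open>This instantiates the existential witnesses: the program
    \<open>draw_story\<close>, 100 for the time and 8 for the size of stored values.\<close>
  show "let n = card (pverts T) in
        \<exists>t s. exec (int (8 * (n + W))) draw_story (input_state \<tau> W vs adj) t s \<and> t \<le> 100 * n \<and>
          (\<exists>\<Gamma>. drawing_story T \<tau> W \<Gamma> \<and> planar_story T \<tau> W \<Gamma> \<and> straight_line_story T \<tau> W \<Gamma> \<and>
               lies_on_grid T \<tau> W (8 * W + 1) (8 * W + 1) \<Gamma> \<and>
               output_positions T \<tau> W vs s \<Gamma>)"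
    unfolding Let_def card_verts by (rule drawing_story_computed)
qed

end
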